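(* Let $\{S_i\}_{i=1}^\ell$ be an IFS of contracting similarities on $\mathbb{R}^d$, let $\rho_i\in(0,1)$ be the contraction ratio of $S_i$, let $(p_1,\ldots,p_\ell)$ be a probability vector with all $p_i>0$, and let $\mu$ be the associated self-similar measure. Then: (i) For any finite Borel partition $\mathscr{D}$ of $\mathbb{R}^d$ with respect to $\mu$, \[ \dim(\mu)\geq \frac{\left(\sum_{i=1}^\ell -p_i\log p_i\right) -\sum_{D\in \mathscr{D}} f\left(p_1\mu(S_1^{-1}D),\ldots, p_\ell\mu(S_\ell^{-1}D)\right) }{\sum_{i=1}^\ell -p_i\log \rho_i}; \] consequently, if $y_i(D)\ge 0$ are numbers with $p_i\mu(S_i^{-1}D)\leq y_i(D)$ for all $1\leq i\leq \ell$ and $D\in \mathscr{D}$, then \[ \dim(\mu)\geq \frac{\left(\sum_{i=1}^\ell -p_i\log p_i\right) -\sum_{D\in \mathscr{D}} f\left(y_1(D),\ldots, y_\ell(D)\right) }{\sum_{i=1}^\ell -p_i\log \rho_i}. \] (ii) If $(\mathscr{D}_n)$ is a sequence of finite Borel partitions of $\mathbb{R}^d$ with respect to $\mu$ such that $\max_{D\in \mathscr{D}_n}\operatorname{diam}(D)\to 0$ as $n\to\infty$, then the limit below exists and \[ \dim(\mu)=\frac{\left(\sum_{i=1}^\ell -p_i\log p_i\right) -\lim_{n\to \infty} \sum_{D\in \mathscr{D}_n} f\left(p_1\mu(S_1^{-1}D),\ldots, p_\ell\mu(S_\ell^{-1}D)\right) }{\sum_{i=1}^\ell -p_i\log \rho_i}.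 \]
   Context: The self-similar measure associated with the IFS and the probability vector is the unique Borel probability measure $\mu$ on $\mathbb{R}^d$ with $\mu=\sum_{i=1}^\ell p_i\,\mu\circ S_i^{-1}$. Such $\mu$ is exact dimensional: there is a constant $\dim(\mu)$ with $\lim_{r\to0}\log\mu(B_r(x))/\log r=\dim(\mu)$ for $\mu$-a.e. $x$, where $B_r(x)$ is the closed ball of radius $r$ centred at $x$. Let $\varphi(x)=-x\log x$ for $x>0$ and $\varphi(0)=0$. Define $f\colon[0,\infty)^\ell\to\mathbb{R}$ by $f(x_1,\ldots,x_\ell)=(x_1+\cdots+x_\ell)\sum_{i=1}^\ell\varphi\!\left(\frac{x_i}{x_1+\cdots+x_\ell}\right)$ (with $f(0,\ldots,0)=0$). For a Borel probability measure $\eta$ on $\mathbb{R}^d$, a finite collection $\mathscr{D}$ of Borel subsets of $\mathbb{R}^d$ is a finite Borel partition of $\mathbb{R}^d$ with respect to $\eta$ if $\eta(\bigcup_{D\in\mathscr{D}}D)=1$ and $\eta(D\cap D')=0$ for distinct $D,D'\in\mathscr{D}$. *)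

theory Defs
  imports "HOL-Analysis.Analysis" "HOL-Probability.Probability"
begin

definition similarity_with :: "('a::metric_space \<Rightarrow> 'a) \<Rightarrow> real \<Rightarrow> bool" where
  "similarity_with S r \<longleftrightarrow> (\<forall>x y. dist (S x) (S y) = r * dist x y)"

definition self_similar_measure ::
  "nat \<Rightarrow> (nat \<Rightarrow> 'a::euclidean_space \<Rightarrow> 'a) \<Rightarrow> (nat \<Rightarrow> real) \<Rightarrow> 'a measure \<Rightarrow> bool" where
  "self_similar_measure l S p \<mu> \<longleftrightarrow>
     prob_space \<mu> \<and> sets \<mu> = sets borel \<and>
     (\<forall>A\<in>sets borel. measure \<mu> A = (\<Sum>i<l. p i * measure \<mu> (S i -` A)))"

definition exact_dim :: "'a::euclidean_space measure \<Rightarrow> real \<Rightarrow> bool" where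
  "exact_dim \<mu> s \<longleftrightarrow>
     (AE x in \<mu>. ((\<lambda>r. ln (measure \<mu> (cball x r)) / ln r) \<longlongrightarrow> s) (at_right 0))"

definition dim_meas :: "'a::euclidean_space measure \<Rightarrow> real" where
  "dim_meas \<mu> = (THE s. exact_dim \<mu> s)"

definition phi :: "real \<Rightarrow> real" where
  "phi x = (if x \<le> 0 then 0 else - x * ln x)"

definition fent :: "nat \<Rightarrow> (nat \<Rightarrow> real) \<Rightarrow> real" where
  "fent l x = (let s = (\<Sum>i<l. x i) in
      if s = 0 then 0 else s * (\<Sum>i<l. phi (x i / s)))"

definition borel_partition_wrt :: "'a::euclidean_space measure \<Rightarrow> 'a set set \<Rightarrow> bool" where
  "borel_partition_wrt \<eta> \<D> \<longleftrightarrow> finite \<D> \<and> \<D> \<subseteq> sets borel \<and>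
     measure \<eta> (\<Union>\<D>) = 1 \<and>
     (\<forall>D\<in>\<D>. \<forall>D'\<in>\<D>. D \<noteq> D' \<longrightarrow> measure \<eta> (D \<inter> D') = 0)"

text \<open>Diameter with value infinity for unbounded sets (0 for the empty set).\<close>
definition ediam :: "'a::metric_space set \<Rightarrow> ereal" where
  "ediam D = (if bounded D then ereal (diameter D) else \<infinity>)"

end

theory Submission
  imports Defs
begin

text \<open>
  Code the points of the attractor by random words with independent letters. Let \<open>q\<^sub>i(z)\<close> be the
  density of \<open>p\<^sub>i \<mu> \<circ> S\<^sub>i\<^sup>-\<^sup>1\<close> with respect to \<open>\<mu>\<close>, i.e. the conditional probability of the first letter
  \<open>i\<close> given the coded point \<open>z\<close>, and let \<open>h\<close> be the integral of the entropy of \<open>(q\<^sub>i(z))\<^sub>i\<close>. The dimension is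
  \<open>(H - h) / \<lambda>\<close>, with \<open>H\<close> the entropy of \<open>p\<close> and \<open>\<lambda>\<close> the Lyapunov exponent; exact dimensionality
  comes out of the same argument.

  Both bounds for the local dimension compare the measure of a ball with a product of weights along
  the word, in expectation (so almost surely up to \<open>e\<^bsup>\<epsilon>n\<^esup>\<close>), and read off the exponent with the ergodic theorem.
  For the lower bound of the ball measure the weights are the densities \<open>q\<^sub>i\<close> themselves; for the upper bound
  they are log-Lipschitz approximations of the \<open>q\<^sub>i\<close>, which makes them insensitive to moving the
  base point within the ball, so that neither covering nor differentiation theorems are needed.

  Finally \<open>h\<close> is the infimum of the cross entropies of log-Lipschitz weights, and Gibbs' inequality
  places the entropy of a partition between \<open>h\<close> and such a cross entropy up to its mesh.
\<close>

section \<open>The ergodic theorem for Bernoulli shifts\<close>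

text \<open>The obstacle is overlap: many words of length \<open>n\<close> may lead into the same
  small ball, so the prior mass of a cylinder, the product of the \<open>p (x k)\<close>, says
  little about balls around its points. Bayes' rule supplies the correction. Iterating the
  definition of \<open>posterior\<close>, the product of
  \<open>posterior (x k) (coding (seq_shift k x))\<close> over \<open>k < n\<close> is the
  conditional probability of the first \<open>n\<close> letters given the coded point. If it barely
  changed over a ball of the size of the cylinder, that ball would have measure about prior divided
  by posterior. The means of the two logarithms per letter are \<open>- letter_entropy\<close> and
  \<open>- cond_entropy\<close>, while the radius shrinks at rate \<open>lyapunov\<close>; hence the
  quotient. The posteriors are merely measurable, so this is only a heuristic. One half compares
  words that code the very same point, where measurable densities suffice. In the other half the
  base point moves, but the distances at successive levels decay geometrically, so regular weights
  lose a bounded factor only. The price is a cross entropy in place of \<open>cond_entropy\<close>,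
  a gap that can be made arbitrarily small.\<close>

definition seq_shift :: "nat \<Rightarrow> (nat \<Rightarrow> 'b) \<Rightarrow> nat \<Rightarrow> 'b" where
  "seq_shift k x = (\<lambda>j. x (k + j))"

lemma shift_0 [simp]: "seq_shift 0 x = x"
  by (simp add: seq_shift_def)

lemma shift_shift [simp]: "seq_shift k (seq_shift m x) = seq_shift (m + k) x"
  by (simp add: seq_shift_def add.assoc)

lemma shift_Suc_case_nat [simp]: "seq_shift (Suc k) (case_nat s x) = seq_shift k x"
  by (simp add: seq_shift_def)

definition birkhoff_sum :: "((nat \<Rightarrow> 'b) \<Rightarrow> real) \<Rightarrow> nat \<Rightarrow> (nat \<Rightarrow> 'b) \<Rightarrow> real" where
  "birkhoff_sum f n x = (\<Sum>k<n. f (seq_shift k x))"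

lemma birkhoff_sum_Suc: "birkhoff_sum f (Suc n) x = f x + birkhoff_sum f n (seq_shift 1 x)"
  unfolding birkhoff_sum_def by (subst sum.lessThan_Suc_shift) simp

text \<open>The maximum of \<open>0\<close> and the partial sums of lengths \<open>1\<close> to
  \<open>n\<close>, given by a recursion through the shift because the maximal argument compares
  \<open>birkhoff_max f (Suc n)\<close> with the shifted \<open>birkhoff_max f n\<close>.\<close>

primrec birkhoff_max :: "((nat \<Rightarrow> 'b) \<Rightarrow> real) \<Rightarrow> nat \<Rightarrow> (nat \<Rightarrow> 'b) \<Rightarrow> real" where
  "birkhoff_max f 0 x = 0"
| "birkhoff_max f (Suc n) x = max 0 (f x + birkhoff_max f n (seq_shift 1 x))"

lemma birkhoff_max_nonneg: "0 \<le> birkhoff_max f n x"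
  by (cases n) auto

lemma birkhoff_max_mono: "m \<le> n \<Longrightarrow> birkhoff_max f m x \<le> birkhoff_max f n x"
proof (induction m arbitrary: n x)
  case (Suc m)
  then obtain n' where "n = Suc n'" "m \<le> n'" by (cases n) auto
  with Suc.IH[of n' "seq_shift 1 x"] show ?case by (simp add: max_def)
qed (simp add: birkhoff_max_nonneg)

lemma birkhoff_sum_le_max: "birkhoff_sum f n x \<le> birkhoff_max f n x"
proof (induction n arbitrary: x)
  case (Suc n)
  show ?case using Suc[of "seq_shift 1 x"] by (simp add: birkhoff_sum_Suc)
qed (simp add: birkhoff_sum_def)

context sequence_space
begin

lemma shift_measurable [measurable]: "seq_shift k \<in> measurable S S"
  by (rule measurable_PiM_single') (auto simp: seq_shift_def space_PiM)

lemma shift_in_space: "x \<in> space S \<Longrightarrow> seq_shift k x \<in> space S"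
  by (rule measurable_space[OF shift_measurable])

lemma case_nat_in_space: "s \<in> space M \<Longrightarrow> x \<in> space S \<Longrightarrow> case_nat s x \<in> space S"
  by (auto simp: space_PiM PiE_iff split: nat.split)

text \<open>The product measure is the image of letter times tail under prefixing. Later inductions
  on the number of letters split off the first one through this identity or its finite form
  \<open>nn_integral_P\<close>.\<close>

lemma nn_integral_case_nat:
  assumes [measurable]: "f \<in> borel_measurable S"
  shows "(\<integral>\<^sup>+x. f x \<partial>S) = (\<integral>\<^sup>+s. (\<integral>\<^sup>+x. f (case_nat s x) \<partial>S) \<partial>M)"
proof -
  have "(\<integral>\<^sup>+x. f x \<partial>S) = (\<integral>\<^sup>+x. f x \<partial>distr (M \<Otimes>\<^sub>M S) S (\<lambda>(s, \<omega>). case_nat s \<omega>))"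
    by (simp add: PiM_iter)
  also have "\<dots> = (\<integral>\<^sup>+(s, x). f (case_nat s x) \<partial>(M \<Otimes>\<^sub>M S))"
    by (subst nn_integral_distr) (auto intro!: nn_integral_cong)
  also have "\<dots> = (\<integral>\<^sup>+s. (\<integral>\<^sup>+x. f (case_nat s x) \<partial>S) \<partial>M)"
    by (subst P.nn_integral_fst[symmetric]) auto
  finally show ?thesis .
qed

lemma nn_integral_shift:
  assumes [measurable]: "f \<in> borel_measurable S"
  shows "(\<integral>\<^sup>+x. f (seq_shift k x) \<partial>S) = (\<integral>\<^sup>+x. f x \<partial>S)"
proof (induction k)
  case (Suc k)
  have "(\<integral>\<^sup>+x. f (seq_shift (Suc k) x) \<partial>S) = (\<integral>\<^sup>+s. (\<integral>\<^sup>+x. f (seq_shift k x) \<partial>S) \<partial>M)"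
    by (subst nn_integral_case_nat) auto
  then show ?case
    using Suc M.emeasure_space_1 by simp
qed simp

lemma distr_shift: "distr S S (seq_shift k) = S"
proof (rule measure_eqI)
  fix A assume [measurable]: "A \<in> sets (distr S S (seq_shift k))"
  then have [measurable]: "A \<in> sets S" by simp
  have "emeasure (distr S S (seq_shift k)) A = (\<integral>\<^sup>+x. indicator A x \<partial>distr S S (seq_shift k))"
    by simp
  also have "\<dots> = (\<integral>\<^sup>+x. indicator A (seq_shift k x) \<partial>S)"
    by (rule nn_integral_distr) auto
  also have "\<dots> = emeasure S A"
    by (subst nn_integral_shift) auto
  finally show "emeasure (distr S S (seq_shift k)) A = emeasure S A" .
qed simp

lemma integrable_shift:
  fixes f :: "_ \<Rightarrow> real"
  assumes "integrable S f"
  shows "integrable S (\<lambda>x. f (seq_shift k x))"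
  by (rule integrable_distr[OF shift_measurable]) (simp add: distr_shift assms)

lemma integral_shift:
  fixes f :: "_ \<Rightarrow> real"
  assumes [measurable]: "f \<in> borel_measurable S"
  shows "(\<integral>x. f (seq_shift k x) \<partial>S) = (\<integral>x. f x \<partial>S)"
  by (subst (2) distr_shift[symmetric, of k], rule integral_distr[symmetric]) auto

lemma AE_shift:
  assumes "AE x in S. Q x"
  shows "AE x in S. Q (seq_shift k x)"
proof (rule AE_distrD[OF shift_measurable])
  show "AE x in distr S S (seq_shift k). Q x"
    using assms by (subst distr_shift)
qed

text \<open>Prefixing a letter does not affect membership in an invariant set, so the letters on
  which \<open>f\<close> depends can be integrated out one at a time until \<open>f\<close> is
  constant. Thus \<open>E\<close> is independent of everything decided by finitely many
  letters.\<close>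

lemma nn_integral_invariant_mult:
  assumes [measurable]: "E \<in> sets S" "f \<in> borel_measurable S"
    and inv: "\<And>x. x \<in> space S \<Longrightarrow> seq_shift 1 x \<in> E \<longleftrightarrow> x \<in> E"
    and fin: "\<And>x y. x \<in> space S \<Longrightarrow> y \<in> space S \<Longrightarrow> (\<forall>k<n. x k = y k) \<Longrightarrow> f x = f y"
  shows "(\<integral>\<^sup>+x. indicator E x * f x \<partial>S) = emeasure S E * (\<integral>\<^sup>+x. f x \<partial>S)"
  using assms(2) fin
proof (induction n arbitrary: f)
  case 0
  obtain x0 where "x0 \<in> space S" using P.not_empty by blast
  then have "f x = f x0" if "x \<in> space S" for x
    by (intro 0(2) that) simp_all
  note const = this
  have "(\<integral>\<^sup>+x. indicator E x * f x \<partial>S) = (\<integral>\<^sup>+x. f x0 * indicator E x \<partial>S)"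
    by (rule nn_integral_cong) (simp add: const mult.commute)
  moreover have "(\<integral>\<^sup>+x. f x \<partial>S) = (\<integral>\<^sup>+x. f x0 \<partial>S)"
    by (rule nn_integral_cong) (rule const)
  ultimately show ?case
    using P.emeasure_space_1 by (simp add: nn_integral_cmult mult.commute)
next
  case (Suc n)
  note [measurable] = Suc.prems(1)
  have ind: "indicator E (case_nat s x) = (indicator E x :: ennreal)"
    if "s \<in> space M" "x \<in> space S" for s x
    using inv[OF case_nat_in_space[OF that]] by (auto simp: indicator_def)
  have "(\<integral>\<^sup>+x. indicator E x * f x \<partial>S)
      = (\<integral>\<^sup>+s. (\<integral>\<^sup>+x. indicator E (case_nat s x) * f (case_nat s x) \<partial>S) \<partial>M)"
    by (rule nn_integral_case_nat) auto
  also have "\<dots> = (\<integral>\<^sup>+s. (\<integral>\<^sup>+x. indicator E x * f (case_nat s x) \<partial>S) \<partial>M)"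
    by (intro nn_integral_cong) (simp add: ind)
  also have "\<dots> = (\<integral>\<^sup>+s. emeasure S E * (\<integral>\<^sup>+x. f (case_nat s x) \<partial>S) \<partial>M)"
  proof (rule nn_integral_cong)
    fix s assume s: "s \<in> space M"
    then have [measurable]: "(\<lambda>x. f (case_nat s x)) \<in> borel_measurable S" by measurable
    show "(\<integral>\<^sup>+x. indicator E x * f (case_nat s x) \<partial>S) = emeasure S E * (\<integral>\<^sup>+x. f (case_nat s x) \<partial>S)"
    proof (rule Suc.IH)
      fix x y assume "x \<in> space S" "y \<in> space S" "\<forall>k<n. x k = y k"
      then show "f (case_nat s x) = f (case_nat s y)"
        by (intro Suc.prems(2) case_nat_in_space s) (auto split: nat.split)
    qed measurable
  qed
  also have "\<dots> = emeasure S E * (\<integral>\<^sup>+x. f x \<partial>S)"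
    by (subst nn_integral_case_nat[of f]) (auto intro!: nn_integral_cmult)
  finally show ?case .
qed

text \<open>Zero-one law: by the independence just shown, conditioning on \<open>E\<close> changes
  no cylinder probability, so the conditioned measure is the product measure itself, and it gives
  \<open>E\<close> mass one.\<close>

lemma ergodic_shift:
  assumes E [measurable]: "E \<in> sets S"
    and inv: "\<And>x. x \<in> space S \<Longrightarrow> seq_shift 1 x \<in> E \<longleftrightarrow> x \<in> E"
    and pos: "emeasure S E \<noteq> 0"
  shows "emeasure S E = 1"
proof -
  have fin: "emeasure S E \<noteq> \<infinity>" by simp
  have "uniform_measure S E = S"
  proof (rule PiM_eq)
    fix J :: "nat set" and F assume J: "finite J" "\<And>j. j \<in> J \<Longrightarrow> F j \<in> sets M"
    let ?A = "prod_emb UNIV (\<lambda>_. M) J (\<Pi>\<^sub>E j\<in>J. F j)"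
    have [measurable]: "?A \<in> sets S" using J by (intro sets_PiM_I) auto
    obtain n where n: "\<forall>j\<in>J. j < n" using J(1) finite_nat_iff_bounded by auto
    have "emeasure (uniform_measure S E) ?A = emeasure S (E \<inter> ?A) / emeasure S E"
      by (rule emeasure_uniform_measure) auto
    also have "emeasure S (E \<inter> ?A) = (\<integral>\<^sup>+x. indicator E x * indicator ?A x \<partial>S)"
      by (simp flip: indicator_inter_arith)
    also have "\<dots> = emeasure S E * (\<integral>\<^sup>+x. indicator ?A x \<partial>S)"
    proof (rule nn_integral_invariant_mult[where n = n])
      fix x y assume "x \<in> space S" "y \<in> space S" "\<forall>k<n. x k = y k"
      then show "indicator ?A x = (indicator ?A y :: ennreal)"
        using n by (auto simp: indicator_def prod_emb_def space_PiM restrict_def PiE_iff extensional_def)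
    qed (use inv in simp_all)
    also have "\<dots> / emeasure S E = emeasure S ?A"
      by (subst mult.commute, subst mult_divide_eq_ennreal) (use pos fin in simp_all)
    also have "\<dots> = (\<Prod>j\<in>J. emeasure M (F j))"
      using J by (intro emeasure_PiM_emb) auto
    finally show "emeasure (uniform_measure S E) ?A = (\<Prod>j\<in>J. emeasure M (F j))" .
  qed simp
  moreover have "emeasure (uniform_measure S E) E = 1"
    using pos by (subst emeasure_uniform_measure) (simp_all add: P.emeasure_eq_measure)
  ultimately show ?thesis by simp
qed

lemma birkhoff_max_measurable [measurable]:
  assumes [measurable]: "f \<in> borel_measurable S"
  shows "birkhoff_max f n \<in> borel_measurable S"
  by (induction n) simp_all

lemma integrable_birkhoff_max:
  assumes f: "integrable S f"
  shows "integrable S (birkhoff_max f n)"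
proof (induction n)
  case (Suc n)
  then show ?case
    by (auto intro!: integrable_max Bochner_Integration.integrable_add f integrable_shift)
qed simp

text \<open>
  The set where the partial sums are unbounded above is invariant, and on it
  \<open>max\<close> over \<open>n + 1\<close> sums minus the shifted \<open>max\<close> over \<open>n\<close> sums decreases to \<open>f\<close>.
\<close>

lemma birkhoff_sum_bounded_above:
  assumes f: "integrable S f" and neg: "(\<integral>x. f x \<partial>S) < 0"
  shows "AE x in S. \<exists>K. \<forall>n. birkhoff_sum f n x \<le> K"
proof -
  have [measurable]: "f \<in> borel_measurable S" using f by simp
  define E where "E = {x \<in> space S. \<forall>K::nat. \<exists>n. birkhoff_max f n x > real K}"
  have [measurable]: "E \<in> sets S" unfolding E_def by measurable
  have unbdd: "(\<exists>n. birkhoff_max f n x > K)" if xE: "x \<in> E" for x K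
  proof -
    obtain K' :: nat where "K < real K'" using reals_Archimedean2 by blast
    moreover obtain n where "birkhoff_max f n x > real K'" using xE unfolding E_def by blast
    ultimately show ?thesis by (intro exI[of _ n]) linarith
  qed
  have inv: "seq_shift 1 x \<in> E \<longleftrightarrow> x \<in> E" if x: "x \<in> space S" for x
  proof
    assume T: "seq_shift 1 x \<in> E"
    have "\<exists>n. birkhoff_max f n x > real K" for K
    proof -
      obtain n where "birkhoff_max f n (seq_shift 1 x) > real K - f x" using unbdd[OF T] by blast
      then show ?thesis by (intro exI[of _ "Suc n"]) auto
    qed
    then show "x \<in> E" using x by (auto simp: E_def)
  next
    assume xE: "x \<in> E"
    have "\<exists>n. birkhoff_max f n (seq_shift 1 x) > real K" for K
    proof -
      obtain n where n: "birkhoff_max f n x > max 0 (real K + f x)" using unbdd[OF xE] by blast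
      then obtain m where "n = Suc m" by (cases n) auto
      then show ?thesis using n by (intro exI[of _ m]) (auto simp: max_def split: if_splits)
    qed
    then show "seq_shift 1 x \<in> E" using shift_in_space[OF x] by (auto simp: E_def)
  qed
  have "emeasure S E = 0"
  proof (rule ccontr)
    assume "emeasure S E \<noteq> 0"
    then have "emeasure S E = 1" by (intro ergodic_shift inv) auto
    then have aeE: "AE x in S. x \<in> E"
      by (subst P.AE_in_set_eq_1) (auto simp: P.emeasure_eq_measure)
    define d where "d n x = birkhoff_max f (Suc n) x - birkhoff_max f n (seq_shift 1 x)" for n x
    have d_eq: "d n x = max (- birkhoff_max f n (seq_shift 1 x)) (f x)" for n x
      unfolding d_def by (simp add: max_def)
    have [measurable]: "d n \<in> borel_measurable S" for n
      unfolding d_def by measurable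
    have "(\<lambda>n. \<integral>x. d n x \<partial>S) \<longlonglongrightarrow> (\<integral>x. f x \<partial>S)"
    proof (rule integral_dominated_convergence[where w = "\<lambda>x. norm (f x)"])
      show "AE x in S. (\<lambda>n. d n x) \<longlonglongrightarrow> f x"
      proof (use aeE AE_space in eventually_elim)
        case (elim x)
        then have "seq_shift 1 x \<in> E" using inv by blast
        then obtain m where m: "birkhoff_max f m (seq_shift 1 x) > - f x" using unbdd by blast
        have "d n x = f x" if "n \<ge> m" for n
          using birkhoff_max_mono[OF that, of f "seq_shift 1 x"] m unfolding d_eq by auto
        then show ?case
          by (intro tendsto_eventually) (auto simp: eventually_sequentially)
      qed
      show "AE x in S. norm (d n x) \<le> norm (f x)" for n
      proof (rule AE_I2)
        fix x
        show "norm (d n x) \<le> norm (f x)"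
          unfolding d_eq using birkhoff_max_nonneg[of f n "seq_shift 1 x"] by (simp add: max_def abs_if)
      qed
    qed (use f in auto)
    \<comment> \<open>Shift invariance turns the integral of \<open>d n\<close> into that of
      \<open>birkhoff_max f (Suc n) x - birkhoff_max f n x\<close>, which is pointwise nonnegative.
      In the limit this contradicts the negative mean.\<close>
    moreover have "0 \<le> (\<integral>x. d n x \<partial>S)" for n
    proof -
      have "(\<integral>x. d n x \<partial>S) = (\<integral>x. birkhoff_max f (Suc n) x \<partial>S) - (\<integral>x. birkhoff_max f n (seq_shift 1 x) \<partial>S)"
        unfolding d_def
        by (intro Bochner_Integration.integral_diff integrable_birkhoff_max f integrable_shift)
      moreover have "(\<integral>x. birkhoff_max f n (seq_shift 1 x) \<partial>S) = (\<integral>x. birkhoff_max f n x \<partial>S)"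
        by (intro integral_shift) simp
      moreover have "(\<integral>x. birkhoff_max f n x \<partial>S) \<le> (\<integral>x. birkhoff_max f (Suc n) x \<partial>S)"
        by (intro integral_mono integrable_birkhoff_max f birkhoff_max_mono) auto
      ultimately show ?thesis by linarith
    qed
    ultimately have "0 \<le> (\<integral>x. f x \<partial>S)"
      by (intro tendsto_lowerbound) auto
    with neg show False by simp
  qed
  then have notin: "AE x in S. x \<notin> E"
    by (intro AE_not_in) (auto simp: null_sets_def)
  show ?thesis
  proof (use notin AE_space in eventually_elim)
    case (elim x)
    then obtain K :: nat where "\<forall>n. birkhoff_max f n x \<le> real K"
      by (auto simp: E_def not_less)
    then show ?case
      using birkhoff_sum_le_max[of f _ x] by (meson order_trans)
  qed
qed

text \<open>Lowering \<open>f\<close> by a constant \<open>c'\<close> strictly between its mean and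
  \<open>c\<close> keeps the mean negative, so the lowered sums are bounded, and the bound is
  absorbed by \<open>(c - c') * n\<close>. Lower bounds come from applying this to the negated
  function.\<close>

lemma birkhoff_sum_eventually_le:
  assumes f: "integrable S f" and less: "(\<integral>x. f x \<partial>S) < c"
  shows "AE x in S. \<forall>\<^sub>F n in sequentially. birkhoff_sum f n x \<le> c * real n"
proof -
  obtain c' where c': "(\<integral>x. f x \<partial>S) < c'" "c' < c" using less dense by blast
  have "AE x in S. \<exists>K. \<forall>n. birkhoff_sum (\<lambda>x. f x - c') n x \<le> K"
    using f c' P.prob_space by (intro birkhoff_sum_bounded_above) auto
  then show ?thesis
  proof eventually_elim
    case (elim x)
    then obtain K where K: "\<And>n. birkhoff_sum f n x - real n * c' \<le> K"
      by (auto simp: birkhoff_sum_def sum_subtractf)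
    obtain N :: nat where "K / (c - c') < real N" using reals_Archimedean2 by blast
    then have N: "K < real N * (c - c')" using c' by (simp add: divide_simps)
    have "birkhoff_sum f n x \<le> c * real n" if "n \<ge> N" for n
    proof -
      have "K < real n * (c - c')"
        using N that c' by (smt (verit) mult_right_mono of_nat_mono)
      with K[of n] show ?thesis by (simp add: algebra_simps)
    qed
    then show ?case by (auto simp: eventually_sequentially)
  qed
qed

text \<open>Markov's inequality and Borel-Cantelli in one step: the series of the \<open>F n\<close>
  weighted by \<open>exp (- e) ^ n\<close> has finite expectation, so it converges almost surely and
  its terms eventually fall below one.\<close>

lemma AE_eventually_le_exp:
  fixes F :: "nat \<Rightarrow> (nat \<Rightarrow> 'a) \<Rightarrow> ennreal"
  assumes [measurable]: "\<And>n. F n \<in> borel_measurable S"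
    and bound: "\<And>n. (\<integral>\<^sup>+x. F n x \<partial>S) \<le> ennreal C" and "0 < e"
  shows "AE x in S. \<forall>\<^sub>F n in sequentially. F n x \<le> ennreal (exp (e * real n))"
proof -
  have sm: "summable (\<lambda>n. exp (- e) ^ n)"
    using \<open>0 < e\<close> by (intro summable_geometric) auto
  have "(\<integral>\<^sup>+x. (\<Sum>n. ennreal (exp (- e) ^ n) * F n x) \<partial>S)
      = (\<Sum>n. ennreal (exp (- e) ^ n) * (\<integral>\<^sup>+x. F n x \<partial>S))"
    by (subst nn_integral_suminf) (auto simp: nn_integral_cmult)
  also have "\<dots> \<le> (\<Sum>n. ennreal (exp (- e) ^ n) * ennreal C)"
    by (intro suminf_le mult_left_mono bound) auto
  also have "\<dots> = ennreal (\<Sum>n. exp (- e) ^ n) * ennreal C"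
    using sm by (simp add: suminf_ennreal2)
  also have "\<dots> < \<infinity>"
    by (simp add: ennreal_mult_less_top)
  finally have "AE x in S. (\<Sum>n. ennreal (exp (- e) ^ n) * F n x) \<noteq> \<infinity>"
    by (intro nn_integral_PInf_AE) auto
  then show ?thesis
  proof eventually_elim
    case (elim x)
    define a where "a n = ennreal (exp (- e) ^ n) * F n x" for n
    have sum: "(\<Sum>n. a n) \<noteq> \<infinity>" using elim by (simp add: a_def)
    have "a n \<noteq> \<infinity>" for n
      using sum ennreal_suminf_lessD[of a \<infinity> n] by (auto simp: top.not_eq_extremum)
    then have a_eq: "a n = ennreal (enn2real (a n))" for n
      by (simp add: top.not_eq_extremum)
    have "summable (\<lambda>n. enn2real (a n))"
      using sum a_eq by (intro summable_suminf_not_top) auto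
    then have "(\<lambda>n. enn2real (a n)) \<longlonglongrightarrow> 0"
      by (rule summable_LIMSEQ_zero)
    then have "\<forall>\<^sub>F n in sequentially. enn2real (a n) < 1"
      by (rule order_tendstoD) simp
    then show ?case
    proof eventually_elim
      case (elim n)
      have "exp (e * real n) * exp (- e) ^ n = exp (e * real n + real n * (- e))"
        by (simp only: exp_add exp_of_nat_mult)
      then have one: "ennreal (exp (e * real n)) * ennreal (exp (- e) ^ n) = 1"
        by (simp flip: ennreal_mult)
      have "F n x = ennreal (exp (e * real n)) * a n"
        unfolding a_def by (simp only: mult.assoc[symmetric] one) simp
      also have "a n \<le> ennreal 1"
        by (subst a_eq) (use elim in \<open>intro ennreal_leI; simp\<close>)
      then have "ennreal (exp (e * real n)) * a n \<le> ennreal (exp (e * real n)) * 1"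
        by (intro mult_left_mono) auto
      finally show ?case by simp
    qed
  qed
qed

end

section \<open>Real analysis\<close>

lemma fent_eq:
  assumes "\<And>i. i < l \<Longrightarrow> 0 \<le> x i"
  shows "fent l x = (\<Sum>i<l. - x i * ln (x i / (\<Sum>i<l. x i)))"
proof (cases "(\<Sum>i<l. x i) = 0")
  case True
  then have "\<forall>i<l. x i = 0"
    using assms by (subst (asm) sum_nonneg_eq_0_iff) auto
  then show ?thesis using True by (simp add: fent_def)
next
  case False
  then have pos: "(\<Sum>i<l. x i) > 0"
    using assms by (auto intro!: sum_nonneg simp: order_less_le)
  have "(\<Sum>i<l. x i) * phi (x j / (\<Sum>i<l. x i)) = - x j * ln (x j / (\<Sum>i<l. x i))" if "j < l" for j
    using assms[OF that] pos by (cases "x j = 0") (auto simp: phi_def divide_le_0_iff)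
  then show ?thesis
    using False by (simp add: fent_def Let_def sum_distrib_left)
qed

text \<open>Gibbs' inequality for an unnormalised vector with sum \<open>s\<close>: use
  \<open>ln t <= t - 1\<close> at \<open>t = g i * s / x i\<close> and add up. The last hypothesis
  rules out terms whose true value would be infinite but which \<open>ln 0\<close> would
  hide.\<close>

lemma fent_le_cross_entropy:
  assumes x: "\<And>i. i < l \<Longrightarrow> 0 \<le> x i" and g: "\<And>i. i < l \<Longrightarrow> 0 \<le> g i"
    and sum: "(\<Sum>i<l. g i) \<le> 1" and ac: "\<And>i. i < l \<Longrightarrow> g i = 0 \<Longrightarrow> x i = 0"
  shows "fent l x \<le> (\<Sum>i<l. - x i * ln (g i))"
proof -
  define s where "s = (\<Sum>i<l. x i)"
  have s: "0 \<le> s" unfolding s_def using x by (auto intro!: sum_nonneg)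
  have "x i * ln (g i) - x i * ln (x i / s) \<le> s * g i - x i" if i: "i < l" for i
  proof (cases "x i = 0")
    case True
    then show ?thesis using s g[OF i] by simp
  next
    case False
    then have pos: "0 < x i" "0 < g i" using x[OF i] g[OF i] ac[OF i] by (auto simp: order_less_le)
    then have "0 < s"
      unfolding s_def using x i by (intro sum_pos2[of _ i]) auto
    have "x i * ln (g i) - x i * ln (x i / s) = x i * ln (g i * s / x i)"
      using pos \<open>0 < s\<close> by (simp add: ln_div ln_mult algebra_simps)
    also have "\<dots> \<le> x i * (g i * s / x i - 1)"
      using pos \<open>0 < s\<close> by (intro mult_left_mono ln_le_minus_one) auto
    also have "\<dots> = s * g i - x i"
      using pos by (simp add: field_simps)
    finally show ?thesis .
  qed
  then have "(\<Sum>i<l. x i * ln (g i) - x i * ln (x i / s)) \<le> (\<Sum>i<l. s * g i - x i)"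
    by (intro sum_mono) auto
  also have "\<dots> = s * (\<Sum>i<l. g i) - s"
    by (simp add: sum_subtractf sum_distrib_left s_def)
  also have "\<dots> \<le> 0"
    using mult_left_mono[OF sum s] by simp
  finally show ?thesis
    using x by (subst fent_eq) (simp_all add: sum_subtractf sum_negf s_def)
qed

text \<open>Take the normalised \<open>y\<close> as weights in Gibbs' inequality. Their negative
  logarithms are nonnegative, so replacing the coefficients \<open>x i\<close> by the larger
  \<open>y i\<close> only increases the sum, which is then the entropy of \<open>y\<close>.\<close>

lemma fent_mono:
  assumes xy: "\<And>i. i < l \<Longrightarrow> 0 \<le> x i \<and> x i \<le> y i"
  shows "fent l x \<le> fent l y"
proof -
  define s where "s = (\<Sum>i<l. y i)"
  have y: "0 \<le> y i" if "i < l" for i using xy[OF that] by linarith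
  have s: "0 \<le> s" "y i \<le> s" if "i < l" for i
    unfolding s_def using y that by (auto intro!: sum_nonneg member_le_sum)
  have le1: "y i / s \<le> 1" "0 \<le> y i / s" if "i < l" for i
    using s[OF that] y[OF that] by (auto simp: divide_le_eq_1 order_less_le)
  have "fent l x \<le> (\<Sum>i<l. - x i * ln (y i / s))"
  proof (rule fent_le_cross_entropy)
    show "(\<Sum>i<l. y i / s) \<le> 1"
      by (simp flip: sum_divide_distrib s_def)
    show "x i = 0" if "i < l" "y i / s = 0" for i
      using that xy[of i] s[of i] y[of i] by auto
  qed (use xy le1 in auto)
  also have "\<dots> \<le> (\<Sum>i<l. - y i * ln (y i / s))"
  proof (rule sum_mono)
    fix i assume "i \<in> {..<l}"
    then have i: "i < l" by simp
    have "ln (y i / s) \<le> 0"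
      using le1[OF i] by (cases "y i / s = 0") (auto simp: ln_le_zero_iff order_less_le)
    then have "y i * ln (y i / s) \<le> x i * ln (y i / s)"
      using xy[OF i] by (intro mult_right_mono_neg) auto
    then show "- x i * ln (y i / s) \<le> - y i * ln (y i / s)" by simp
  qed
  also have "\<dots> = fent l y"
    using y by (subst fent_eq) (simp_all add: s_def)
  finally show ?thesis .
qed

section \<open>From geometric sequences of radii to all radii\<close>

lemma eventually_ln_less: "\<forall>\<^sub>F r in at_right 0. ln r < (B::real)"
  using ln_at_0 by (auto simp: filterlim_at_bot_dense)

text \<open>Writing \<open>r = C * exp (- k * t)\<close> and rounding \<open>t\<close> to an integer
  changes the logarithms by a bounded amount only, which the gap between \<open>c\<close> and
  \<open>a / k\<close> absorbs as \<open>ln r\<close> tends to minus infinity. Division by the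
  negative \<open>ln r\<close> turns an upper bound for \<open>m\<close> into a lower bound for the
  ratio.\<close>

lemma ratio_gt_from_geometric_radii:
  fixes m :: "real \<Rightarrow> real"
  assumes mono: "\<And>r s. 0 < r \<Longrightarrow> r \<le> s \<Longrightarrow> m r \<le> m s" and pos: "\<And>r. 0 < r \<Longrightarrow> 0 < m r"
    and "0 < C" "0 < k"
    and ev: "\<forall>\<^sub>F n in sequentially. ln (m (C * exp (- k * real n))) \<le> - a * real n"
    and c: "c < a / k"
  shows "\<forall>\<^sub>F r in at_right 0. c < ln (m r) / ln r"
proof -
  obtain N where N: "\<And>n. n \<ge> N \<Longrightarrow> ln (m (C * exp (- k * real n))) \<le> - a * real n"
    using ev by (auto simp: eventually_sequentially)
  \<comment> \<open>The absolute value pays for rounding \<open>t\<close> down, whatever the sign of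
    \<open>a\<close>; the other term comes from \<open>C\<close>.\<close>
  define K where "K = \<bar>a\<bar> - a / k * ln C"
  have "\<forall>\<^sub>F r in at_right 0. ln r < ln C - k * real (Suc N)"
    "\<forall>\<^sub>F r in at_right 0. ln r < - (\<bar>K\<bar> / (a / k - c))"
    "\<forall>\<^sub>F r in at_right (0::real). ln r < 0" "\<forall>\<^sub>F r in at_right (0::real). 0 < r"
    by (auto intro: eventually_ln_less simp: eventually_at_right_less)
  then show ?thesis
  proof eventually_elim
    case (elim r)
    define t where "t = (ln C - ln r) / k"
    define n where "n = nat \<lfloor>t\<rfloor>"
    have t: "real N + 1 < t"
      using elim \<open>0 < k\<close> by (simp add: t_def field_simps)
    then have n: "real n \<le> t" "t < real n + 1" "N \<le> n"
      unfolding n_def by linarith+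
    have "r = C * exp (- k * t)"
      using \<open>0 < C\<close> \<open>0 < k\<close> elim by (simp add: t_def exp_diff)
    also have "\<dots> \<le> C * exp (- k * real n)"
      using n \<open>0 < C\<close> \<open>0 < k\<close> by simp
    finally have "ln (m r) \<le> ln (m (C * exp (- k * real n)))"
      using elim by (intro ln_mono mono pos) auto
    also have "\<dots> \<le> - a * real n" by (rule N) fact
    also have "\<dots> \<le> - a * t + \<bar>a\<bar>"
    proof -
      have "a * (t - real n) \<le> \<bar>a\<bar> * (t - real n)"
        using n by (intro mult_right_mono) auto
      also have "\<dots> \<le> \<bar>a\<bar> * 1"
        using n by (intro mult_left_mono) auto
      finally show ?thesis by (simp add: algebra_simps)
    qed
    also have "\<dots> = a / k * ln r + K"
      by (simp add: t_def K_def diff_divide_distrib algebra_simps)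
    also have "\<dots> < c * ln r"
    proof -
      have "\<bar>K\<bar> / (a / k - c) < - ln r" using elim(2) by linarith
      then have "\<bar>K\<bar> < - ln r * (a / k - c)"
        using c by (subst (asm) pos_divide_less_eq) auto
      then show ?thesis by (simp add: algebra_simps)
    qed
    finally show ?case
      using elim by (simp add: neg_less_divide_eq)
  qed
qed

lemma ratio_less_from_geometric_radii:
  fixes m :: "real \<Rightarrow> real"
  assumes mono: "\<And>r s. 0 < r \<Longrightarrow> r \<le> s \<Longrightarrow> m r \<le> m s" and pos: "\<And>r. 0 < r \<Longrightarrow> 0 < m r"
    and "0 < C" "0 < k"
    and ev: "\<forall>\<^sub>F n in sequentially. - a * real n \<le> ln (m (C * exp (- k * real n)))"
    and c: "a / k < c"
  shows "\<forall>\<^sub>F r in at_right 0. ln (m r) / ln r < c"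
proof -
  obtain N where N: "\<And>n. n \<ge> N \<Longrightarrow> - a * real n \<le> ln (m (C * exp (- k * real n)))"
    using ev by (auto simp: eventually_sequentially)
  define K where "K = \<bar>a\<bar> + a / k * ln C"
  have "\<forall>\<^sub>F r in at_right 0. ln r < ln C - k * real (Suc N)"
    "\<forall>\<^sub>F r in at_right 0. ln r < - (\<bar>K\<bar> / (c - a / k))"
    "\<forall>\<^sub>F r in at_right (0::real). ln r < 0" "\<forall>\<^sub>F r in at_right (0::real). 0 < r"
    by (auto intro: eventually_ln_less simp: eventually_at_right_less)
  then show ?thesis
  proof eventually_elim
    case (elim r)
    define t where "t = (ln C - ln r) / k"
    \<comment> \<open>Rounded up this time, so that the geometric radius is at most
      \<open>r\<close>.\<close>
    define n where "n = nat \<lceil>t\<rceil>"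
    have t: "real N + 1 < t"
      using elim \<open>0 < k\<close> by (simp add: t_def field_simps)
    then have n: "t \<le> real n" "real n < t + 1" "N \<le> n"
      unfolding n_def by linarith+
    have "a / k * ln r - K = - a * t - \<bar>a\<bar>"
      by (simp add: t_def K_def diff_divide_distrib algebra_simps)
    also have "\<dots> \<le> - a * real n"
    proof -
      have "a * (real n - t) \<le> \<bar>a\<bar> * (real n - t)"
        using n by (intro mult_right_mono) auto
      also have "\<dots> \<le> \<bar>a\<bar> * 1"
        using n by (intro mult_left_mono) auto
      finally show ?thesis by (simp add: algebra_simps)
    qed
    also have "\<dots> \<le> ln (m (C * exp (- k * real n)))" by (rule N) fact
    also have "\<dots> \<le> ln (m r)"
    proof -
      have "C * exp (- k * real n) \<le> C * exp (- k * t)"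
        using n \<open>0 < C\<close> \<open>0 < k\<close> by simp
      also have "\<dots> = r"
        using \<open>0 < C\<close> \<open>0 < k\<close> elim by (simp add: t_def exp_diff)
      finally show ?thesis
        using \<open>0 < C\<close> by (intro ln_mono mono pos) auto
    qed
    finally have "a / k * ln r - K \<le> ln (m r)" .
    moreover have "c * ln r < a / k * ln r - K"
    proof -
      have "\<bar>K\<bar> / (c - a / k) < - ln r" using elim(2) by linarith
      then have "\<bar>K\<bar> < - ln r * (c - a / k)"
        using c by (subst (asm) pos_divide_less_eq) auto
      then show ?thesis by (simp add: algebra_simps)
    qed
    ultimately show ?case
      using elim by (simp add: neg_divide_less_eq)
  qed
qed

section \<open>Lipschitz functions are dense in L1\<close>

definition bump :: "nat \<Rightarrow> 'a::metric_space set \<Rightarrow> 'a \<Rightarrow> real" where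
  "bump n K x = max 0 (1 - real n * infdist x K)"

lemma bump_lipschitz: "\<bar>bump n K x - bump n K y\<bar> \<le> real n * dist x y"
proof -
  have "\<bar>bump n K x - bump n K y\<bar> \<le> \<bar>real n * infdist x K - real n * infdist y K\<bar>"
    unfolding bump_def by linarith
  also have "\<dots> = real n * \<bar>infdist x K - infdist y K\<bar>"
    by (simp add: abs_mult flip: right_diff_distrib)
  also have "\<dots> \<le> real n * dist x y"
    by (intro mult_left_mono infdist_triangle_abs) auto
  finally show ?thesis .
qed

lemma bump_continuous: "continuous_on UNIV (bump n K)"
  unfolding bump_def by (intro continuous_intros)

lemma bump_measurable [measurable]: "bump n K \<in> borel_measurable borel"
  by (intro borel_measurable_continuous_onI bump_continuous)

lemma bump_bounds: "0 \<le> bump n K x" "bump n K x \<le> 1"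
  unfolding bump_def by (auto simp: infdist_nonneg)

lemma bump_tendsto_indicator:
  assumes "closed K" "K \<noteq> {}"
  shows "(\<lambda>n. bump n K x) \<longlonglongrightarrow> indicator K x"
proof (cases "x \<in> K")
  case True
  then show ?thesis by (simp add: bump_def)
next
  case xK: False
  then have "infdist x K > 0"
    using assms by (simp add: infdist_pos_not_in_closed)
  then obtain N :: nat where N: "1 < real N * infdist x K"
    by (metis reals_Archimedean3)
  have "bump n K x = 0" if "n \<ge> N" for n
  proof -
    have "real N * infdist x K \<le> real n * infdist x K"
      using that by (intro mult_right_mono) (auto simp: infdist_nonneg)
    with N show ?thesis by (simp add: bump_def)
  qed
  then show ?thesis
    using xK by (intro tendsto_eventually) (auto simp: eventually_sequentially)
qed

text \<open>Inner regularity replaces \<open>A\<close> by a compact subset \<open>K\<close> at cost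
  \<open>e / 2\<close>. The tents \<open>bump n K\<close> have Lipschitz constant \<open>n\<close>
  and converge boundedly to the indicator of \<open>K\<close>, which takes the other half.\<close>

lemma lipschitz_indicator_approx:
  fixes \<mu> :: "'a::euclidean_space measure"
  assumes "finite_measure \<mu>" and sets: "sets \<mu> = sets borel" and A: "A \<in> sets borel" and "0 < e"
  shows "\<exists>u L. (\<forall>x y. \<bar>u x - u y\<bar> \<le> L * dist x y) \<and> integrable \<mu> u \<and>
    (\<integral>x. \<bar>indicator A x - u x\<bar> \<partial>\<mu>) < (e::real)"
proof -
  interpret finite_measure \<mu> by fact
  note sets [measurable_cong]
  note A [measurable]
  have "emeasure \<mu> A = (SUP K \<in> {K. K \<subseteq> A \<and> compact K}. emeasure \<mu> K)"
    using sets A by (intro inner_regular) auto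
  then have "\<exists>K\<in>{K. K \<subseteq> A \<and> compact K}. emeasure \<mu> A < emeasure \<mu> K + ennreal (e / 2)"
    by (rule SUP_approx_ennreal[rotated 2]) (use \<open>0 < e\<close> in \<open>auto simp: emeasure_eq_measure\<close>)
  then obtain K where K: "K \<subseteq> A" "compact K" "emeasure \<mu> A < emeasure \<mu> K + ennreal (e / 2)"
    by auto
  have [measurable]: "K \<in> sets borel" using K(2) by (simp add: borel_compact)
  have meas: "measure \<mu> A < measure \<mu> K + e / 2"
    using K(3) \<open>0 < e\<close> by (simp add: emeasure_eq_measure ennreal_plus[symmetric] ennreal_less_iff del: ennreal_plus)
  have "(\<integral>x. \<bar>indicator A x - (indicator K x :: real)\<bar> \<partial>\<mu>) = (\<integral>x. indicator A x - indicator K x \<partial>\<mu>)"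
    using K(1) by (intro Bochner_Integration.integral_cong) (auto simp: indicator_def)
  also have "\<dots> = measure \<mu> A - measure \<mu> K"
    by (subst Bochner_Integration.integral_diff) (auto simp: emeasure_eq_measure sets)
  finally have AK: "(\<integral>x. \<bar>indicator A x - (indicator K x :: real)\<bar> \<partial>\<mu>) < e / 2"
    using meas by simp
  have "\<exists>u L. (\<forall>x y. \<bar>u x - u y\<bar> \<le> L * dist x y) \<and> u \<in> borel_measurable borel \<and> (\<forall>x. \<bar>u x\<bar> \<le> 1) \<and>
    (\<integral>x. \<bar>indicator K x - u x\<bar> \<partial>\<mu>) < e / 2"
  proof (cases "K = {}")
    case True
    then show ?thesis using \<open>0 < e\<close> by (intro exI[of _ "\<lambda>_. 0"] exI[of _ 0]) auto
  next
    case False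
    have "(\<lambda>n. \<integral>x. \<bar>indicator K x - bump n K x\<bar> \<partial>\<mu>) \<longlonglongrightarrow> (\<integral>x. 0 \<partial>\<mu>)"
    proof (rule integral_dominated_convergence[where w = "\<lambda>_. 1"])
      show "AE x in \<mu>. (\<lambda>n. \<bar>indicator K x - bump n K x\<bar>) \<longlonglongrightarrow> 0"
      proof (rule AE_I2)
        fix x
        have "(\<lambda>n. \<bar>indicator K x - bump n K x\<bar>) \<longlonglongrightarrow> \<bar>indicator K x - indicator K x\<bar>"
          using K(2) False by (intro tendsto_intros bump_tendsto_indicator compact_imp_closed)
        then show "(\<lambda>n. \<bar>indicator K x - bump n K x\<bar>) \<longlonglongrightarrow> 0" by simp
      qed
      show "AE x in \<mu>. norm \<bar>indicator K x - bump n K x\<bar> \<le> 1" for n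
      proof (rule AE_I2)
        fix x
        show "norm \<bar>indicator K x - bump n K x\<bar> \<le> 1"
          using bump_bounds[of n K x] by (simp add: indicator_def)
      qed
    qed auto
    then have "\<forall>\<^sub>F n in sequentially. (\<integral>x. \<bar>indicator K x - bump n K x\<bar> \<partial>\<mu>) < e / 2"
      using \<open>0 < e\<close> by (intro order_tendstoD(2)[where y = 0]) auto
    then obtain n where "(\<integral>x. \<bar>indicator K x - bump n K x\<bar> \<partial>\<mu>) < e / 2"
      by (auto simp: eventually_sequentially)
    then show ?thesis
      using bump_lipschitz[of n K] bump_bounds[of n K] by (intro exI[of _ "bump n K"] exI[of _ "real n"]) (auto simp: abs_of_nonneg)
  qed
  then obtain u L where u: "\<forall>x y. \<bar>u x - u y\<bar> \<le> L * dist x y" and [measurable]: "u \<in> borel_measurable borel"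
    and b: "\<And>x. \<bar>u x\<bar> \<le> 1" and Ku: "(\<integral>x. \<bar>indicator K x - u x\<bar> \<partial>\<mu>) < e / 2" by auto
  have int: "integrable \<mu> u"
    by (rule integrable_const_bound[where B = 1]) (use b in auto)
  have intA: "integrable \<mu> (indicator B :: 'a \<Rightarrow> real)" if "B \<in> sets borel" for B
    using that sets by (simp add: emeasure_eq_measure)
  have "(\<integral>x. \<bar>indicator A x - u x\<bar> \<partial>\<mu>)
      \<le> (\<integral>x. \<bar>indicator A x - (indicator K x :: real)\<bar> + \<bar>indicator K x - u x\<bar> \<partial>\<mu>)"
    using int intA by (intro integral_mono) auto
  also have "\<dots> = (\<integral>x. \<bar>indicator A x - (indicator K x :: real)\<bar> \<partial>\<mu>) + (\<integral>x. \<bar>indicator K x - u x\<bar> \<partial>\<mu>)"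
    using int intA by (intro Bochner_Integration.integral_add) auto
  finally show ?thesis
    using AK Ku u int by (intro exI[of _ u] exI[of _ L]) auto
qed

lemma lipschitz_dense_L1:
  fixes \<mu> :: "'a::euclidean_space measure" and f :: "'a \<Rightarrow> real"
  assumes fin: "finite_measure \<mu>" and sets: "sets \<mu> = sets borel" and f: "integrable \<mu> f" and "0 < e"
  shows "\<exists>u L. (\<forall>x y. \<bar>u x - u y\<bar> \<le> L * dist x y) \<and> integrable \<mu> u \<and> (\<integral>x. \<bar>f x - u x\<bar> \<partial>\<mu>) < e"
  using f \<open>0 < e\<close>
proof (induction f arbitrary: e rule: integrable_induct)
  case (base A c)
  then have A: "A \<in> sets borel" using sets by auto
  \<comment> \<open>The added \<open>1\<close> covers the case \<open>c = 0\<close>.\<close>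
  have "0 < e / (\<bar>c\<bar> + 1)" using base by auto
  from lipschitz_indicator_approx[OF fin sets A this]
  obtain u L where u: "\<And>x y. \<bar>u x - u y\<bar> \<le> L * dist x y" "integrable \<mu> u"
    and lt: "(\<integral>x. \<bar>indicator A x - u x\<bar> \<partial>\<mu>) < e / (\<bar>c\<bar> + 1)" by blast
  have "\<bar>c * u x - c * u y\<bar> \<le> (\<bar>c\<bar> * L) * dist x y" for x y
    using mult_left_mono[OF u(1)[of x y], of "\<bar>c\<bar>"]
    by (simp add: abs_mult mult.assoc flip: right_diff_distrib)
  moreover have "(\<integral>x. \<bar>indicator A x *\<^sub>R c - c * u x\<bar> \<partial>\<mu>) < e"
  proof -
    have "(\<integral>x. \<bar>indicator A x *\<^sub>R c - c * u x\<bar> \<partial>\<mu>) = (\<integral>x. \<bar>c\<bar> * \<bar>indicator A x - u x\<bar> \<partial>\<mu>)"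
      by (intro Bochner_Integration.integral_cong) (auto simp: abs_mult[symmetric] algebra_simps)
    also have "\<dots> = \<bar>c\<bar> * (\<integral>x. \<bar>indicator A x - u x\<bar> \<partial>\<mu>)" by simp
    also have "\<dots> \<le> \<bar>c\<bar> * (e / (\<bar>c\<bar> + 1))"
      using lt by (intro mult_left_mono) auto
    also have "\<dots> < e" using base by (simp add: field_simps)
    finally show ?thesis .
  qed
  ultimately show ?case
    using u(2) by (intro exI[of _ "\<lambda>x. c * u x"] exI[of _ "\<bar>c\<bar> * L"]) auto
next
  case (add f g)
  from add.prems have "0 < e / 2" by simp
  from add.IH(1)[OF this] add.IH(2)[OF this]
  obtain u L v L' where u: "\<And>x y. \<bar>u x - u y\<bar> \<le> L * dist x y" "integrable \<mu> u" "(\<integral>x. \<bar>f x - u x\<bar> \<partial>\<mu>) < e / 2"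
    and v: "\<And>x y. \<bar>v x - v y\<bar> \<le> L' * dist x y" "integrable \<mu> v" "(\<integral>x. \<bar>g x - v x\<bar> \<partial>\<mu>) < e / 2"
    by blast
  have "\<bar>(u x + v x) - (u y + v y)\<bar> \<le> (L + L') * dist x y" for x y
    using u(1)[of x y] v(1)[of x y] by (simp add: algebra_simps)
  moreover have "(\<integral>x. \<bar>(f x + g x) - (u x + v x)\<bar> \<partial>\<mu>) < e"
  proof -
    have "(\<integral>x. \<bar>(f x + g x) - (u x + v x)\<bar> \<partial>\<mu>) \<le> (\<integral>x. \<bar>f x - u x\<bar> + \<bar>g x - v x\<bar> \<partial>\<mu>)"
      using u v add by (intro integral_mono) auto
    also have "\<dots> = (\<integral>x. \<bar>f x - u x\<bar> \<partial>\<mu>) + (\<integral>x. \<bar>g x - v x\<bar> \<partial>\<mu>)"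
      using u v add by (intro Bochner_Integration.integral_add) auto
    finally show ?thesis using u v by linarith
  qed
  ultimately show ?case
    using u(2) v(2) by (intro exI[of _ "\<lambda>x. u x + v x"] exI[of _ "L + L'"]) auto
next
  case (lim f s)
  have "(\<lambda>n. \<integral>x. \<bar>f x - s n x\<bar> \<partial>\<mu>) \<longlonglongrightarrow> (\<integral>x. 0 \<partial>\<mu>)"
  proof (rule integral_dominated_convergence[where w = "\<lambda>x. 3 * \<bar>f x\<bar>"])
    show "AE x in \<mu>. (\<lambda>n. \<bar>f x - s n x\<bar>) \<longlonglongrightarrow> 0"
    proof (rule AE_I2)
      fix x assume "x \<in> space \<mu>"
      then have "(\<lambda>n. \<bar>f x - s n x\<bar>) \<longlonglongrightarrow> \<bar>f x - f x\<bar>"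
        by (intro tendsto_intros lim)
      then show "(\<lambda>n. \<bar>f x - s n x\<bar>) \<longlonglongrightarrow> 0" by simp
    qed
    show "AE x in \<mu>. norm \<bar>f x - s n x\<bar> \<le> 3 * \<bar>f x\<bar>" for n
    proof (rule AE_I2)
      fix x assume "x \<in> space \<mu>"
      then have "norm (s n x) \<le> 2 * norm (f x)" by (rule lim)
      then show "norm \<bar>f x - s n x\<bar> \<le> 3 * \<bar>f x\<bar>" by (simp add: abs_if split: if_splits)
    qed
  qed (use lim in auto)
  then have "\<forall>\<^sub>F n in sequentially. (\<integral>x. \<bar>f x - s n x\<bar> \<partial>\<mu>) < e / 2"
    using lim.prems by (intro order_tendstoD(2)[where y = 0]) auto
  then obtain n where n: "(\<integral>x. \<bar>f x - s n x\<bar> \<partial>\<mu>) < e / 2"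
    by (auto simp: eventually_sequentially)
  from lim.prems have "0 < e / 2" by simp
  from lim.IH[OF this, of n] obtain u L where u: "\<And>x y. \<bar>u x - u y\<bar> \<le> L * dist x y" "integrable \<mu> u"
    "(\<integral>x. \<bar>s n x - u x\<bar> \<partial>\<mu>) < e / 2"
    by blast
  have "(\<integral>x. \<bar>f x - u x\<bar> \<partial>\<mu>) \<le> (\<integral>x. \<bar>f x - s n x\<bar> + \<bar>s n x - u x\<bar> \<partial>\<mu>)"
    using u lim by (intro integral_mono) auto
  also have "\<dots> = (\<integral>x. \<bar>f x - s n x\<bar> \<partial>\<mu>) + (\<integral>x. \<bar>s n x - u x\<bar> \<partial>\<mu>)"
    using u lim by (intro Bochner_Integration.integral_add) auto
  finally show ?case using u n by (intro exI[of _ u] exI[of _ L]) auto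
qed

section \<open>Similarities and the logarithm\<close>

lemma similarity_surj:
  fixes S :: "'a::euclidean_space \<Rightarrow> 'a"
  assumes "similarity_with S r" "0 < r"
  shows "surj S"
proof -
  define T where "T x = (S x - S 0) /\<^sub>R r" for x
  have "dist (T x) (T y) = dist x y" for x y
  proof -
    have "T x - T y = (S x - S y) /\<^sub>R r"
      by (simp add: T_def algebra_simps)
    then have "dist (T x) (T y) = dist (S x) (S y) / r"
      using assms(2) by (simp add: dist_norm divide_inverse_commute)
    then show ?thesis
      using assms by (simp add: similarity_with_def)
  qed
  \<comment> \<open>\<open>T\<close> is an isometry fixing the origin, hence linear and orthogonal,
    hence onto. Surjectivity later allows an arbitrary centre to be pulled back through
    \<open>S i\<close>.\<close>
  then have "orthogonal_transformation T"
    by (simp add: orthogonal_transformation_isometry T_def)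
  then have T: "surj T" by (rule orthogonal_transformation_surj)
  show ?thesis
  proof (rule surjI)
    fix y
    have "T (inv T ((y - S 0) /\<^sub>R r)) = (y - S 0) /\<^sub>R r"
      using T by (rule surj_f_inv_f)
    then show "S (inv T ((y - S 0) /\<^sub>R r)) = y"
      using assms(2) by (simp add: T_def)
  qed
qed

lemma abs_ln_diff_le:
  fixes a b c :: real
  assumes "0 < c" "c \<le> a" "c \<le> b"
  shows "\<bar>ln a - ln b\<bar> \<le> \<bar>a - b\<bar> / c"
proof -
  have *: "ln x - ln y \<le> \<bar>x - y\<bar> / c" if "c \<le> x" "c \<le> y" for x y
  proof -
    have "ln x - ln y \<le> (x - y) / y"
      using that \<open>0 < c\<close> ln_le_minus_one[of "x / y"] by (simp add: ln_div diff_divide_distrib)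
    also have "\<dots> \<le> \<bar>x - y\<bar> / c"
      using that \<open>0 < c\<close> by (intro frac_le) auto
    finally show ?thesis .
  qed
  from *[OF assms(2,3)] *[OF assms(3,2)] show ?thesis by (simp add: abs_minus_commute abs_le_iff)
qed

section \<open>The coding map\<close>

locale self_similar_ifs =
  fixes l :: nat and S :: "nat \<Rightarrow> 'a::euclidean_space \<Rightarrow> 'a" and \<rho> p :: "nat \<Rightarrow> real"
    and \<mu> :: "'a measure"
  assumes sim: "\<And>i. i < l \<Longrightarrow> similarity_with (S i) (\<rho> i)"
    and rho: "\<And>i. i < l \<Longrightarrow> 0 < \<rho> i \<and> \<rho> i < 1"
    and ppos: "\<And>i. i < l \<Longrightarrow> 0 < p i"
    and psum: "(\<Sum>i<l. p i) = 1"
    and mu: "self_similar_measure l S p \<mu>"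
begin

lemma l_pos: "0 < l"
  using psum by (cases l) auto

lemma dist_S: "i < l \<Longrightarrow> dist (S i x) (S i y) = \<rho> i * dist x y"
  using sim by (simp add: similarity_with_def)

lemma surj_S: "i < l \<Longrightarrow> surj (S i)"
  using similarity_surj sim rho by blast

lemma continuous_S: "i < l \<Longrightarrow> continuous_on UNIV (S i)"
  by (rule lipschitz_on_continuous_on[of "\<rho> i"], rule lipschitz_onI)
     (use rho in \<open>auto simp: dist_S order_less_imp_le\<close>)

lemma measurable_S: "i < l \<Longrightarrow> S i \<in> borel_measurable borel"
  by (intro borel_measurable_continuous_onI continuous_S)

lemma sets_mu [measurable_cong]: "sets \<mu> = sets borel"
  using mu by (simp add: self_similar_measure_def)

lemma space_mu [simp]: "space \<mu> = UNIV"
  using sets_eq_imp_space_eq[OF sets_mu] by simp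

sublocale mu: prob_space \<mu>
  using mu by (simp add: self_similar_measure_def)

lemma emeasure_mu:
  assumes "A \<in> sets borel"
  shows "emeasure \<mu> A = (\<Sum>i<l. ennreal (p i) * emeasure \<mu> (S i -` A))"
proof -
  have "emeasure \<mu> A = ennreal (\<Sum>i<l. p i * measure \<mu> (S i -` A))"
    using mu assms by (simp add: self_similar_measure_def mu.emeasure_eq_measure)
  also have "\<dots> = (\<Sum>i<l. ennreal (p i) * emeasure \<mu> (S i -` A))"
    using ppos by (subst sum_ennreal[symmetric])
      (auto simp: mu.emeasure_eq_measure ennreal_mult' order_less_imp_le intro!: sum.cong)
  finally show ?thesis .
qed

lemma nn_integral_mu:
  assumes "f \<in> borel_measurable borel"
  shows "(\<integral>\<^sup>+z. f z \<partial>\<mu>) = (\<Sum>i<l. ennreal (p i) * (\<integral>\<^sup>+z. f (S i z) \<partial>\<mu>))"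
  using assms
proof (induction rule: borel_measurable_induct)
  case (cong f g)
  then show ?case by simp
next
  case (set A)
  have "(\<integral>\<^sup>+z. indicator A (S i z) \<partial>\<mu>) = emeasure \<mu> (S i -` A)" if "i < l" for i
    using measurable_sets[OF measurable_S[OF that] set]
    by (simp add: indicator_vimage[symmetric] sets_mu)
  then show ?case using set emeasure_mu[OF set] sets_mu by simp
next
  case (mult u c)
  have "(\<lambda>z. u (S i z)) \<in> borel_measurable \<mu>" if "i < l" for i
    using measurable_compose[OF measurable_S[OF that] mult(2)] sets_mu by (simp cong: measurable_cong_sets)
  then show ?case
    using mult sets_mu by (simp add: nn_integral_cmult sum_distrib_left ac_simps cong: measurable_cong_sets)
next
  case (add u v)
  have "(\<lambda>z. u (S i z)) \<in> borel_measurable \<mu>" "(\<lambda>z. v (S i z)) \<in> borel_measurable \<mu>" if "i < l" for i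
    using measurable_compose[OF measurable_S[OF that] add(1)] measurable_compose[OF measurable_S[OF that] add(3)]
      sets_mu by (simp_all cong: measurable_cong_sets)
  then show ?case
    using add sets_mu by (simp add: nn_integral_add sum.distrib distrib_left cong: measurable_cong_sets)
next
  case (seq U)
  have [measurable]: "U j \<in> borel_measurable borel" for j by (rule seq)
  have meas: "(\<lambda>z. U j (S i z)) \<in> borel_measurable \<mu>" if "i < l" for i j
    using measurable_compose[OF measurable_S[OF that] seq(1)] sets_mu by (simp cong: measurable_cong_sets)
  have inc: "incseq (\<lambda>j z. U j (S i z))" for i
    using seq(3) by (auto simp: incseq_def le_fun_def)
  have "(\<integral>\<^sup>+z. (SUP j. U j z) \<partial>\<mu>) = (SUP j. \<integral>\<^sup>+z. U j z \<partial>\<mu>)"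
    using seq(3) by (intro nn_integral_monotone_convergence_SUP) auto
  also have "\<dots> = (SUP j. \<Sum>i<l. ennreal (p i) * (\<integral>\<^sup>+z. U j (S i z) \<partial>\<mu>))"
    by (simp add: seq.IH)
  also have "\<dots> = (\<Sum>i<l. SUP j. ennreal (p i) * (\<integral>\<^sup>+z. U j (S i z) \<partial>\<mu>))"
  proof (rule ennreal_SUP_sum)
    fix i assume "i \<in> {..<l}"
    show "incseq (\<lambda>j. ennreal (p i) * (\<integral>\<^sup>+z. U j (S i z) \<partial>\<mu>))"
      using inc[of i] by (auto simp: incseq_def le_fun_def intro!: mult_left_mono nn_integral_mono)
  qed
  also have "\<dots> = (\<Sum>i<l. ennreal (p i) * (\<integral>\<^sup>+z. (SUP j. U j (S i z)) \<partial>\<mu>))"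
    using inc meas by (intro sum.cong refl) (simp add: SUP_mult_left_ennreal nn_integral_monotone_convergence_SUP)
  finally show ?case by (simp add: SUP_apply image_comp)
qed

section \<open>Words with independent letters\<close>

definition letters :: "nat measure" where
  "letters = point_measure {..<l} (\<lambda>i. ennreal (p i))"

lemma space_letters [simp]: "space letters = {..<l}"
  by (simp add: letters_def space_point_measure)

lemma sets_letters [measurable_cong]: "sets letters = sets (count_space {..<l})"
  by (simp add: letters_def sets_point_measure)

sublocale prob_letters: prob_space letters
proof
  have "emeasure letters (space letters) = (\<Sum>i<l. ennreal (p i))"
    by (simp add: letters_def space_point_measure emeasure_point_measure_finite)
  also have "\<dots> = 1"
    using psum ppos by (subst sum_ennreal) (auto simp: order_less_imp_le)
  finally show "emeasure letters (space letters) = 1" .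
qed

sublocale words: sequence_space letters ..

abbreviation P :: "(nat \<Rightarrow> nat) measure" where
  "P \<equiv> Pi\<^sub>M UNIV (\<lambda>_::nat. letters)"

lemma space_P: "x \<in> space P \<longleftrightarrow> (\<forall>k. x k < l)"
  by (auto simp: space_PiM PiE_iff)

lemma letter_less: "x \<in> space P \<Longrightarrow> x k < l"
  by (simp add: space_P)

lemma nn_integral_letters: "(\<integral>\<^sup>+i. f i \<partial>letters) = (\<Sum>i<l. ennreal (p i) * f i)"
  by (simp add: letters_def nn_integral_point_measure_finite mult.commute)

lemma nn_integral_P:
  assumes "f \<in> borel_measurable P"
  shows "(\<integral>\<^sup>+x. f x \<partial>P) = (\<Sum>i<l. ennreal (p i) * (\<integral>\<^sup>+x. f (case_nat i x) \<partial>P))"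
  by (simp add: words.nn_integral_case_nat[OF assms] nn_integral_letters)

lemma measurable_letter: "(\<lambda>x. x k) \<in> measurable P (count_space {..<l})"
proof -
  have "(\<lambda>x. x k) \<in> measurable P letters" by measurable
  then show ?thesis by (simp add: sets_letters cong: measurable_cong_sets)
qed

text \<open>Maps such as \<open>S i\<close> are known to be measurable only for
  \<open>i < l\<close>, so a map selected by a random letter is glued from these finitely many
  branches.\<close>

lemma measurable_letter_compose:
  assumes F: "\<And>i. i < l \<Longrightarrow> F i \<in> measurable N L" and k: "g \<in> measurable N P"
  shows "(\<lambda>x. F (g x k) x) \<in> measurable N L"
  by (rule measurable_compose_countable'[where I = "{..<l}"])
     (auto intro: F measurable_compose[OF k measurable_letter])

lemma measurable_fun_letter [measurable]:
  "(\<lambda>x. h (x k)) \<in> borel_measurable P"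
  by (rule measurable_letter_compose[where F = "\<lambda>i x. h i"]) auto

section \<open>Contraction ratios and cylinder maps\<close>

definition rmax :: real where
  "rmax = Max (\<rho> ` {..<l})"

lemma rho_le_rmax: "i < l \<Longrightarrow> \<rho> i \<le> rmax"
  by (simp add: rmax_def)

lemma rmax: "0 < rmax" "rmax < 1"
proof -
  show "0 < rmax" using rho_le_rmax[of 0] rho[of 0] l_pos by simp
  show "rmax < 1" unfolding rmax_def using rho l_pos by (subst Max_less_iff) auto
qed

text \<open>The least \<open>R\<close> for which \<open>rmax * R\<close> plus the largest
  \<open>norm (S i 0)\<close> is at most \<open>R\<close>. Hence every \<open>S i\<close> maps the
  closed ball of this radius around the origin into itself.\<close>

definition radius :: real where
  "radius = Max ((\<lambda>i. norm (S i 0)) ` {..<l}) / (1 - rmax)"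

lemma radius_nonneg: "0 \<le> radius"
proof -
  have "norm (S 0 0) \<le> Max ((\<lambda>i. norm (S i 0)) ` {..<l})"
    using l_pos by (intro Max_ge) auto
  then have "0 \<le> Max ((\<lambda>i. norm (S i 0)) ` {..<l})"
    using norm_ge_zero order_trans by blast
  then show ?thesis unfolding radius_def using rmax by simp
qed

lemma norm_S_le:
  assumes "i < l" "norm z \<le> radius"
  shows "norm (S i z) \<le> radius"
proof -
  have "norm (S i z) \<le> dist (S i z) (S i 0) + norm (S i 0)"
    by (metis dist_norm norm_triangle_sub add.commute)
  also have "\<dots> \<le> rmax * radius + radius * (1 - rmax)"
  proof (rule add_mono)
    show "dist (S i z) (S i 0) \<le> rmax * radius"
      using assms rho_le_rmax[of i] rmax unfolding dist_S[OF assms(1)] by (intro mult_mono) auto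
    have "norm (S i 0) \<le> Max ((\<lambda>i. norm (S i 0)) ` {..<l})"
      using assms(1) by (intro Max_ge) auto
    then show "norm (S i 0) \<le> radius * (1 - rmax)"
      unfolding radius_def using rmax by simp
  qed
  finally show ?thesis by (simp add: algebra_simps)
qed

text \<open>The first letter acts outermost, so that longer words refine shorter ones and the maps
  converge as \<open>n\<close> grows.\<close>

primrec cyl_map :: "nat \<Rightarrow> (nat \<Rightarrow> nat) \<Rightarrow> 'a \<Rightarrow> 'a" where
  "cyl_map 0 x z = z"
| "cyl_map (Suc n) x z = S (x 0) (cyl_map n (seq_shift 1 x) z)"

definition cyl_ratio :: "nat \<Rightarrow> (nat \<Rightarrow> nat) \<Rightarrow> real" where
  "cyl_ratio n x = (\<Prod>k<n. \<rho> (x k))"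

lemma cyl_ratio_Suc: "cyl_ratio (Suc n) x = \<rho> (x 0) * cyl_ratio n (seq_shift 1 x)"
  unfolding cyl_ratio_def by (subst prod.lessThan_Suc_shift) (simp add: seq_shift_def)

lemma cyl_ratio_0 [simp]: "cyl_ratio 0 x = 1"
  by (simp add: cyl_ratio_def)

lemma cyl_ratio_pos: "x \<in> space P \<Longrightarrow> 0 < cyl_ratio n x"
  unfolding cyl_ratio_def using rho by (intro prod_pos) (simp add: space_P)

lemma cyl_ratio_le: "x \<in> space P \<Longrightarrow> cyl_ratio n x \<le> rmax ^ n"
proof -
  assume "x \<in> space P"
  then have "cyl_ratio n x \<le> (\<Prod>k<n. rmax)"
    unfolding cyl_ratio_def using rho rho_le_rmax
    by (intro prod_mono) (auto simp: space_P order_less_imp_le)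
  then show ?thesis by simp
qed

lemma cyl_ratio_measurable [measurable]: "cyl_ratio n \<in> borel_measurable P"
  unfolding cyl_ratio_def by measurable

lemma dist_cyl_map:
  "x \<in> space P \<Longrightarrow> dist (cyl_map n x z) (cyl_map n x z') = cyl_ratio n x * dist z z'"
proof (induction n arbitrary: x)
  case (Suc n)
  from Suc.prems have "x 0 < l" "seq_shift 1 x \<in> space P"
    by (auto simp: space_P seq_shift_def)
  then show ?case using Suc.IH by (simp add: dist_S cyl_ratio_Suc)
qed simp

lemma cyl_map_add:
  "cyl_map (n + k) x z = cyl_map n x (cyl_map k (seq_shift n x) z)"
  by (induction n arbitrary: x) simp_all

lemma norm_cyl_map_le: "x \<in> space P \<Longrightarrow> norm z \<le> radius \<Longrightarrow> norm (cyl_map n x z) \<le> radius"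
proof (induction n arbitrary: x)
  case (Suc n)
  from Suc.prems have "x 0 < l" "seq_shift 1 x \<in> space P"
    by (auto simp: space_P seq_shift_def)
  then show ?case using Suc by (simp add: norm_S_le)
qed simp

lemma cyl_map_measurable [measurable]: "(\<lambda>(x, z). cyl_map n x z) \<in> borel_measurable (P \<Otimes>\<^sub>M borel)"
proof (induction n)
  case (Suc n)
  note [measurable] = Suc
  have "(\<lambda>w. S (fst w 0) (cyl_map n (seq_shift 1 (fst w)) (snd w))) \<in> borel_measurable (P \<Otimes>\<^sub>M borel)"
  proof (rule measurable_letter_compose[where g = fst])
    fix i assume "i < l"
    have "(\<lambda>w. (seq_shift 1 (fst w), snd w)) \<in> measurable (P \<Otimes>\<^sub>M borel) (P \<Otimes>\<^sub>M borel)"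
      by measurable
    from measurable_compose[OF measurable_compose[OF this Suc] measurable_S[OF \<open>i < l\<close>]]
    show "(\<lambda>w. S i (cyl_map n (seq_shift 1 (fst w)) (snd w))) \<in> borel_measurable (P \<Otimes>\<^sub>M borel)"
      by simp
  qed simp
  then show ?case by (simp add: split_beta')
qed (simp add: split_beta')

lemma cyl_map_measurable' [measurable]: "(\<lambda>x. cyl_map n x z) \<in> borel_measurable P"
proof -
  have "(\<lambda>x. (x, z)) \<in> measurable P (P \<Otimes>\<^sub>M borel)" by measurable
  from measurable_compose[OF this cyl_map_measurable] show ?thesis by simp
qed

section \<open>Convergence of the cylinder maps and the law of the coded point\<close>

definition coding :: "(nat \<Rightarrow> nat) \<Rightarrow> 'a" where
  "coding x = lim (\<lambda>n. cyl_map n x 0)"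

lemma coding_measurable [measurable]: "coding \<in> borel_measurable P"
  unfolding coding_def by measurable

text \<open>Two starting points are brought together at rate \<open>rmax ^ n\<close>, so the limit
  forgets where it started. This freedom matters because the starting point will be drawn from
  \<mu>.\<close>

lemma cyl_map_tendsto:
  assumes x: "x \<in> space P"
  shows "(\<lambda>n. cyl_map n x z) \<longlonglongrightarrow> coding x"
proof -
  have pow: "(\<lambda>n. rmax ^ n * c) \<longlonglongrightarrow> 0" for c
    using rmax by (intro tendsto_mult_left_zero LIMSEQ_power_zero) auto
  have "Cauchy (\<lambda>n. cyl_map n x 0)"
  proof (rule CauchyI')
    fix e :: real assume "0 < e"
    then obtain N where N: "\<And>n. n \<ge> N \<Longrightarrow> rmax ^ n * (radius + 1) < e"
      using order_tendstoD(2)[OF pow] unfolding eventually_sequentially by blast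
    have "norm (cyl_map m x 0 - cyl_map n x 0) < e" if mn: "N \<le> m" "m < n" for m n
    proof -
      obtain k where k: "n = m + k" using mn(2) less_imp_add_positive by blast
      have "norm (cyl_map m x 0 - cyl_map n x 0) = cyl_ratio m x * norm (cyl_map k (seq_shift m x) 0)"
        using dist_cyl_map[OF x, of m 0] by (simp add: k cyl_map_add dist_norm)
      also have "\<dots> \<le> rmax ^ m * radius"
        using cyl_ratio_le[OF x] rmax radius_nonneg
        by (intro mult_mono norm_cyl_map_le words.shift_in_space[OF x]) auto
      also have "\<dots> \<le> rmax ^ m * (radius + 1)"
        using rmax by (intro mult_left_mono) auto
      also have "\<dots> < e" using N mn by simp
      finally show ?thesis .
    qed
    then show "\<exists>M. \<forall>m\<ge>M. \<forall>n>m. dist (cyl_map m x 0) (cyl_map n x 0) < e"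
      unfolding dist_norm by blast
  qed
  then have lim: "(\<lambda>n. cyl_map n x 0) \<longlonglongrightarrow> coding x"
    unfolding coding_def by (simp add: Cauchy_convergent_iff convergent_LIMSEQ_iff)
  have "(\<lambda>n. dist (cyl_map n x z) (cyl_map n x 0)) \<longlonglongrightarrow> 0"
  proof (rule tendsto_sandwich[where f = "\<lambda>_. 0" and h = "\<lambda>n. rmax ^ n * norm z"])
    show "\<forall>\<^sub>F n in sequentially. dist (cyl_map n x z) (cyl_map n x 0) \<le> rmax ^ n * norm z"
      using cyl_ratio_le[OF x] by (auto simp: dist_cyl_map[OF x] intro!: mult_right_mono always_eventually)
    show "(\<lambda>n. rmax ^ n * norm z) \<longlonglongrightarrow> 0" by (rule pow)
  qed (auto intro: tendsto_const)
  then have "(\<lambda>n. cyl_map n x z - cyl_map n x 0) \<longlonglongrightarrow> 0"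
    by (simp add: dist_norm tendsto_norm_zero_iff)
  with lim show ?thesis
    by (rule Lim_transform)
qed

lemma coding_shift:
  assumes x: "x \<in> space P"
  shows "coding x = S (x 0) (coding (seq_shift 1 x))"
proof (rule LIMSEQ_unique)
  show "(\<lambda>n. cyl_map (Suc n) x 0) \<longlonglongrightarrow> coding x"
    using cyl_map_tendsto[OF x] by (rule LIMSEQ_Suc)
  have "isCont (S (x 0)) (coding (seq_shift 1 x))"
    using continuous_S[OF letter_less[OF x]] by (simp add: continuous_on_eq_continuous_at)
  from isCont_tendsto_compose[OF this cyl_map_tendsto[OF words.shift_in_space[OF x]]]
  show "(\<lambda>n. cyl_map (Suc n) x 0) \<longlonglongrightarrow> S (x 0) (coding (seq_shift 1 x))"
    by simp
qed

lemma coding_case_nat: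
  assumes "i < l" "x \<in> space P"
  shows "coding (case_nat i x) = S i (coding x)"
  using coding_shift[of "case_nat i x"] words.case_nat_in_space[of i x] assms by simp

lemma norm_coding_le:
  assumes x: "x \<in> space P"
  shows "norm (coding x) \<le> radius"
proof (rule Lim_norm_ubound)
  show "(\<lambda>n. cyl_map n x 0) \<longlonglongrightarrow> coding x" by (rule cyl_map_tendsto[OF x])
  show "\<forall>\<^sub>F n in sequentially. norm (cyl_map n x 0) \<le> radius"
    using norm_cyl_map_le[OF x] radius_nonneg by simp
qed simp

sublocale pair: pair_sigma_finite P \<mu> ..

text \<open>Self-similarity iterated \<open>n\<close> times, with the weighted sum over words
  written as an expectation so that \<open>n\<close> can tend to infinity.\<close>

lemma nn_integral_cyl_map:
  assumes "f \<in> borel_measurable borel"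
  shows "(\<integral>\<^sup>+z. f z \<partial>\<mu>) = (\<integral>\<^sup>+x. (\<integral>\<^sup>+z. f (cyl_map n x z) \<partial>\<mu>) \<partial>P)"
  using assms
proof (induction n arbitrary: f)
  case 0
  show ?case using words.P.emeasure_space_1 by simp
next
  case (Suc n)
  note [measurable] = Suc.prems
  have "(\<integral>\<^sup>+x. (\<integral>\<^sup>+z. f (cyl_map (Suc n) x z) \<partial>\<mu>) \<partial>P)
      = (\<Sum>i<l. ennreal (p i) * (\<integral>\<^sup>+x. (\<integral>\<^sup>+z. f (S i (cyl_map n x z)) \<partial>\<mu>) \<partial>P))"
  proof (subst nn_integral_P)
    have "(\<lambda>(x, z). f (cyl_map (Suc n) x z)) \<in> borel_measurable (P \<Otimes>\<^sub>M \<mu>)"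
      using measurable_compose[OF cyl_map_measurable[of "Suc n"] Suc.prems]
      by (simp add: split_beta' sets_mu cong: measurable_cong_sets sets_pair_measure_cong)
    then show "(\<lambda>x. \<integral>\<^sup>+z. f (cyl_map (Suc n) x z) \<partial>\<mu>) \<in> borel_measurable P"
      by (rule mu.borel_measurable_nn_integral)
  qed simp
  also have "\<dots> = (\<Sum>i<l. ennreal (p i) * (\<integral>\<^sup>+z. f (S i z) \<partial>\<mu>))"
  proof (rule sum.cong)
    fix i assume "i \<in> {..<l}"
    then have "(\<lambda>z. f (S i z)) \<in> borel_measurable borel"
      by (intro measurable_compose[OF measurable_S Suc.prems]) simp
    from Suc.IH[OF this]
    show "ennreal (p i) * (\<integral>\<^sup>+x. (\<integral>\<^sup>+z. f (S i (cyl_map n x z)) \<partial>\<mu>) \<partial>P)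
        = ennreal (p i) * (\<integral>\<^sup>+z. f (S i z) \<partial>\<mu>)" by simp
  qed simp
  also have "\<dots> = (\<integral>\<^sup>+z. f z \<partial>\<mu>)"
    by (rule nn_integral_mu[symmetric]) fact
  finally show ?case ..
qed

text \<open>The left side equals its \<open>n\<close>-th iterate for every \<open>n\<close>. By
  continuity of \<open>f\<close> and dominated convergence these iterates tend to the right
  side.\<close>

lemma nn_integral_coding_continuous:
  fixes f :: "'a \<Rightarrow> real"
  assumes cont: "continuous_on UNIV f" and bounds: "\<And>z. 0 \<le> f z" "\<And>z. f z \<le> 1"
  shows "(\<integral>\<^sup>+z. ennreal (f z) \<partial>\<mu>) = (\<integral>\<^sup>+x. ennreal (f (coding x)) \<partial>P)"
proof (rule LIMSEQ_unique)
  have f [measurable]: "f \<in> borel_measurable borel" by (rule borel_measurable_continuous_onI) fact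
  have cyl: "(\<lambda>(x, z). cyl_map n x z) \<in> borel_measurable (P \<Otimes>\<^sub>M \<mu>)" for n
    using cyl_map_measurable by (simp add: sets_mu cong: measurable_cong_sets sets_pair_measure_cong)
  have meas [measurable]: "(\<lambda>(x, z). ennreal (f (cyl_map n x z))) \<in> borel_measurable (P \<Otimes>\<^sub>M \<mu>)" for n
    using measurable_compose[OF measurable_compose[OF cyl f] measurable_ennreal] by (simp add: split_beta')
  interpret PM: prob_space "P \<Otimes>\<^sub>M \<mu>"
    by (intro prob_space_pair words.P.prob_space_axioms mu.prob_space_axioms)
  have "(\<lambda>n. \<integral>\<^sup>+(x, z). ennreal (f (cyl_map n x z)) \<partial>(P \<Otimes>\<^sub>M \<mu>))
      \<longlonglongrightarrow> (\<integral>\<^sup>+(x, z). ennreal (f (coding x)) \<partial>(P \<Otimes>\<^sub>M \<mu>))"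
  proof (rule nn_integral_dominated_convergence[where w = "\<lambda>_. 1"])
    show "AE w in P \<Otimes>\<^sub>M \<mu>. (\<lambda>n. case w of (x, z) \<Rightarrow> ennreal (f (cyl_map n x z)))
        \<longlonglongrightarrow> (case w of (x, z) \<Rightarrow> ennreal (f (coding x)))"
    proof (rule AE_I2)
      fix w assume "w \<in> space (P \<Otimes>\<^sub>M \<mu>)"
      then obtain x z where w: "w = (x, z)" "x \<in> space P" by (auto simp: space_pair_measure)
      have "isCont f (coding x)"
        using cont by (simp add: continuous_on_eq_continuous_at)
      then have "(\<lambda>n. f (cyl_map n x z)) \<longlonglongrightarrow> f (coding x)"
        using cyl_map_tendsto[OF w(2)] by (rule isCont_tendsto_compose)
      then show "(\<lambda>n. case w of (x, z) \<Rightarrow> ennreal (f (cyl_map n x z)))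
        \<longlonglongrightarrow> (case w of (x, z) \<Rightarrow> ennreal (f (coding x)))"
        by (simp add: w tendsto_ennrealI)
    qed
    show "(\<integral>\<^sup>+x. 1 \<partial>(P \<Otimes>\<^sub>M \<mu>)) < \<infinity>"
      by (simp add: PM.emeasure_space_1)
  qed (use bounds in \<open>auto simp: ennreal_le_1 intro!: AE_I2\<close>)
  moreover have "(\<integral>\<^sup>+(x, z). ennreal (f (cyl_map n x z)) \<partial>(P \<Otimes>\<^sub>M \<mu>)) = (\<integral>\<^sup>+z. ennreal (f z) \<partial>\<mu>)" for n
    by (subst nn_integral_cyl_map[of _ n]) (auto simp: mu.nn_integral_fst[OF meas, symmetric])
  ultimately show "(\<lambda>n. (\<integral>\<^sup>+z. ennreal (f z) \<partial>\<mu>)) \<longlonglongrightarrow> (\<integral>\<^sup>+x. ennreal (f (coding x)) \<partial>P)"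
    by (subst (asm) mu.nn_integral_fst[symmetric]) (auto simp: mu.emeasure_space_1[simplified])
qed simp

text \<open>Tents around a closed set transfer the identity from continuous functions to closed
  sets, a generator stable under intersection. As \<open>P\<close> and \<open>coding\<close> do not
  depend on \<mu>, this also contains the uniqueness of \<mu>.\<close>

lemma distr_coding: "distr P borel coding = \<mu>"
proof (rule measure_eqI_generator_eq[where E = "{K. closed K}" and \<Omega> = UNIV and A = "\<lambda>_. UNIV"])
  show "Int_stable {K :: 'a set. closed K}" by (auto simp: Int_stable_def)
  have "sets (borel :: 'a measure) = sigma_sets UNIV {K. closed K}"
    unfolding borel_eq_closed by (simp add: sets_measure_of)
  then show "sets (distr P borel coding) = sigma_sets UNIV {K. closed K}"
    "sets \<mu> = sigma_sets UNIV {K. closed K}"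
    by (simp_all add: sets_mu)
  show "emeasure (distr P borel coding) K = emeasure \<mu> K" if "K \<in> {K. closed K}" for K
  proof (cases "K = {}")
    case False
    have K [measurable]: "K \<in> sets borel" using that by (simp add: borel_closed)
    have ind: "(\<lambda>n. ennreal (bump n K z)) \<longlonglongrightarrow> indicator K z" for z
      using tendsto_ennrealI[OF bump_tendsto_indicator[of K z]] that False by (simp add: ennreal_indicator)
    have "(\<lambda>n. \<integral>\<^sup>+z. ennreal (bump n K z) \<partial>\<mu>) \<longlonglongrightarrow> (\<integral>\<^sup>+z. indicator K z \<partial>\<mu>)"
      by (rule nn_integral_dominated_convergence[where w = "\<lambda>_. 1"])
         (use ind bump_bounds in \<open>auto simp: ennreal_le_1 mu.emeasure_space_1[simplified] intro!: AE_I2\<close>)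
    moreover have "(\<lambda>n. \<integral>\<^sup>+x. ennreal (bump n K (coding x)) \<partial>P) \<longlonglongrightarrow> (\<integral>\<^sup>+x. indicator K (coding x) \<partial>P)"
      by (rule nn_integral_dominated_convergence[where w = "\<lambda>_. 1"])
         (use ind bump_bounds in \<open>auto simp: ennreal_le_1 words.P.emeasure_space_1 intro!: AE_I2\<close>)
    moreover have "(\<integral>\<^sup>+z. ennreal (bump n K z) \<partial>\<mu>) = (\<integral>\<^sup>+x. ennreal (bump n K (coding x)) \<partial>P)" for n
      by (intro nn_integral_coding_continuous bump_continuous bump_bounds)
    ultimately have "(\<integral>\<^sup>+z. indicator K z \<partial>\<mu>) = (\<integral>\<^sup>+x. indicator K (coding x) \<partial>P)"
      by (simp add: LIMSEQ_unique)
    moreover have "(\<integral>\<^sup>+x. indicator K (coding x) \<partial>P) = (\<integral>\<^sup>+z. indicator K z \<partial>distr P borel coding)"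
      by (subst nn_integral_distr) auto
    ultimately show ?thesis using K sets_mu by simp
  qed simp
  show "emeasure (distr P borel coding) UNIV \<noteq> \<infinity>"
    by (simp add: emeasure_distr words.P.emeasure_eq_measure)
qed auto

lemma nn_integral_coding:
  assumes "f \<in> borel_measurable borel"
  shows "(\<integral>\<^sup>+x. f (coding x) \<partial>P) = (\<integral>\<^sup>+z. f z \<partial>\<mu>)"
  by (subst distr_coding[symmetric], subst nn_integral_distr) (use assms in auto)

lemma AE_coding_iff:
  assumes "{z. Q z} \<in> sets borel"
  shows "(AE x in P. Q (coding x)) \<longleftrightarrow> (AE z in \<mu>. Q z)"
proof -
  have "(AE z in distr P borel coding. Q z) \<longleftrightarrow> (AE x in P. Q (coding x))"
    by (rule AE_distr_iff) (use assms in auto)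
  then show ?thesis by (simp only: distr_coding)
qed

subsection \<open>Ball measures along words\<close>

text \<open>By self-similarity each \<open>\<nu> i\<close> is dominated by \<mu>, hence has a
  density, and the densities add up to one almost everywhere. They are adjusted on a null set so
  that they form a real probability vector at every point, which lets Gibbs' inequality be used
  pointwise.\<close>

lemma ex_posterior:
  "\<exists>q :: nat \<Rightarrow> 'a \<Rightarrow> real. (\<forall>i. q i \<in> borel_measurable borel) \<and> (\<forall>i z. 0 \<le> q i z) \<and>
    (\<forall>z. (\<Sum>i<l. q i z) = 1) \<and>
    (\<forall>i<l. \<forall>f\<in>borel_measurable borel.
      ennreal (p i) * (\<integral>\<^sup>+z. f (S i z) \<partial>\<mu>) = (\<integral>\<^sup>+z. ennreal (q i z) * f z \<partial>\<mu>))"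
proof -
  define \<nu> where "\<nu> i = distr (density \<mu> (\<lambda>_. ennreal (p i))) borel (S i)" for i
  have nu_int: "(\<integral>\<^sup>+z. f z \<partial>\<nu> i) = ennreal (p i) * (\<integral>\<^sup>+z. f (S i z) \<partial>\<mu>)"
    if "i < l" "f \<in> borel_measurable borel" for i f
  proof -
    have S: "S i \<in> borel_measurable \<mu>"
      using measurable_S[OF that(1)] by (simp add: sets_mu cong: measurable_cong_sets)
    then show ?thesis
      unfolding \<nu>_def using that(2) measurable_compose[OF S that(2)]
      by (simp add: nn_integral_distr nn_integral_density nn_integral_cmult)
  qed
  have nu_le: "emeasure (\<nu> i) A \<le> emeasure \<mu> A" if "i < l" "A \<in> sets borel" for i A
  proof -
    have "emeasure (\<nu> i) A = (\<integral>\<^sup>+z. indicator A z \<partial>\<nu> i)"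
      using that by (simp add: \<nu>_def)
    also have "\<dots> = ennreal (p i) * (\<integral>\<^sup>+z. indicator A (S i z) \<partial>\<mu>)"
      using that by (intro nu_int) auto
    also have "\<dots> \<le> (\<Sum>j<l. ennreal (p j) * (\<integral>\<^sup>+z. indicator A (S j z) \<partial>\<mu>))"
      using that(1) by (intro member_le_sum) auto
    also have "\<dots> = emeasure \<mu> A"
      using that by (subst nn_integral_mu[symmetric]) (auto simp: sets_mu)
    finally show ?thesis .
  qed
  have "\<forall>i. \<exists>f. i < l \<longrightarrow> f \<in> borel_measurable \<mu> \<and> density \<mu> f = \<nu> i"
  proof
    fix i
    show "\<exists>f. i < l \<longrightarrow> f \<in> borel_measurable \<mu> \<and> density \<mu> f = \<nu> i"
    proof (cases "i < l")
      case True
      have "absolutely_continuous \<mu> (\<nu> i)"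
      proof (unfold absolutely_continuous_def, rule subsetI)
        fix A assume A: "A \<in> null_sets \<mu>"
        then have "A \<in> sets borel" by (auto simp: null_sets_def sets_mu)
        with nu_le[OF True this] A show "A \<in> null_sets (\<nu> i)"
          by (auto simp: null_sets_def \<nu>_def)
      qed
      then show ?thesis
        using mu.Radon_Nikodym[of "\<nu> i"] by (auto simp: \<nu>_def sets_mu)
    qed simp
  qed
  then obtain f where f': "\<And>i. i < l \<Longrightarrow> f i \<in> borel_measurable \<mu>" "\<And>i. i < l \<Longrightarrow> density \<mu> (f i) = \<nu> i"
    by metis
  have f [measurable]: "i < l \<Longrightarrow> f i \<in> borel_measurable borel" for i
    using f'(1) by (simp add: sets_mu cong: measurable_cong_sets)
  have f_int: "ennreal (p i) * (\<integral>\<^sup>+z. g (S i z) \<partial>\<mu>) = (\<integral>\<^sup>+z. f i z * g z \<partial>\<mu>)"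
    if "i < l" "g \<in> borel_measurable borel" for i g
  proof -
    have "(\<integral>\<^sup>+z. g z \<partial>\<nu> i) = (\<integral>\<^sup>+z. f i z * g z \<partial>\<mu>)"
      using that f'(1) by (subst f'(2)[symmetric]) (auto intro!: nn_integral_density simp: sets_mu cong: measurable_cong_sets)
    then show ?thesis using nu_int[OF that] by simp
  qed
  have sum_meas: "(\<lambda>z. \<Sum>i<l. f i z) \<in> borel_measurable borel"
    by (intro borel_measurable_sum) auto
  have "AE z in \<mu>. (\<Sum>i<l. f i z) = 1"
  proof (rule mu.density_unique)
    show "density \<mu> (\<lambda>z. \<Sum>i<l. f i z) = density \<mu> (\<lambda>_. 1)"
    proof (rule measure_eqI)
      fix A assume "A \<in> sets (density \<mu> (\<lambda>z. \<Sum>i<l. f i z))"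
      then have A [measurable]: "A \<in> sets borel" by (simp add: sets_mu)
      have "emeasure (density \<mu> (\<lambda>z. \<Sum>i<l. f i z)) A = (\<integral>\<^sup>+z. (\<Sum>i<l. f i z * indicator A z) \<partial>\<mu>)"
        using sum_meas A by (subst emeasure_density) (auto simp: sets_mu sum_distrib_right cong: measurable_cong_sets)
      also have "\<dots> = (\<Sum>i<l. \<integral>\<^sup>+z. f i z * indicator A z \<partial>\<mu>)"
        by (intro nn_integral_sum) auto
      also have "\<dots> = (\<Sum>i<l. ennreal (p i) * (\<integral>\<^sup>+z. indicator A (S i z) \<partial>\<mu>))"
        by (intro sum.cong refl f_int[symmetric]) auto
      also have "\<dots> = (\<integral>\<^sup>+z. indicator A z \<partial>\<mu>)"
        by (intro nn_integral_mu[symmetric]) auto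
      finally show "emeasure (density \<mu> (\<lambda>z. \<Sum>i<l. f i z)) A = emeasure (density \<mu> (\<lambda>_. 1)) A"
        by (simp add: density_1)
    qed simp
  qed (use sum_meas in \<open>auto simp: sets_mu cong: measurable_cong_sets\<close>)
  note ae1 = this
  \<comment> \<open>On the exceptional null set all weight goes to letter \<open>0\<close>, which
    exists by \<open>l_pos\<close>. On the good set indices from \<open>l\<close> on get
    \<open>0\<close>, because \<open>f i\<close> is arbitrary there.\<close>
  define q where "q i z = (if (\<Sum>i<l. f i z) = 1 then (if i < l then enn2real (f i z) else 0)
      else if i = 0 then 1 else 0)" for i z
  have "q i \<in> borel_measurable borel" for i
  proof (cases "i < l")
    case True
    note [measurable] = f[OF True] sum_meas
    show ?thesis unfolding q_def using True by simp
  next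
    case False
    note [measurable] = sum_meas
    have "q i = (\<lambda>z. if (\<Sum>i<l. f i z) = 1 then 0 else if i = 0 then 1 else 0)"
      using False by (auto simp: q_def fun_eq_iff)
    then show ?thesis by simp
  qed
  moreover have "0 \<le> q i z" for i z by (simp add: q_def)
  moreover have fin: "f i z \<noteq> \<top>" if "(\<Sum>i<l. f i z) = 1" "i < l" for i z
    using member_le_sum[of i "{..<l}" "\<lambda>i. f i z"] that by (auto simp: top_unique)
  have "(\<Sum>i<l. q i z) = 1" for z
  proof (cases "(\<Sum>i<l. f i z) = 1")
    case True
    have "ennreal (\<Sum>i<l. enn2real (f i z)) = (\<Sum>i<l. ennreal (enn2real (f i z)))"
      by (rule sum_ennreal[symmetric]) simp
    also have "\<dots> = (\<Sum>i<l. f i z)"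
      using fin[OF True] by (intro sum.cong) (auto simp: less_top)
    finally have "(\<Sum>i<l. enn2real (f i z)) = 1"
      using True by simp
    then show ?thesis using True by (simp add: q_def)
  next
    case False
    then show ?thesis using l_pos by (simp add: q_def sum.delta)
  qed
  moreover have "ennreal (p i) * (\<integral>\<^sup>+z. g (S i z) \<partial>\<mu>) = (\<integral>\<^sup>+z. ennreal (q i z) * g z \<partial>\<mu>)"
    if "i < l" "g \<in> borel_measurable borel" for i g
  proof -
    have "(\<integral>\<^sup>+z. f i z * g z \<partial>\<mu>) = (\<integral>\<^sup>+z. ennreal (q i z) * g z \<partial>\<mu>)"
      by (rule nn_integral_cong_AE, use ae1 in eventually_elim)
         (use fin that in \<open>auto simp: q_def less_top\<close>)
    then show ?thesis using f_int[OF that] by simp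
  qed
  ultimately show ?thesis by (intro exI[of _ q]) blast
qed

text \<open>\<open>posterior i z\<close> is the conditional probability that a random word coding \<open>z\<close> starts with \<open>i\<close>.\<close>

definition posterior :: "nat \<Rightarrow> 'a \<Rightarrow> real" where
  "posterior = (SOME q. (\<forall>i. q i \<in> borel_measurable borel) \<and> (\<forall>i z. 0 \<le> q i z) \<and>
    (\<forall>z. (\<Sum>i<l. q i z) = 1) \<and>
    (\<forall>i<l. \<forall>f\<in>borel_measurable borel.
      ennreal (p i) * (\<integral>\<^sup>+z. f (S i z) \<partial>\<mu>) = (\<integral>\<^sup>+z. ennreal (q i z) * f z \<partial>\<mu>)))"

lemma
  shows posterior_measurable [measurable]: "posterior i \<in> borel_measurable borel"
    and posterior_nonneg: "0 \<le> posterior i z"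
    and posterior_sum: "(\<Sum>i<l. posterior i z) = 1"
    and nn_integral_posterior: "i < l \<Longrightarrow> f \<in> borel_measurable borel \<Longrightarrow>
      ennreal (p i) * (\<integral>\<^sup>+z. f (S i z) \<partial>\<mu>) = (\<integral>\<^sup>+z. ennreal (posterior i z) * f z \<partial>\<mu>)"
  using someI_ex[OF ex_posterior] unfolding posterior_def[symmetric] by blast+

lemma posterior_le_1: "i < l \<Longrightarrow> posterior i z \<le> 1"
  using member_le_sum[of i "{..<l}" "\<lambda>i. posterior i z"] posterior_nonneg posterior_sum by auto

lemma measurable_letter_coding:
  assumes "\<And>i. i < l \<Longrightarrow> F i \<in> measurable borel N"
  shows "(\<lambda>x. F (x k) (coding (seq_shift k x))) \<in> measurable P N"
proof (rule measurable_letter_compose[where g = "\<lambda>x. x" and F = "\<lambda>i x. F i (coding (seq_shift k x))"])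
  fix i assume "i < l"
  from measurable_compose[OF measurable_compose[OF words.shift_measurable coding_measurable] assms[OF this]]
  show "(\<lambda>x. F i (coding (seq_shift k x))) \<in> measurable P N" .
qed simp

lemma measurable_letter_coding_0:
  assumes "\<And>i. i < l \<Longrightarrow> F i \<in> measurable borel N"
  shows "(\<lambda>x. F (x 0) (coding x)) \<in> measurable P N"
  using measurable_letter_coding[of F N 0] assms by simp

text \<open>The joint law of first letter and coded point. Splitting off the letter \<open>i\<close>
  turns \<open>coding\<close> into \<open>S i\<close> applied to the coded tail, and the change of
  variables defining \<open>posterior\<close> moves the integral back to the coded point.\<close>

lemma nn_integral_letter_coding:
  fixes F :: "nat \<Rightarrow> 'a \<Rightarrow> ennreal"
  assumes F: "\<And>i. i < l \<Longrightarrow> F i \<in> borel_measurable borel"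
  shows "(\<integral>\<^sup>+x. F (x 0) (coding x) \<partial>P) = (\<Sum>i<l. \<integral>\<^sup>+z. ennreal (posterior i z) * F i z \<partial>\<mu>)"
proof -
  have "(\<integral>\<^sup>+x. F (x 0) (coding x) \<partial>P) = (\<Sum>i<l. ennreal (p i) * (\<integral>\<^sup>+x. F i (coding (case_nat i x)) \<partial>P))"
    by (subst nn_integral_P[OF measurable_letter_coding_0[OF F]]) simp_all
  also have "\<dots> = (\<Sum>i<l. \<integral>\<^sup>+z. ennreal (posterior i z) * F i z \<partial>\<mu>)"
  proof (rule sum.cong)
    fix i assume "i \<in> {..<l}"
    then have i: "i < l" by simp
    have "(\<integral>\<^sup>+x. F i (coding (case_nat i x)) \<partial>P) = (\<integral>\<^sup>+x. F i (S i (coding x)) \<partial>P)"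
      by (intro nn_integral_cong) (simp add: coding_case_nat i)
    also have "\<dots> = (\<integral>\<^sup>+z. F i (S i z) \<partial>\<mu>)"
      using measurable_compose[OF measurable_S[OF i] F[OF i]] by (rule nn_integral_coding)
    finally show "ennreal (p i) * (\<integral>\<^sup>+x. F i (coding (case_nat i x)) \<partial>P)
        = (\<integral>\<^sup>+z. ennreal (posterior i z) * F i z \<partial>\<mu>)"
      using nn_integral_posterior[OF i F[OF i]] by simp
  qed simp
  finally show ?thesis .
qed

lemma integral_letter_coding_nonneg:
  fixes F :: "nat \<Rightarrow> 'a \<Rightarrow> real"
  assumes F [measurable]: "\<And>i. i < l \<Longrightarrow> F i \<in> borel_measurable borel"
    and nonneg: "\<And>i z. 0 \<le> F i z"
    and int: "\<And>i. i < l \<Longrightarrow> integrable \<mu> (\<lambda>z. posterior i z * F i z)"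
  shows "integrable P (\<lambda>x. F (x 0) (coding x)) \<and>
    (\<integral>x. F (x 0) (coding x) \<partial>P) = (\<Sum>i<l. \<integral>z. posterior i z * F i z \<partial>\<mu>)"
proof (subst nn_integral_eq_integrable[symmetric])
  show "(\<lambda>x. F (x 0) (coding x)) \<in> borel_measurable P"
    by (rule measurable_letter_coding_0) (rule F)
  have nn: "0 \<le> (\<integral>z. posterior i z * F i z \<partial>\<mu>)" for i
    by (intro Bochner_Integration.integral_nonneg mult_nonneg_nonneg posterior_nonneg nonneg)
  then show "0 \<le> (\<Sum>i<l. \<integral>z. posterior i z * F i z \<partial>\<mu>)" by (intro sum_nonneg)
  have "(\<integral>\<^sup>+x. ennreal (F (x 0) (coding x)) \<partial>P)
      = (\<Sum>i<l. \<integral>\<^sup>+z. ennreal (posterior i z) * ennreal (F i z) \<partial>\<mu>)"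
    by (intro nn_integral_letter_coding) auto
  also have "\<dots> = (\<Sum>i<l. ennreal (\<integral>z. posterior i z * F i z \<partial>\<mu>))"
  proof (rule sum.cong)
    fix i assume "i \<in> {..<l}"
    then have "(\<integral>\<^sup>+z. ennreal (posterior i z * F i z) \<partial>\<mu>) = ennreal (\<integral>z. posterior i z * F i z \<partial>\<mu>)"
      by (intro nn_integral_eq_integral int AE_I2 mult_nonneg_nonneg posterior_nonneg nonneg) auto
    then show "(\<integral>\<^sup>+z. ennreal (posterior i z) * ennreal (F i z) \<partial>\<mu>) = ennreal (\<integral>z. posterior i z * F i z \<partial>\<mu>)"
      by (simp add: ennreal_mult posterior_nonneg nonneg)
  qed simp
  also have "\<dots> = ennreal (\<Sum>i<l. \<integral>z. posterior i z * F i z \<partial>\<mu>)"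
    using nn by (intro sum_ennreal)
  finally show "(\<integral>\<^sup>+x. ennreal (F (x 0) (coding x)) \<partial>P) = ennreal (\<Sum>i<l. \<integral>z. posterior i z * F i z \<partial>\<mu>)" .
qed (use nonneg in simp_all)

text \<open>Integrability is asked of the weighted functions only: \<open>ln (posterior i z)\<close>
  may fail to be integrable by itself where the posterior is small, while its product with the
  posterior is bounded.\<close>

lemma integral_letter_coding:
  fixes F :: "nat \<Rightarrow> 'a \<Rightarrow> real"
  assumes F: "\<And>i. i < l \<Longrightarrow> F i \<in> borel_measurable borel"
    and int: "\<And>i. i < l \<Longrightarrow> integrable \<mu> (\<lambda>z. posterior i z * F i z)"
  shows "integrable P (\<lambda>x. F (x 0) (coding x))"
    and "(\<integral>x. F (x 0) (coding x) \<partial>P) = (\<Sum>i<l. \<integral>z. posterior i z * F i z \<partial>\<mu>)"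
proof -
  define F1 F2 where "F1 i z = max 0 (F i z)" and "F2 i z = max 0 (- F i z)" for i z
  have split: "F i z = F1 i z - F2 i z" for i z by (simp add: F1_def F2_def)
  have q: "posterior i z * F1 i z = max 0 (posterior i z * F i z)"
    "posterior i z * F2 i z = max 0 (- (posterior i z * F i z))" for i z
    using posterior_nonneg[of i z]
    by (auto simp: F1_def F2_def max_def mult_le_0_iff zero_le_mult_iff mult_nonneg_nonpos split: if_splits)
  have i1: "integrable \<mu> (\<lambda>z. posterior i z * F1 i z)" "integrable \<mu> (\<lambda>z. posterior i z * F2 i z)" if "i < l" for i
    unfolding q using int[OF that] by (auto intro!: integrable_max)
  have 1: "integrable P (\<lambda>x. F1 (x 0) (coding x)) \<and>
    (\<integral>x. F1 (x 0) (coding x) \<partial>P) = (\<Sum>i<l. \<integral>z. posterior i z * F1 i z \<partial>\<mu>)"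
    by (rule integral_letter_coding_nonneg) (use F i1 in \<open>auto simp: F1_def\<close>)
  have 2: "integrable P (\<lambda>x. F2 (x 0) (coding x)) \<and>
    (\<integral>x. F2 (x 0) (coding x) \<partial>P) = (\<Sum>i<l. \<integral>z. posterior i z * F2 i z \<partial>\<mu>)"
    by (rule integral_letter_coding_nonneg) (use F i1 in \<open>auto simp: F2_def\<close>)
  show "integrable P (\<lambda>x. F (x 0) (coding x))"
    unfolding split using 1 2 by auto
  have "(\<integral>x. F (x 0) (coding x) \<partial>P) = (\<Sum>i<l. \<integral>z. posterior i z * F1 i z \<partial>\<mu>) - (\<Sum>i<l. \<integral>z. posterior i z * F2 i z \<partial>\<mu>)"
    unfolding split using 1 2 by (subst Bochner_Integration.integral_diff) auto
  also have "\<dots> = (\<Sum>i<l. \<integral>z. posterior i z * F i z \<partial>\<mu>)"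
    using i1 unfolding split right_diff_distrib by (simp add: sum_subtractf)
  finally show "(\<integral>x. F (x 0) (coding x) \<partial>P) = (\<Sum>i<l. \<integral>z. posterior i z * F i z \<partial>\<mu>)" .
qed

lemma birkhoff_sum_letter_coding_le:
  fixes F :: "nat \<Rightarrow> 'a \<Rightarrow> real"
  assumes F: "\<And>i. i < l \<Longrightarrow> F i \<in> borel_measurable borel"
    and int: "\<And>i. i < l \<Longrightarrow> integrable \<mu> (\<lambda>z. posterior i z * F i z)"
    and less: "(\<Sum>i<l. \<integral>z. posterior i z * F i z \<partial>\<mu>) < c"
  shows "AE x in P. \<forall>\<^sub>F n in sequentially. (\<Sum>k<n. F (x k) (coding (seq_shift k x))) \<le> c * real n"
  using words.birkhoff_sum_eventually_le[OF integral_letter_coding(1)[OF F int], of c]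
    integral_letter_coding(2)[OF F int] less
  by (simp add: birkhoff_sum_def seq_shift_def)

lemma posterior_integrable: "i < l \<Longrightarrow> integrable \<mu> (posterior i)"
  by (rule mu.integrable_const_bound[where B = 1])
     (auto simp: posterior_nonneg posterior_le_1 sets_mu cong: measurable_cong_sets)

lemma integral_posterior_set:
  assumes i: "i < l" and A [measurable]: "A \<in> sets borel"
  shows "(\<integral>z. indicator A z * posterior i z \<partial>\<mu>) = p i * measure \<mu> (S i -` A)"
proof -
  have [measurable]: "S i -` A \<in> sets borel"
    using measurable_sets[OF measurable_S[OF i] A] by simp
  have "(\<integral>\<^sup>+z. ennreal (indicator A z * posterior i z) \<partial>\<mu>) = (\<integral>\<^sup>+z. ennreal (posterior i z) * indicator A z \<partial>\<mu>)"
    by (intro nn_integral_cong) (auto simp: indicator_def)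
  also have "\<dots> = ennreal (p i) * (\<integral>\<^sup>+z. indicator A (S i z) \<partial>\<mu>)"
    using i by (intro nn_integral_posterior[symmetric]) auto
  also have "\<dots> = ennreal (p i * measure \<mu> (S i -` A))"
    using ppos[OF i] by (simp add: indicator_vimage[symmetric] sets_mu mu.emeasure_eq_measure ennreal_mult')
  finally show ?thesis
    using ppos[OF i] by (intro integral_eq_nn_integral[THEN trans]) (auto simp: posterior_nonneg)
qed

lemma integral_posterior: "i < l \<Longrightarrow> (\<integral>z. posterior i z \<partial>\<mu>) = p i"
  using integral_posterior_set[of i UNIV] mu.prob_space by simp

text \<open>A letter of conditional probability zero is never drawn: the bad event has as
  probability the integral of the posterior over its own zero set. Shift invariance extends this to
  every position, so that quotients and logarithms along a typical word are genuine.\<close>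

lemma AE_posterior_pos: "AE x in P. \<forall>k. 0 < posterior (x k) (coding (seq_shift k x))"
proof -
  have meas: "(\<lambda>x. posterior (x 0) (coding x)) \<in> borel_measurable P"
    by (rule measurable_letter_coding_0) simp
  have "(\<integral>\<^sup>+x. indicator {0} (posterior (x 0) (coding x)) \<partial>P)
      = (\<Sum>i<l. \<integral>\<^sup>+z. ennreal (posterior i z) * indicator {0} (posterior i z) \<partial>\<mu>)"
    by (rule nn_integral_letter_coding[of "\<lambda>i z. indicator {0} (posterior i z)"]) simp
  also have "\<dots> = (\<Sum>i<l. \<integral>\<^sup>+z. 0 \<partial>\<mu>)"
    by (intro sum.cong refl nn_integral_cong) (auto simp: indicator_def)
  finally have zero: "(\<integral>\<^sup>+x. indicator {0} (posterior (x 0) (coding x)) \<partial>P) = 0" by simp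
  have "(\<lambda>x. indicator {0} (posterior (x 0) (coding x)) :: ennreal) \<in> borel_measurable P"
    using meas by measurable
  from nn_integral_0_iff_AE[OF this] zero
  have "AE x in P. indicator {0} (posterior (x 0) (coding x)) = (0 :: ennreal)" by simp
  then have "AE x in P. 0 < posterior (x 0) (coding x)"
    by eventually_elim (use posterior_nonneg in \<open>auto simp: indicator_def order_less_le split: if_splits\<close>)
  then have "AE x in P. 0 < posterior (seq_shift k x 0) (coding (seq_shift k x))" for k
    by (rule words.AE_shift)
  then show ?thesis by (subst AE_all_countable) (simp add: seq_shift_def)
qed

lemma measurable_emeasure_cball:
  fixes T :: "'a \<Rightarrow> 'a"
  assumes T: "T \<in> borel_measurable borel"
  shows "(\<lambda>z. emeasure \<mu> (T -` cball z r)) \<in> borel_measurable borel"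
proof -
  have Tm: "T \<in> borel_measurable \<mu>" using T by (simp add: sets_mu cong: measurable_cong_sets)
  have "(\<lambda>w. dist (fst w) (T (snd w))) \<in> borel_measurable (borel \<Otimes>\<^sub>M \<mu>)"
    by (intro borel_measurable_dist measurable_fst measurable_compose[OF measurable_snd Tm])
  then have set: "{w \<in> space (borel \<Otimes>\<^sub>M \<mu>). dist (fst w) (T (snd w)) \<le> r} \<in> sets (borel \<Otimes>\<^sub>M \<mu>)"
    by (intro borel_measurable_le borel_measurable_const)
  have eq: "emeasure \<mu> (T -` cball z r) = emeasure \<mu> (Pair z -` {w \<in> space (borel \<Otimes>\<^sub>M \<mu>). dist (fst w) (T (snd w)) \<le> r})" for z
    by (rule arg_cong[where f = "emeasure \<mu>"]) (auto simp: space_pair_measure)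
  show ?thesis
    unfolding eq by (rule mu.measurable_emeasure_Pair[OF set])
qed

lemma measurable_emeasure_cball' [measurable]: "(\<lambda>z. emeasure \<mu> (cball z r)) \<in> borel_measurable borel"
  using measurable_emeasure_cball[of "\<lambda>z. z" r] by simp

lemma measurable_measure_cball [measurable]: "(\<lambda>z. measure \<mu> (cball z r)) \<in> borel_measurable borel"
  unfolding measure_def by measurable

lemma AE_mu_norm_le: "AE z in \<mu>. norm z \<le> radius"
proof (subst AE_coding_iff[symmetric])
  show "AE x in P. norm (coding x) \<le> radius" by (intro AE_I2 norm_coding_le)
qed measurable

section \<open>Upper bound for the measure of balls\<close>

definition lipschitz_weights :: "(nat \<Rightarrow> 'a \<Rightarrow> real) \<Rightarrow> real \<Rightarrow> bool" where
  "lipschitz_weights g L \<longleftrightarrow> 0 \<le> L \<and> (\<forall>i<l. g i \<in> borel_measurable borel) \<and> (\<forall>i<l. \<forall>z. 0 < g i z) \<and>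
    (\<forall>z. (\<Sum>i<l. g i z) = 1) \<and> (\<forall>i<l. \<forall>y z. \<bar>ln (g i y) - ln (g i z)\<bar> \<le> L * dist y z)"

text \<open>The reciprocal of the predicted ball measure: the weights \<open>g\<close> stand for the
  posterior of the prefix, the \<open>p (x k)\<close> for its prior.\<close>

definition weight_ratio :: "(nat \<Rightarrow> 'a \<Rightarrow> real) \<Rightarrow> nat \<Rightarrow> (nat \<Rightarrow> nat) \<Rightarrow> real" where
  "weight_ratio g n x = (\<Prod>k<n. g (x k) (coding (seq_shift k x)) / p (x k))"

lemma weight_ratio_case_nat:
  assumes "i < l" "x \<in> space P"
  shows "weight_ratio g (Suc n) (case_nat i x) = g i (S i (coding x)) / p i * weight_ratio g n x"
  unfolding weight_ratio_def using assms
  by (subst prod.lessThan_Suc_shift) (simp add: coding_case_nat)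

lemma cyl_ratio_case_nat: "cyl_ratio (Suc n) (case_nat i x) = \<rho> i * cyl_ratio n x"
  by (simp add: cyl_ratio_Suc)

lemma weight_ratio_measurable:
  assumes "\<And>i. i < l \<Longrightarrow> g i \<in> borel_measurable borel"
  shows "weight_ratio g n \<in> borel_measurable P"
  unfolding weight_ratio_def
  by (intro borel_measurable_prod borel_measurable_divide measurable_letter_coding assms measurable_fun_letter)

text \<open>
  The weights of the words of length \<open>n\<close> sum to one when read off at a fixed point \<open>y\<close>, and
  log-Lipschitz continuity makes reading them off at a nearby point cost only a bounded factor.
\<close>

lemma nn_integral_weight_ratio_le:
  assumes g: "lipschitz_weights g L"
  shows "(\<integral>\<^sup>+x. ennreal (weight_ratio g n x) * indicator {x. dist (coding x) y \<le> cyl_ratio n x} x \<partial>P)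
    \<le> ennreal (exp (L * (\<Sum>j<n. rmax ^ Suc j)))"
proof (induction n arbitrary: y)
  case 0
  have "(\<integral>\<^sup>+x. ennreal (weight_ratio g 0 x) * indicator {x. dist (coding x) y \<le> cyl_ratio 0 x} x \<partial>P)
    \<le> (\<integral>\<^sup>+x. 1 \<partial>P)"
    by (intro nn_integral_mono) (auto simp: weight_ratio_def indicator_def)
  then show ?case by (simp add: words.P.emeasure_space_1)
next
  case (Suc n)
  have gm: "\<And>i. i < l \<Longrightarrow> g i \<in> borel_measurable borel" and gpos: "\<And>i z. i < l \<Longrightarrow> 0 < g i z"
    and gsum: "\<And>z. (\<Sum>i<l. g i z) = 1" and L: "0 \<le> L"
    and lip: "\<And>i y z. i < l \<Longrightarrow> \<bar>ln (g i y) - ln (g i z)\<bar> \<le> L * dist y z"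
    using g by (auto simp: lipschitz_weights_def)
  note [measurable] = weight_ratio_measurable[OF gm]
  let ?c = "exp (L * rmax ^ Suc n)" and ?b = "exp (L * (\<Sum>j<n. rmax ^ Suc j))"
  let ?J = "\<lambda>n y x. ennreal (weight_ratio g n x) * indicator {x. dist (coding x) y \<le> cyl_ratio n x} x"
  have Jm: "?J n y \<in> borel_measurable P" for n y
  proof -
    have "(\<lambda>x. ennreal (weight_ratio g n x) * indicator {x \<in> space P. dist (coding x) y \<le> cyl_ratio n x} x)
        \<in> borel_measurable P"
      by measurable
    then show ?thesis
      by (rule measurable_cong[THEN iffD1, rotated]) (auto simp: indicator_def)
  qed
  have step: "ennreal (p i) * (\<integral>\<^sup>+x. ?J (Suc n) y (case_nat i x) \<partial>P) \<le> ennreal (?c * g i y) * ennreal ?b"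
    if i: "i < l" for i
  proof -
    \<comment> \<open>\<open>S i\<close> scales distances exactly, so closeness to \<open>y\<close>
      at level \<open>Suc n\<close> is closeness to the pulled-back centre \<open>y'\<close> at
      level \<open>n\<close>. This is why the induction keeps the centre arbitrary.\<close>
    obtain y' where y': "y = S i y'" using surj_S[OF i] by blast
    have "ennreal (p i) * ?J (Suc n) y (case_nat i x) \<le> ennreal (?c * g i y) * ?J n y' x"
      if x: "x \<in> space P" for x
    proof -
      have iff: "dist (coding (case_nat i x)) y \<le> cyl_ratio (Suc n) (case_nat i x) \<longleftrightarrow> dist (coding x) y' \<le> cyl_ratio n x"
        using rho[OF i] by (simp add: coding_case_nat[OF i x] y' dist_S[OF i] cyl_ratio_case_nat)
      show ?thesis
      proof (cases "dist (coding x) y' \<le> cyl_ratio n x")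
        case True
        \<comment> \<open>The weight of the first letter is read off at distance at most
          \<open>rmax ^ Suc n\<close> from \<open>y\<close>; over all levels these distances form
          the geometric sum in the bound.\<close>
        have "dist (S i (coding x)) y = \<rho> i * dist (coding x) y'"
          by (simp add: y' dist_S[OF i])
        also have "\<dots> \<le> rmax * rmax ^ n"
          using True rho[OF i] rho_le_rmax[OF i] rmax cyl_ratio_le[OF x, of n]
          by (intro mult_mono) auto
        finally have d: "dist (S i (coding x)) y \<le> rmax ^ Suc n" by simp
        have "ln (g i (S i (coding x))) \<le> ln (g i y) + L * dist (S i (coding x)) y"
          using lip[OF i, of "S i (coding x)" y] by linarith
        also have "\<dots> \<le> ln (g i y) + L * rmax ^ Suc n"
          using d L by (intro add_left_mono mult_left_mono) auto
        finally have "exp (ln (g i (S i (coding x)))) \<le> exp (ln (g i y) + L * rmax ^ Suc n)" by simp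
        then have gle: "g i (S i (coding x)) \<le> ?c * g i y"
          using gpos[OF i] by (simp add: exp_add mult.commute)
        have wn: "0 \<le> weight_ratio g n x"
          unfolding weight_ratio_def using gpos ppos letter_less[OF x]
          by (intro prod_nonneg) (auto simp: order_less_imp_le)
        have "ennreal (p i) * ennreal (weight_ratio g (Suc n) (case_nat i x))
          = ennreal (g i (S i (coding x)) * weight_ratio g n x)"
          using ppos[OF i] by (simp add: weight_ratio_case_nat[OF i x] flip: ennreal_mult')
        also have "\<dots> \<le> ennreal (?c * g i y * weight_ratio g n x)"
          using gle wn by (intro ennreal_leI mult_right_mono)
        also have "\<dots> = ennreal (?c * g i y) * ennreal (weight_ratio g n x)"
          using gpos[OF i] wn by (intro ennreal_mult) (auto simp: order_less_imp_le)
        finally show ?thesis using True iff by simp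
      next
        case False
        then show ?thesis using iff by simp
      qed
    qed
    then have "(\<integral>\<^sup>+x. ennreal (p i) * ?J (Suc n) y (case_nat i x) \<partial>P)
        \<le> (\<integral>\<^sup>+x. ennreal (?c * g i y) * ?J n y' x \<partial>P)"
      by (intro nn_integral_mono) auto
    also have "\<dots> = ennreal (?c * g i y) * (\<integral>\<^sup>+x. ?J n y' x \<partial>P)"
      using Jm by (intro nn_integral_cmult)
    also have "\<dots> \<le> ennreal (?c * g i y) * ennreal ?b"
      by (intro mult_left_mono Suc.IH) auto
    finally show ?thesis
      using measurable_compose[OF _ Jm[of "Suc n" y], of "case_nat i" P] i
      by (subst (asm) nn_integral_cmult) auto
  qed
  have "(\<integral>\<^sup>+x. ?J (Suc n) y x \<partial>P) = (\<Sum>i<l. ennreal (p i) * (\<integral>\<^sup>+x. ?J (Suc n) y (case_nat i x) \<partial>P))"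
    by (rule nn_integral_P[OF Jm])
  also have "\<dots> \<le> (\<Sum>i<l. ennreal (?c * g i y) * ennreal ?b)"
    by (intro sum_mono step) auto
  also have "\<dots> = (\<Sum>i<l. ennreal (?c * g i y * ?b))"
    using gpos by (intro sum.cong refl ennreal_mult[symmetric]) (auto simp: order_less_imp_le)
  also have "\<dots> = ennreal (\<Sum>i<l. ?c * g i y * ?b)"
    using gpos by (intro sum_ennreal) (auto simp: order_less_imp_le)
  also have "(\<Sum>i<l. ?c * g i y * ?b) = ?c * ?b"
    using gsum[of y] by (simp add: mult.commute mult.left_commute flip: sum_distrib_left sum_distrib_right)
  also have "?c * ?b = exp (L * (\<Sum>j<Suc n. rmax ^ Suc j))"
    by (simp add: distrib_left exp_add)
  finally show ?case .
qed

text \<open>The measure of the ball is the probability that an independent point \<open>y\<close>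
  with law \<mu> falls into it. After exchanging the integrals, \<open>y\<close> is fixed and
  \<open>nn_integral_weight_ratio_le\<close> applies; its bound is uniform in \<open>n\<close>
  because the geometric sum converges.\<close>

lemma AE_ball_measure_upper:
  assumes g: "lipschitz_weights g L" and "0 < e"
  shows "AE x in P. \<forall>\<^sub>F n in sequentially.
    weight_ratio g n x * measure \<mu> (cball (coding x) (cyl_ratio n x)) \<le> exp (e * real n)"
proof -
  have gm: "\<And>i. i < l \<Longrightarrow> g i \<in> borel_measurable borel" and gpos: "\<And>i z. i < l \<Longrightarrow> 0 < g i z" and L: "0 \<le> L"
    using g by (auto simp: lipschitz_weights_def)
  note [measurable] = weight_ratio_measurable[OF gm]
  let ?F = "\<lambda>n x. ennreal (weight_ratio g n x) * emeasure \<mu> (cball (coding x) (cyl_ratio n x))"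
  let ?I = "\<lambda>n w. ennreal (weight_ratio g n (fst w)) * indicator {w \<in> space (P \<Otimes>\<^sub>M \<mu>). dist (coding (fst w)) (snd w) \<le> cyl_ratio n (fst w)} w"
  have Im: "?I n \<in> borel_measurable (P \<Otimes>\<^sub>M \<mu>)" for n
    by measurable
  have F_eq: "(\<integral>\<^sup>+y. ?I n (x, y) \<partial>\<mu>) = ?F n x" if "x \<in> space P" for n x
  proof -
    have "(\<integral>\<^sup>+y. ?I n (x, y) \<partial>\<mu>)
        = (\<integral>\<^sup>+y. ennreal (weight_ratio g n x) * indicator (cball (coding x) (cyl_ratio n x)) y \<partial>\<mu>)"
      using that by (intro nn_integral_cong) (auto simp: indicator_def space_pair_measure)
    also have "\<dots> = ?F n x"
      by (rule nn_integral_cmult_indicator) (simp add: sets_mu)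
    finally show ?thesis .
  qed
  have Fm: "?F n \<in> borel_measurable P" for n
    using mu.borel_measurable_nn_integral_fst[OF Im, of n]
    by (rule measurable_cong[THEN iffD1, rotated]) (rule F_eq)
  have bound: "(\<integral>\<^sup>+x. ?F n x \<partial>P) \<le> ennreal (exp (L * (1 / (1 - rmax))))" for n
  proof -
    have "(\<integral>\<^sup>+x. ?F n x \<partial>P) = (\<integral>\<^sup>+x. (\<integral>\<^sup>+y. ?I n (x, y) \<partial>\<mu>) \<partial>P)"
      by (intro nn_integral_cong F_eq[symmetric])
    also have "\<dots> = (\<integral>\<^sup>+y. (\<integral>\<^sup>+x. ?I n (x, y) \<partial>P) \<partial>\<mu>)"
      by (rule pair.Fubini[OF Im, symmetric])
    also have "\<dots> \<le> (\<integral>\<^sup>+y. ennreal (exp (L * (\<Sum>j<n. rmax ^ Suc j))) \<partial>\<mu>)"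
    proof (rule nn_integral_mono)
      fix y
      have "(\<integral>\<^sup>+x. ?I n (x, y) \<partial>P)
        = (\<integral>\<^sup>+x. ennreal (weight_ratio g n x) * indicator {x. dist (coding x) y \<le> cyl_ratio n x} x \<partial>P)"
        by (intro nn_integral_cong) (auto simp: indicator_def space_pair_measure)
      also have "\<dots> \<le> ennreal (exp (L * (\<Sum>j<n. rmax ^ Suc j)))"
        by (rule nn_integral_weight_ratio_le[OF g])
      finally show "(\<integral>\<^sup>+x. ?I n (x, y) \<partial>P) \<le> ennreal (exp (L * (\<Sum>j<n. rmax ^ Suc j)))" .
    qed
    also have "\<dots> = ennreal (exp (L * (\<Sum>j<n. rmax ^ Suc j)))"
      using mu.emeasure_space_1 by simp
    also have "\<dots> \<le> ennreal (exp (L * (1 / (1 - rmax))))"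
    proof -
      have "(\<Sum>j<n. rmax ^ Suc j) \<le> (\<Sum>j<n. rmax ^ j)"
        using rmax by (intro sum_mono) (simp add: mult_left_le_one_le)
      also have "\<dots> \<le> 1 / (1 - rmax)"
        using rmax sum_le_suminf[OF summable_geometric, of rmax "{..<n}"] by (simp add: suminf_geometric)
      finally show ?thesis
        using L by (intro ennreal_leI exp_le_cancel_iff[THEN iffD2] mult_left_mono)
    qed
    finally show ?thesis .
  qed
  from words.AE_eventually_le_exp[OF Fm bound \<open>0 < e\<close>]
  show ?thesis
  proof (rule AE_mp, intro AE_I2 impI)
    fix x assume x: "x \<in> space P"
    assume ev: "\<forall>\<^sub>F n in sequentially. ?F n x \<le> ennreal (exp (e * real n))"
    have "0 \<le> weight_ratio g n x" for n
      unfolding weight_ratio_def using gpos ppos letter_less[OF x]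
      by (intro prod_nonneg) (auto simp: order_less_imp_le)
    with ev show "\<forall>\<^sub>F n in sequentially. weight_ratio g n x * measure \<mu> (cball (coding x) (cyl_ratio n x)) \<le> exp (e * real n)"
      by (simp add: mu.emeasure_eq_measure flip: ennreal_mult)
  qed
qed

section \<open>Lower bound for the measure of balls\<close>

definition posterior_ratio :: "nat \<Rightarrow> (nat \<Rightarrow> nat) \<Rightarrow> ennreal" where
  "posterior_ratio n x = (\<Prod>k<n. ennreal (p (x k)) / ennreal (posterior (x k) (coding (seq_shift k x))))"

lemma posterior_ratio_case_nat:
  assumes "i < l" "x \<in> space P"
  shows "posterior_ratio (Suc n) (case_nat i x)
    = ennreal (p i) / ennreal (posterior i (S i (coding x))) * posterior_ratio n x"
  unfolding posterior_ratio_def using assms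
  by (subst prod.lessThan_Suc_shift) (simp add: coding_case_nat)

lemma posterior_ratio_measurable [measurable]: "posterior_ratio n \<in> borel_measurable P"
proof -
  have "(\<lambda>x. ennreal (p (x k)) / ennreal (posterior (x k) (coding (seq_shift k x)))) \<in> borel_measurable P" for k
    using measurable_letter_coding[where F = "\<lambda>i z. ennreal (p i) / ennreal (posterior i z)" and k = k] by simp
  then show ?thesis unfolding posterior_ratio_def by measurable
qed

text \<open>Twice \<open>radius\<close> bounds the diameter of the set of coded points; the added
  \<open>1\<close> keeps the constant positive when \<open>radius\<close> is zero.\<close>

definition diam_bound :: real where
  "diam_bound = 2 * radius + 1"

lemma diam_bound_pos: "0 < diam_bound"
  using radius_nonneg by (simp add: diam_bound_def)

text \<open>
  Every cylinder of diameter at most \<open>r\<close> meeting \<open>z\<close> lies in the ball of radius \<open>r\<close> around \<open>z\<close>,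
  so the probabilities of these cylinders sum to at most the measure of the ball.
\<close>

lemma nn_integral_posterior_ratio_le:
  assumes "f \<in> borel_measurable borel"
  shows "(\<integral>\<^sup>+x. f (coding x) * posterior_ratio n x * indicator {x. diam_bound * cyl_ratio n x \<le> r} x \<partial>P)
    \<le> (\<integral>\<^sup>+z. f z * emeasure \<mu> (cball z r) \<partial>\<mu>)"
  using assms
proof (induction n arbitrary: f r)
  case 0
  note [measurable] = 0
  have "(\<integral>\<^sup>+x. f (coding x) * posterior_ratio 0 x * indicator {x. diam_bound * cyl_ratio 0 x \<le> r} x \<partial>P)
      = (\<integral>\<^sup>+x. f (coding x) * of_bool (diam_bound \<le> r) \<partial>P)"
    by (intro nn_integral_cong) (auto simp: posterior_ratio_def indicator_def)
  also have "\<dots> = (\<integral>\<^sup>+z. f z * of_bool (diam_bound \<le> r) \<partial>\<mu>)"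
    by (rule nn_integral_coding) simp
  also have "\<dots> \<le> (\<integral>\<^sup>+z. f z * emeasure \<mu> (cball z r) \<partial>\<mu>)"
  proof (rule nn_integral_mono_AE, use AE_mu_norm_le in eventually_elim)
    case (elim z)
    show ?case
    proof (cases "diam_bound \<le> r")
      case True
      \<comment> \<open>For the empty word the cylinder is everything: \<mu> lives on a set of
        diameter less than \<open>diam_bound\<close>, so the ball has full measure.\<close>
      have "AE w in \<mu>. w \<in> cball z r"
        using AE_mu_norm_le
      proof eventually_elim
        case (elim w)
        have "dist z w \<le> norm z + norm w" by (simp add: dist_norm norm_triangle_ineq4)
        then show ?case using elim \<open>norm z \<le> radius\<close> True by (simp add: diam_bound_def)
      qed
      then have "emeasure \<mu> (cball z r) = 1"
        by (subst mu.emeasure_eq_1_AE) (auto simp: sets_mu)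
      then show ?thesis using True by simp
    qed simp
  qed
  finally show ?case .
next
  case (Suc n)
  note [measurable] = Suc.prems
  let ?K = "\<lambda>x. f (coding x) * posterior_ratio (Suc n) x * indicator {x. diam_bound * cyl_ratio (Suc n) x \<le> r} x"
  let ?q = "\<lambda>i z. ennreal (p i) / ennreal (posterior i z)"
  have Km: "?K \<in> borel_measurable P"
  proof -
    have "(\<lambda>x. f (coding x) * posterior_ratio (Suc n) x * indicator {x \<in> space P. diam_bound * cyl_ratio (Suc n) x \<le> r} x)
        \<in> borel_measurable P"
      by measurable
    then show ?thesis
      by (rule measurable_cong[THEN iffD1, rotated]) (auto simp: indicator_def)
  qed
  have step: "ennreal (p i) * (\<integral>\<^sup>+x. ?K (case_nat i x) \<partial>P)
      \<le> (\<integral>\<^sup>+z. f z * (ennreal (p i) * emeasure \<mu> (S i -` cball z r)) \<partial>\<mu>)" if i: "i < l" for i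
  proof -
    \<comment> \<open>Prefixing \<open>i\<close> replaces \<open>f\<close> by its composition with
      \<open>S i\<close> times the new factor \<open>?q i\<close>, and \<open>r\<close> by
      \<open>r / \<rho> i\<close>. The induction therefore has to range over all \<open>f\<close>
      and \<open>r\<close>.\<close>
    note [measurable] = measurable_S[OF i] measurable_emeasure_cball[OF measurable_S[OF i]]
    have "(\<integral>\<^sup>+x. ?K (case_nat i x) \<partial>P)
        = (\<integral>\<^sup>+x. f (S i (coding x)) * ?q i (S i (coding x)) * posterior_ratio n x
            * indicator {x. diam_bound * cyl_ratio n x \<le> r / \<rho> i} x \<partial>P)"
      using rho[OF i]
      by (intro nn_integral_cong)
         (simp add: coding_case_nat[OF i] posterior_ratio_case_nat[OF i] cyl_ratio_case_nat indicator_def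
           field_simps mult.assoc)
    also have "\<dots> \<le> (\<integral>\<^sup>+z. f (S i z) * ?q i (S i z) * emeasure \<mu> (cball z (r / \<rho> i)) \<partial>\<mu>)"
      by (rule Suc.IH) measurable
    also have "\<dots> = (\<integral>\<^sup>+z. f (S i z) * ?q i (S i z) * emeasure \<mu> (S i -` cball (S i z) r) \<partial>\<mu>)"
    proof (intro nn_integral_cong arg_cong2[where f = "(*)"] refl arg_cong[where f = "emeasure \<mu>"])
      fix z show "cball z (r / \<rho> i) = S i -` cball (S i z) r"
        using rho[OF i] by (auto simp: dist_S[OF i] field_simps)
    qed
    finally have "ennreal (p i) * (\<integral>\<^sup>+x. ?K (case_nat i x) \<partial>P)
        \<le> ennreal (p i) * (\<integral>\<^sup>+z. f (S i z) * ?q i (S i z) * emeasure \<mu> (S i -` cball (S i z) r) \<partial>\<mu>)"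
      by (rule mult_left_mono) simp
    also have "\<dots> = (\<integral>\<^sup>+z. ennreal (posterior i z) * (f z * ?q i z * emeasure \<mu> (S i -` cball z r)) \<partial>\<mu>)"
      by (rule nn_integral_posterior[OF i]) measurable
    also have "\<dots> \<le> (\<integral>\<^sup>+z. f z * (ennreal (p i) * emeasure \<mu> (S i -` cball z r)) \<partial>\<mu>)"
    proof (rule nn_integral_mono)
      fix z
      \<comment> \<open>Where the posterior vanishes the quotient is infinite, but its product with
        zero is zero; elsewhere the factors cancel to \<open>p i\<close>.\<close>
      have le: "ennreal (posterior i z) * ?q i z \<le> ennreal (p i)"
        using posterior_nonneg[of i z] ppos[OF i]
        by (cases "posterior i z = 0") (auto simp: divide_ennreal order_less_le simp flip: ennreal_mult)
      have "ennreal (posterior i z) * (f z * ?q i z * emeasure \<mu> (S i -` cball z r))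
          = f z * ((ennreal (posterior i z) * ?q i z) * emeasure \<mu> (S i -` cball z r))"
        by (simp only: ac_simps)
      also have "\<dots> \<le> f z * (ennreal (p i) * emeasure \<mu> (S i -` cball z r))"
        by (intro mult_left_mono mult_right_mono le) auto
      finally show "ennreal (posterior i z) * (f z * ?q i z * emeasure \<mu> (S i -` cball z r))
          \<le> f z * (ennreal (p i) * emeasure \<mu> (S i -` cball z r))" .
    qed
    finally show ?thesis .
  qed
  have "(\<integral>\<^sup>+x. ?K x \<partial>P) = (\<Sum>i<l. ennreal (p i) * (\<integral>\<^sup>+x. ?K (case_nat i x) \<partial>P))"
    by (rule nn_integral_P[OF Km])
  also have "\<dots> \<le> (\<Sum>i<l. \<integral>\<^sup>+z. f z * (ennreal (p i) * emeasure \<mu> (S i -` cball z r)) \<partial>\<mu>)"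
    by (intro sum_mono step) simp
  also have "\<dots> = (\<integral>\<^sup>+z. (\<Sum>i<l. f z * (ennreal (p i) * emeasure \<mu> (S i -` cball z r))) \<partial>\<mu>)"
  proof (rule nn_integral_sum[symmetric])
    fix i assume "i \<in> {..<l}"
    then have [measurable]: "(\<lambda>z. emeasure \<mu> (S i -` cball z r)) \<in> borel_measurable borel"
      by (intro measurable_emeasure_cball measurable_S) simp
    show "(\<lambda>z. f z * (ennreal (p i) * emeasure \<mu> (S i -` cball z r))) \<in> borel_measurable \<mu>"
      by measurable
  qed
  also have "\<dots> = (\<integral>\<^sup>+z. f z * emeasure \<mu> (cball z r) \<partial>\<mu>)"
    \<comment> \<open>Self-similarity of \<mu>, applied to the ball, reassembles the pieces.\<close>
    by (intro nn_integral_cong) (simp add: emeasure_mu[of "cball _ r"] sum_distrib_left)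
  finally show ?case .
qed

text \<open>With the reciprocal ball measure as test function the preceding estimate gives
  expectations at most one. The radii are deterministic while the cylinder sizes are random, hence
  the premise on \<open>cyl_ratio\<close>, which the ergodic theorem supplies in
  \<open>AE_cball_ge\<close>.\<close>

lemma AE_ball_measure_lower:
  assumes "0 < e" and r: "\<And>n. 0 < r n"
  shows "AE x in P. \<forall>\<^sub>F n in sequentially. diam_bound * cyl_ratio n x \<le> r n \<longrightarrow>
    posterior_ratio n x \<le> ennreal (exp (e * real n) * measure \<mu> (cball (coding x) (r n)))"
proof -
  let ?f = "\<lambda>n z. 1 / emeasure \<mu> (cball z (r n))"
  let ?F = "\<lambda>n x. ?f n (coding x) * posterior_ratio n x * indicator {x \<in> space P. diam_bound * cyl_ratio n x \<le> r n} x"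
  have Fm: "?F n \<in> borel_measurable P" for n by measurable
  have bound: "(\<integral>\<^sup>+x. ?F n x \<partial>P) \<le> ennreal 1" for n
  proof -
    have "(\<integral>\<^sup>+x. ?F n x \<partial>P) = (\<integral>\<^sup>+x. ?f n (coding x) * posterior_ratio n x * indicator {x. diam_bound * cyl_ratio n x \<le> r n} x \<partial>P)"
      by (intro nn_integral_cong) (auto simp: indicator_def)
    also have "\<dots> \<le> (\<integral>\<^sup>+z. ?f n z * emeasure \<mu> (cball z (r n)) \<partial>\<mu>)"
      by (rule nn_integral_posterior_ratio_le) measurable
    also have "\<dots> \<le> (\<integral>\<^sup>+z. 1 \<partial>\<mu>)"
    proof (rule nn_integral_mono)
      fix z
      show "?f n z * emeasure \<mu> (cball z (r n)) \<le> 1"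
        by (cases "emeasure \<mu> (cball z (r n)) = 0")
           (auto simp: ennreal_divide_times mu.emeasure_eq_measure)
    qed
    finally show ?thesis using mu.emeasure_space_1 by simp
  qed
  from words.AE_eventually_le_exp[OF Fm bound \<open>0 < e\<close>]
  show ?thesis
  proof (rule AE_mp, intro AE_I2 impI)
    fix x assume x: "x \<in> space P"
    assume ev: "\<forall>\<^sub>F n in sequentially. ?F n x \<le> ennreal (exp (e * real n))"
    have W: "posterior_ratio n x \<noteq> 0" for n
    proof -
      have "0 < p (x k)" for k using ppos letter_less[OF x] by blast
      then show ?thesis
        unfolding posterior_ratio_def by (auto simp: ennreal_divide_eq_0_iff ennreal_eq_0_iff not_le[symmetric])
    qed
    from ev show "\<forall>\<^sub>F n in sequentially. diam_bound * cyl_ratio n x \<le> r n \<longrightarrow>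
      posterior_ratio n x \<le> ennreal (exp (e * real n) * measure \<mu> (cball (coding x) (r n)))"
    proof (eventually_elim, intro impI)
      fix n assume "?F n x \<le> ennreal (exp (e * real n))" "diam_bound * cyl_ratio n x \<le> r n"
      then have le: "?f n (coding x) * posterior_ratio n x \<le> ennreal (exp (e * real n))"
        using x by simp
      \<comment> \<open>On a null ball \<open>?f n\<close> would be infinite, and so would its
        product with the nonzero \<open>posterior_ratio\<close>.\<close>
      have pos: "emeasure \<mu> (cball (coding x) (r n)) \<noteq> 0"
      proof
        assume "emeasure \<mu> (cball (coding x) (r n)) = 0"
        with le W[of n] show False by (simp add: ennreal_top_mult top_unique)
      qed
      have "posterior_ratio n x = (?f n (coding x) * posterior_ratio n x) * emeasure \<mu> (cball (coding x) (r n))"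
        using pos by (simp add: mu.emeasure_eq_measure ac_simps ennreal_divide_times ennreal_times_divide mult_divide_eq_ennreal)
      also have "\<dots> \<le> ennreal (exp (e * real n)) * emeasure \<mu> (cball (coding x) (r n))"
        by (intro mult_right_mono le) simp
      finally show "posterior_ratio n x \<le> ennreal (exp (e * real n) * measure \<mu> (cball (coding x) (r n)))"
        by (simp add: mu.emeasure_eq_measure ennreal_mult)
    qed
  qed
qed

subsection \<open>Exact dimensionality\<close>

definition letter_entropy :: real where
  "letter_entropy = (\<Sum>i<l. - p i * ln (p i))"

definition lyapunov :: real where
  "lyapunov = (\<Sum>i<l. - p i * ln (\<rho> i))"

definition cond_entropy :: real where
  "cond_entropy = (\<Sum>i<l. \<integral>z. - posterior i z * ln (posterior i z) \<partial>\<mu>)"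

definition cross_entropy :: "(nat \<Rightarrow> 'a \<Rightarrow> real) \<Rightarrow> real" where
  "cross_entropy g = (\<Sum>i<l. \<integral>z. - posterior i z * ln (g i z) \<partial>\<mu>)"

lemma lyapunov_pos: "0 < lyapunov"
  unfolding lyapunov_def
proof (rule sum_pos)
  show "0 < - p i * ln (\<rho> i)" if "i \<in> {..<l}" for i
    using that ppos[of i] rho[of i] by (simp add: mult_pos_neg ln_less_zero)
qed (use l_pos in auto)

lemma posterior_const_integrable: "i < l \<Longrightarrow> integrable \<mu> (\<lambda>z. posterior i z * c)"
  using posterior_integrable by simp

lemma ln_cyl_ratio: "x \<in> space P \<Longrightarrow> ln (cyl_ratio n x) = (\<Sum>k<n. ln (\<rho> (x k)))"
proof -
  assume x: "x \<in> space P"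
  have "\<rho> (x k) \<noteq> 0" "0 < \<rho> (x k)" for k using rho[OF letter_less[OF x, of k]] by auto
  then show ?thesis unfolding cyl_ratio_def by (intro ln_prod) auto
qed

section \<open>Exponential rates along typical words\<close>

lemma AE_cyl_ratio_bounds:
  assumes "0 < e"
  shows "AE x in P. \<forall>\<^sub>F n in sequentially. exp (- (lyapunov + e) * real n) \<le> cyl_ratio n x"
    and "AE x in P. \<forall>\<^sub>F n in sequentially. cyl_ratio n x \<le> exp (- (lyapunov - e) * real n)"
proof -
  have "AE x in P. \<forall>\<^sub>F n in sequentially. (\<Sum>k<n. - ln (\<rho> (x k))) \<le> (lyapunov + e) * real n"
    by (rule birkhoff_sum_letter_coding_le[where F = "\<lambda>i z. - ln (\<rho> i)"])
       (use assms posterior_const_integrable in \<open>auto simp: integral_posterior lyapunov_def\<close>)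
  then show "AE x in P. \<forall>\<^sub>F n in sequentially. exp (- (lyapunov + e) * real n) \<le> cyl_ratio n x"
  proof (rule AE_mp, intro AE_I2 impI)
    fix x assume x: "x \<in> space P"
    assume "\<forall>\<^sub>F n in sequentially. (\<Sum>k<n. - ln (\<rho> (x k))) \<le> (lyapunov + e) * real n"
    then show "\<forall>\<^sub>F n in sequentially. exp (- (lyapunov + e) * real n) \<le> cyl_ratio n x"
    proof eventually_elim
      case (elim n)
      then have "- (lyapunov + e) * real n \<le> ln (cyl_ratio n x)"
        by (simp add: ln_cyl_ratio[OF x] sum_negf algebra_simps)
      then show ?case using cyl_ratio_pos[OF x] by (simp add: ln_ge_iff)
    qed
  qed
  have "AE x in P. \<forall>\<^sub>F n in sequentially. (\<Sum>k<n. ln (\<rho> (x k))) \<le> (- lyapunov + e) * real n"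
    by (rule birkhoff_sum_letter_coding_le[where F = "\<lambda>i z. ln (\<rho> i)"])
       (use assms posterior_const_integrable in \<open>auto simp: integral_posterior lyapunov_def sum_negf\<close>)
  then show "AE x in P. \<forall>\<^sub>F n in sequentially. cyl_ratio n x \<le> exp (- (lyapunov - e) * real n)"
  proof (rule AE_mp, intro AE_I2 impI)
    fix x assume x: "x \<in> space P"
    assume "\<forall>\<^sub>F n in sequentially. (\<Sum>k<n. ln (\<rho> (x k))) \<le> (- lyapunov + e) * real n"
    then show "\<forall>\<^sub>F n in sequentially. cyl_ratio n x \<le> exp (- (lyapunov - e) * real n)"
    proof eventually_elim
      case (elim n)
      then have "ln (cyl_ratio n x) \<le> - (lyapunov - e) * real n"
        by (simp add: ln_cyl_ratio[OF x])
      then have "exp (ln (cyl_ratio n x)) \<le> exp (- (lyapunov - e) * real n)" by simp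
      then show ?case using cyl_ratio_pos[OF x] by simp
    qed
  qed
qed

text \<open>One \<open>e\<close> comes from the ergodic sum, the other from turning an expectation
  into an almost sure bound. The random radius \<open>cyl_ratio n x\<close> is eventually at least
  the deterministic one, so passing to the latter only shrinks the ball.\<close>

lemma AE_cball_le:
  assumes g: "lipschitz_weights g L" and int: "\<And>i. i < l \<Longrightarrow> integrable \<mu> (\<lambda>z. posterior i z * ln (g i z))"
    and "0 < e"
  shows "AE z in \<mu>. \<forall>\<^sub>F n in sequentially.
    measure \<mu> (cball z (exp (- (lyapunov + e) * real n))) \<le> exp (- (letter_entropy - cross_entropy g - 2 * e) * real n)"
proof (subst AE_coding_iff[symmetric])
  show "{z. \<forall>\<^sub>F n in sequentially. measure \<mu> (cball z (exp (- (lyapunov + e) * real n)))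
      \<le> exp (- (letter_entropy - cross_entropy g - 2 * e) * real n)} \<in> sets borel"
    unfolding eventually_sequentially by measurable
  have gm: "\<And>i. i < l \<Longrightarrow> g i \<in> borel_measurable borel" and gpos: "\<And>i z. i < l \<Longrightarrow> 0 < g i z"
    using g by (auto simp: lipschitz_weights_def)
  define c where "c = cross_entropy g - letter_entropy + e"
  have int': "integrable \<mu> (\<lambda>z. posterior i z * (ln (p i) - ln (g i z)))" if "i < l" for i
    using int[OF that] posterior_const_integrable[OF that] by (simp add: right_diff_distrib)
  have "(\<Sum>i<l. \<integral>z. posterior i z * (ln (p i) - ln (g i z)) \<partial>\<mu>) = cross_entropy g - letter_entropy"
    using int posterior_const_integrable
    by (simp add: right_diff_distrib cross_entropy_def letter_entropy_def integral_posterior sum_subtractf sum_negf)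
  then have "AE x in P. \<forall>\<^sub>F n in sequentially.
      (\<Sum>k<n. ln (p (x k)) - ln (g (x k) (coding (seq_shift k x)))) \<le> c * real n"
    using \<open>0 < e\<close> gm int'
    by (intro birkhoff_sum_letter_coding_le[where F = "\<lambda>i z. ln (p i) - ln (g i z)"]) (auto simp: c_def)
  then show "AE x in P. \<forall>\<^sub>F n in sequentially.
    measure \<mu> (cball (coding x) (exp (- (lyapunov + e) * real n))) \<le> exp (- (letter_entropy - cross_entropy g - 2 * e) * real n)"
    using AE_cyl_ratio_bounds(1)[OF \<open>0 < e\<close>] AE_ball_measure_upper[OF g \<open>0 < e\<close>] AE_space
  proof eventually_elim
    case (elim x)
    from elim(1,2,3) show ?case
    proof eventually_elim
      case (elim n)
      let ?s = "\<Sum>k<n. ln (p (x k)) - ln (g (x k) (coding (seq_shift k x)))"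
      let ?m = "measure \<mu> (cball (coding x) (cyl_ratio n x))"
      have "weight_ratio g n x = exp (- ?s)"
        unfolding weight_ratio_def sum_negf[symmetric] exp_sum[OF finite_lessThan]
        using gpos ppos letter_less[OF \<open>x \<in> space P\<close>]
        by (intro prod.cong) (auto simp: exp_diff)
      then have "?m = exp ?s * (weight_ratio g n x * ?m)"
        by (simp add: mult.assoc[symmetric] flip: exp_add)
      also have "\<dots> \<le> exp (c * real n) * exp (e * real n)"
        using elim gpos ppos letter_less[OF \<open>x \<in> space P\<close>]
        by (intro mult_mono) (auto simp: weight_ratio_def order_less_imp_le intro!: mult_nonneg_nonneg prod_nonneg divide_nonneg_pos)
      also have "\<dots> = exp (- (letter_entropy - cross_entropy g - 2 * e) * real n)"
        unfolding c_def exp_add[symmetric] by (simp add: algebra_simps)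
      finally have "?m \<le> exp (- (letter_entropy - cross_entropy g - 2 * e) * real n)" .
      moreover have "measure \<mu> (cball (coding x) (exp (- (lyapunov + e) * real n))) \<le> ?m"
        using elim by (intro mu.finite_measure_mono) (auto simp: sets_mu)
      ultimately show ?case by linarith
    qed
  qed
qed

lemma phi_posterior_integrable:
  assumes "i < l"
  shows "integrable \<mu> (\<lambda>z. posterior i z * ln (posterior i z))"
proof (rule mu.integrable_const_bound[where B = 1])
  show "AE z in \<mu>. norm (posterior i z * ln (posterior i z)) \<le> 1"
  proof (rule AE_I2)
    fix z
    have q: "0 \<le> posterior i z" "posterior i z \<le> 1"
      using posterior_nonneg posterior_le_1[OF assms] by auto
    show "norm (posterior i z * ln (posterior i z)) \<le> 1"
    proof (cases "posterior i z = 0")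
      case False
      then have "0 < posterior i z" using q by simp
      then have "- ln (posterior i z) \<le> 1 / posterior i z - 1"
        using ln_le_minus_one[of "1 / posterior i z"] by (simp add: ln_div)
      then have "posterior i z * (- ln (posterior i z)) \<le> posterior i z * (1 / posterior i z - 1)"
        using q by (intro mult_left_mono)
      moreover have "posterior i z * ln (posterior i z) \<le> 0"
        using \<open>0 < posterior i z\<close> q by (intro mult_nonneg_nonpos) auto
      ultimately show ?thesis
        using False q by (simp add: right_diff_distrib)
    qed simp
  qed
  show "(\<lambda>z. posterior i z * ln (posterior i z)) \<in> borel_measurable \<mu>"
    by measurable
qed

text \<open>The same bookkeeping from below, with deterministic radii large enough to meet the
  premise of \<open>AE_ball_measure_lower\<close>. The true posteriors serve as weights here, so
  \<open>cond_entropy\<close> appears directly.\<close>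

lemma AE_cball_ge:
  assumes "0 < e"
  shows "AE z in \<mu>. \<forall>\<^sub>F n in sequentially.
    exp (- (letter_entropy - cond_entropy + 2 * e) * real n) \<le> measure \<mu> (cball z (diam_bound * exp (- (lyapunov - e) * real n)))"
proof (subst AE_coding_iff[symmetric])
  let ?r = "\<lambda>n. diam_bound * exp (- (lyapunov - e) * real n)"
  show "{z. \<forall>\<^sub>F n in sequentially. exp (- (letter_entropy - cond_entropy + 2 * e) * real n) \<le> measure \<mu> (cball z (?r n))}
    \<in> sets borel"
    unfolding eventually_sequentially by measurable
  define c where "c = letter_entropy - cond_entropy + e"
  have int': "integrable \<mu> (\<lambda>z. posterior i z * (ln (posterior i z) - ln (p i)))" if "i < l" for i
    using phi_posterior_integrable[OF that] posterior_const_integrable[OF that] by (simp add: right_diff_distrib)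
  have "(\<Sum>i<l. \<integral>z. posterior i z * (ln (posterior i z) - ln (p i)) \<partial>\<mu>) = letter_entropy - cond_entropy"
    using phi_posterior_integrable posterior_const_integrable
    by (simp add: right_diff_distrib cond_entropy_def letter_entropy_def integral_posterior sum_subtractf sum_negf)
  then have "AE x in P. \<forall>\<^sub>F n in sequentially.
      (\<Sum>k<n. ln (posterior (x k) (coding (seq_shift k x))) - ln (p (x k))) \<le> c * real n"
    using \<open>0 < e\<close> int'
    by (intro birkhoff_sum_letter_coding_le[where F = "\<lambda>i z. ln (posterior i z) - ln (p i)"]) (auto simp: c_def)
  moreover have "AE x in P. \<forall>\<^sub>F n in sequentially. diam_bound * cyl_ratio n x \<le> ?r n \<longrightarrow>
      posterior_ratio n x \<le> ennreal (exp (e * real n) * measure \<mu> (cball (coding x) (?r n)))"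
    using diam_bound_pos by (intro AE_ball_measure_lower[OF \<open>0 < e\<close>]) simp
  ultimately show "AE x in P. \<forall>\<^sub>F n in sequentially.
    exp (- (letter_entropy - cond_entropy + 2 * e) * real n) \<le> measure \<mu> (cball (coding x) (?r n))"
    using AE_cyl_ratio_bounds(2)[OF \<open>0 < e\<close>] AE_posterior_pos AE_space
  proof eventually_elim
    case (elim x)
    from elim(1,2,3) show ?case
    proof eventually_elim
      case (elim n)
      let ?s = "\<Sum>k<n. ln (posterior (x k) (coding (seq_shift k x))) - ln (p (x k))"
      let ?m = "measure \<mu> (cball (coding x) (?r n))"
      have "posterior_ratio n x = (\<Prod>k<n. ennreal (exp (- (ln (posterior (x k) (coding (seq_shift k x))) - ln (p (x k))))))"
        unfolding posterior_ratio_def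
      proof (rule prod.cong)
        fix k
        have "0 < p (x k)" "0 < posterior (x k) (coding (seq_shift k x))"
          using ppos letter_less[OF \<open>x \<in> space P\<close>] \<open>\<forall>k. 0 < posterior (x k) (coding (seq_shift k x))\<close> by auto
        then show "ennreal (p (x k)) / ennreal (posterior (x k) (coding (seq_shift k x)))
          = ennreal (exp (- (ln (posterior (x k) (coding (seq_shift k x))) - ln (p (x k)))))"
          by (simp add: divide_ennreal exp_diff)
      qed simp
      also have "\<dots> = ennreal (exp (- ?s))"
        unfolding sum_negf[symmetric] exp_sum[OF finite_lessThan] by (rule prod_ennreal) simp
      finally have "ennreal (exp (- ?s)) \<le> ennreal (exp (e * real n) * ?m)"
        using elim diam_bound_pos by simp
      then have "exp (- ?s) \<le> exp (e * real n) * ?m"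
        by (simp add: ennreal_le_iff)
      moreover have "exp (- (c * real n)) \<le> exp (- ?s)"
        using elim by simp
      ultimately have "exp (- (c * real n)) \<le> exp (e * real n) * ?m" by linarith
      then have "exp (- (e * real n)) * exp (- (c * real n)) \<le> exp (- (e * real n)) * (exp (e * real n) * ?m)"
        by (intro mult_left_mono) auto
      also have "\<dots> = ?m" by (simp add: mult.assoc[symmetric] flip: exp_add)
      also have "exp (- (e * real n)) * exp (- (c * real n)) = exp (- (letter_entropy - cond_entropy + 2 * e) * real n)"
        unfolding c_def exp_add[symmetric] by (simp add: algebra_simps)
      finally show ?case .
    qed
  qed
qed

text \<open>Required before logarithms of ball measures can be compared. With
  \<open>e = lyapunov / 2\<close> the radii in \<open>AE_cball_ge\<close> tend to zero, so every
  ball around a typical point contains one with a positive lower bound.\<close>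

lemma AE_measure_cball_pos: "AE z in \<mu>. \<forall>r>0. 0 < measure \<mu> (cball z r)"
proof -
  define e where "e = lyapunov / 2"
  have "0 < e" using lyapunov_pos by (simp add: e_def)
  from AE_cball_ge[OF this] show ?thesis
  proof eventually_elim
    case (elim z)
    show ?case
    proof (intro allI impI)
      fix r :: real assume "0 < r"
      have "(\<lambda>n. diam_bound * exp (- (lyapunov - e)) ^ n) \<longlonglongrightarrow> diam_bound * 0"
        using lyapunov_pos by (intro tendsto_intros LIMSEQ_power_zero) (simp add: e_def)
      then have "\<forall>\<^sub>F n in sequentially. diam_bound * exp (- (lyapunov - e)) ^ n < r"
        using \<open>0 < r\<close> by (intro order_tendstoD(2)) auto
      then have "\<forall>\<^sub>F n in sequentially. 0 < measure \<mu> (cball z r)"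
        using elim
      proof eventually_elim
        case (elim n)
        have "diam_bound * exp (- (lyapunov - e) * real n) \<le> r"
          using elim(1) by (simp add: exp_of_nat2_mult)
        then have "measure \<mu> (cball z (diam_bound * exp (- (lyapunov - e) * real n))) \<le> measure \<mu> (cball z r)"
          by (intro mu.finite_measure_mono) (auto simp: sets_mu)
        moreover have "0 < exp (- (letter_entropy - cond_entropy + 2 * e) * real n)" by simp
        ultimately show ?case using elim(2) by linarith
      qed
      then show "0 < measure \<mu> (cball z r)" by simp
    qed
  qed
qed

text \<open>Lipschitz approximations of the posteriors in L1 are clamped to \<open>[0, 1]\<close>,
  raised by \<open>c\<close> and normalised. Raising keeps them away from zero, where
  \<open>ln\<close> is not Lipschitz and a small L1 error could cost a large amount of
  entropy.\<close>

lemma ex_lipschitz_weights: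
  assumes "0 < e"
  shows "\<exists>g L. lipschitz_weights g L \<and> (\<forall>i<l. integrable \<mu> (\<lambda>z. posterior i z * ln (g i z))) \<and>
    cross_entropy g \<le> cond_entropy + e"
proof -
  have l: "0 < real l" using l_pos by simp
  \<comment> \<open>Raising by \<open>c\<close> will cost \<open>l * c = e / 2\<close>, and the L1
    error \<open>l * (1 / c + 1) * d = e / 2\<close>. The second factor grows as \<open>c\<close>
    shrinks, so \<open>c\<close> is fixed before \<open>d\<close>.\<close>
  define c where "c = e / (2 * real l)"
  have c: "0 < c" using assms l by (simp add: c_def)
  define d where "d = e / (2 * real l * (1 / c + 1))"
  have d: "0 < d" using assms l c by (simp add: d_def add_pos_pos)
  have "\<exists>u L. (\<forall>x y. \<bar>u x - u y\<bar> \<le> L * dist x y) \<and> integrable \<mu> u \<and> (\<integral>x. \<bar>posterior i x - u x\<bar> \<partial>\<mu>) < d"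
    if "i < l" for i
    by (intro lipschitz_dense_L1 posterior_integrable that d sets_mu mu.finite_measure_axioms)
  then obtain v L0 where v: "\<And>i x y. i < l \<Longrightarrow> \<bar>v i x - v i y\<bar> \<le> L0 i * dist x y"
    "\<And>i. i < l \<Longrightarrow> integrable \<mu> (v i)" "\<And>i. i < l \<Longrightarrow> (\<integral>x. \<bar>posterior i x - v i x\<bar> \<partial>\<mu>) < d"
    by metis
  \<comment> \<open>Clamping does not increase Lipschitz constants, nor the distance to a posterior,
    whose values lie in \<open>[0, 1]\<close>.\<close>
  define u where "u i x = max 0 (min 1 (v i x))" for i x
  have u01: "0 \<le> u i x" "u i x \<le> 1" for i x by (auto simp: u_def)
  have [measurable]: "u i \<in> borel_measurable borel" if "i < l" for i
    using v(2)[OF that] unfolding u_def by (auto simp: sets_mu cong: measurable_cong_sets)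
  have u_int: "integrable \<mu> (u i)" if "i < l" for i
    by (rule mu.integrable_const_bound[where B = 1]) (use u01 that in \<open>auto simp: abs_of_nonneg sets_mu cong: measurable_cong_sets\<close>)
  have u_dist: "(\<integral>x. \<bar>u i x - posterior i x\<bar> \<partial>\<mu>) \<le> d" if i: "i < l" for i
  proof -
    have "(\<integral>x. \<bar>u i x - posterior i x\<bar> \<partial>\<mu>) \<le> (\<integral>x. \<bar>posterior i x - v i x\<bar> \<partial>\<mu>)"
    proof (rule integral_mono)
      fix x
      show "\<bar>u i x - posterior i x\<bar> \<le> \<bar>posterior i x - v i x\<bar>"
        using posterior_nonneg[of i x] posterior_le_1[OF i, of x] unfolding u_def by linarith
    qed (use u_int[OF i] v(2)[OF i] posterior_integrable[OF i] in auto)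
    then show ?thesis using v(3)[OF i] by linarith
  qed
  define L where "L = (\<Sum>i<l. \<bar>L0 i\<bar>)"
  have L: "0 \<le> L" by (simp add: L_def sum_nonneg)
  have u_lip: "\<bar>u i x - u i y\<bar> \<le> \<bar>L0 i\<bar> * dist x y" if "i < l" for i x y
  proof -
    have "\<bar>u i x - u i y\<bar> \<le> \<bar>v i x - v i y\<bar>" unfolding u_def by linarith
    also have "\<dots> \<le> L0 i * dist x y" by (rule v(1)[OF that])
    also have "\<dots> \<le> \<bar>L0 i\<bar> * dist x y" by (intro mult_right_mono) auto
    finally show ?thesis .
  qed
  define U where "U x = (\<Sum>i<l. u i x + c)" for x
  have U_ge: "c \<le> u i x + c" "u i x + c \<le> U x" if "i < l" for i x
    unfolding U_def using that u01 c by (auto intro!: member_le_sum[of i "{..<l}" "\<lambda>i. u i x + c"] simp: add_nonneg_nonneg)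
  have U_pos: "c \<le> U x" for x using U_ge[OF l_pos, of x] by linarith
  have [measurable]: "U \<in> borel_measurable borel" unfolding U_def by (intro borel_measurable_sum) auto
  define g where "g i x = (u i x + c) / U x" for i x
  have ln_g: "ln (g i x) = ln (u i x + c) - ln (U x)" if "i < l" for i x
    unfolding g_def using U_ge[OF that, of x] c by (simp add: ln_div)
  have "lipschitz_weights g (L / c + L / c)"
    unfolding lipschitz_weights_def
  proof (intro conjI allI impI)
    show "0 \<le> L / c + L / c" using L c by simp
    show "g i \<in> borel_measurable borel" if "i < l" for i
      unfolding g_def using that by measurable
    show "0 < g i x" if "i < l" for i x
      unfolding g_def using U_ge[OF that, of x] c by (intro divide_pos_pos) auto
    show "(\<Sum>i<l. g i x) = 1" for x
      unfolding g_def sum_divide_distrib[symmetric] using U_pos[of x] c by (simp flip: U_def)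
    show "\<bar>ln (g i y) - ln (g i z)\<bar> \<le> (L / c + L / c) * dist y z" if i: "i < l" for i y z
    proof -
      have Li: "\<bar>L0 i\<bar> \<le> L" unfolding L_def using i by (intro member_le_sum) auto
      have "\<bar>ln (u i y + c) - ln (u i z + c)\<bar> \<le> \<bar>(u i y + c) - (u i z + c)\<bar> / c"
        using U_ge[OF i] by (intro abs_ln_diff_le c) auto
      also have "\<dots> \<le> L * dist y z / c"
        using u_lip[OF i, of y z] mult_right_mono[OF Li, of "dist y z"] c by (intro divide_right_mono) auto
      finally have 1: "\<bar>ln (u i y + c) - ln (u i z + c)\<bar> \<le> L * dist y z / c" .
      have "\<bar>ln (U y) - ln (U z)\<bar> \<le> \<bar>U y - U z\<bar> / c"
        by (intro abs_ln_diff_le c U_pos)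
      also have "\<dots> \<le> L * dist y z / c"
      proof (rule divide_right_mono)
        have "\<bar>U y - U z\<bar> = \<bar>\<Sum>i<l. u i y - u i z\<bar>"
          unfolding U_def by (simp flip: sum_subtractf)
        also have "\<dots> \<le> (\<Sum>i<l. \<bar>u i y - u i z\<bar>)" by (rule sum_abs)
        also have "\<dots> \<le> (\<Sum>i<l. \<bar>L0 i\<bar> * dist y z)" by (intro sum_mono u_lip) auto
        finally show "\<bar>U y - U z\<bar> \<le> L * dist y z" by (simp add: L_def sum_distrib_right)
      qed (use c in simp)
      finally have 2: "\<bar>ln (U y) - ln (U z)\<bar> \<le> L * dist y z / c" .
      have "\<bar>ln (g i y) - ln (g i z)\<bar> \<le> \<bar>ln (u i y + c) - ln (u i z + c)\<bar> + \<bar>ln (U y) - ln (U z)\<bar>"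
        unfolding ln_g[OF i] by linarith
      with 1 2 show ?thesis by (simp add: distrib_right)
    qed
  qed
  moreover have g_int: "integrable \<mu> (\<lambda>z. posterior i z * ln (g i z))" if i: "i < l" for i
  proof (rule mu.integrable_const_bound[where B = "\<bar>ln c\<bar> + \<bar>ln (1 + c)\<bar> + \<bar>ln (real l * (1 + c))\<bar>"])
    have "\<bar>posterior i z * ln (g i z)\<bar> \<le> \<bar>ln c\<bar> + \<bar>ln (1 + c)\<bar> + \<bar>ln (real l * (1 + c))\<bar>" for z
    proof -
      have 1: "ln c \<le> ln (u i z + c)" "ln (u i z + c) \<le> ln (1 + c)"
        using U_ge[OF i, of z] u01[of i z] c by (auto intro!: ln_mono)
      have "U z \<le> (\<Sum>i<l. 1 + c)" unfolding U_def by (intro sum_mono) (simp add: u01)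
      then have 2: "ln c \<le> ln (U z)" "ln (U z) \<le> ln (real l * (1 + c))"
        using U_pos[of z] c l by (auto intro!: ln_mono simp: algebra_simps)
      have "\<bar>posterior i z * ln (g i z)\<bar> \<le> 1 * \<bar>ln (g i z)\<bar>"
        unfolding abs_mult using posterior_nonneg[of i z] posterior_le_1[OF i, of z]
        by (intro mult_right_mono) auto
      moreover have "\<bar>ln (g i z)\<bar> \<le> \<bar>ln c\<bar> + \<bar>ln (1 + c)\<bar> + \<bar>ln (real l * (1 + c))\<bar>"
        unfolding ln_g[OF i] using 1 2 by linarith
      ultimately show ?thesis by linarith
    qed
    then show "AE z in \<mu>. norm (posterior i z * ln (g i z)) \<le> \<bar>ln c\<bar> + \<bar>ln (1 + c)\<bar> + \<bar>ln (real l * (1 + c))\<bar>"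
      by simp
    show "(\<lambda>z. posterior i z * ln (g i z)) \<in> borel_measurable \<mu>"
      unfolding g_def using i by (simp add: sets_mu cong: measurable_cong_sets)
  qed
  moreover have "cross_entropy g \<le> cond_entropy + e"
  proof -
    have pt: "(\<Sum>i<l. - posterior i z * ln (g i z))
        \<le> (\<Sum>i<l. - posterior i z * ln (posterior i z) + (1 / c + 1) * \<bar>u i z - posterior i z\<bar> + c)" for z
    proof -
      have summand: "- posterior i z * ln (u i z + c)
          \<le> - posterior i z * ln (posterior i z) + (1 / c) * \<bar>u i z - posterior i z\<bar>" if i: "i < l" for i
      proof (cases "posterior i z = 0")
        case False
        then have q: "0 < posterior i z" using posterior_nonneg[of i z] by simp
        \<comment> \<open>Raising the posterior as well can only enlarge the difference, and it puts
          both arguments above \<open>c\<close>, where \<open>ln\<close> has Lipschitz constant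
          \<open>1 / c\<close>.\<close>
        have "ln (posterior i z) - ln (u i z + c) \<le> ln (posterior i z + c) - ln (u i z + c)"
          using q c by simp
        also have "\<dots> \<le> \<bar>(posterior i z + c) - (u i z + c)\<bar> / c"
          using abs_ln_diff_le[OF c, of "posterior i z + c" "u i z + c"] q u01[of i z] by simp
        finally have "posterior i z * (ln (posterior i z) - ln (u i z + c)) \<le> posterior i z * (\<bar>u i z - posterior i z\<bar> / c)"
          using q by (intro mult_left_mono) (auto simp: abs_minus_commute)
        also have "\<dots> \<le> 1 * (\<bar>u i z - posterior i z\<bar> / c)"
          using posterior_le_1[OF i, of z] c by (intro mult_right_mono) auto
        finally show ?thesis by (simp add: algebra_simps)
      qed (use c in simp)
      \<comment> \<open>The cost of normalising: since the posteriors sum to one,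
        \<open>U z - 1\<close> consists of approximation errors and copies of \<open>c\<close>
        only.\<close>
      have "ln (U z) \<le> U z - 1" using U_pos[of z] c by (intro ln_le_minus_one) simp
      also have "\<dots> = (\<Sum>i<l. u i z + c - posterior i z)"
        unfolding U_def sum_subtractf posterior_sum by simp
      also have "\<dots> \<le> (\<Sum>i<l. \<bar>u i z - posterior i z\<bar> + c)" by (intro sum_mono) linarith
      finally have lnU: "ln (U z) \<le> (\<Sum>i<l. \<bar>u i z - posterior i z\<bar> + c)" .
      have "(\<Sum>i<l. - posterior i z * ln (g i z)) = (\<Sum>i<l. - posterior i z * ln (u i z + c) + posterior i z * ln (U z))"
        by (intro sum.cong) (auto simp: ln_g algebra_simps)
      also have "\<dots> = (\<Sum>i<l. - posterior i z * ln (u i z + c)) + (\<Sum>i<l. posterior i z) * ln (U z)"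
        by (simp only: sum.distrib sum_distrib_right)
      also have "\<dots> \<le> (\<Sum>i<l. - posterior i z * ln (posterior i z) + (1 / c) * \<bar>u i z - posterior i z\<bar>)
          + (\<Sum>i<l. \<bar>u i z - posterior i z\<bar> + c)"
        unfolding posterior_sum using lnU by (intro add_mono sum_mono summand) auto
      also have "\<dots> = (\<Sum>i<l. - posterior i z * ln (posterior i z) + (1 / c + 1) * \<bar>u i z - posterior i z\<bar> + c)"
        by (simp add: sum.distrib[symmetric] algebra_simps)
      finally show ?thesis .
    qed
    have i1: "integrable \<mu> (\<lambda>z. - posterior i z * ln (g i z))" if "i < l" for i
      using g_int[OF that] by simp
    have i2: "integrable \<mu> (\<lambda>z. - posterior i z * ln (posterior i z))" if "i < l" for i
      using phi_posterior_integrable[OF that] by simp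
    have i3: "integrable \<mu> (\<lambda>z. (1 / c + 1) * \<bar>u i z - posterior i z\<bar>)" if "i < l" for i
      using u_int[OF that] posterior_integrable[OF that]
      by (intro integrable_mult_right integrable_abs Bochner_Integration.integrable_diff)
    have "cross_entropy g = (\<integral>z. (\<Sum>i<l. - posterior i z * ln (g i z)) \<partial>\<mu>)"
      unfolding cross_entropy_def by (intro Bochner_Integration.integral_sum[symmetric] i1) simp
    also have "\<dots> \<le> (\<integral>z. (\<Sum>i<l. - posterior i z * ln (posterior i z) + (1 / c + 1) * \<bar>u i z - posterior i z\<bar> + c) \<partial>\<mu>)"
      by (intro integral_mono pt Bochner_Integration.integrable_sum Bochner_Integration.integrable_add i1 i2 i3) auto
    also have "\<dots> = (\<Sum>i<l. \<integral>z. - posterior i z * ln (posterior i z) + (1 / c + 1) * \<bar>u i z - posterior i z\<bar> + c \<partial>\<mu>)"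
      by (intro Bochner_Integration.integral_sum Bochner_Integration.integrable_add i2 i3) auto
    also have "\<dots> = (\<Sum>i<l. (\<integral>z. - posterior i z * ln (posterior i z) \<partial>\<mu>) + (1 / c + 1) * (\<integral>z. \<bar>u i z - posterior i z\<bar> \<partial>\<mu>) + c)"
    proof (rule sum.cong)
      fix i assume "i \<in> {..<l}"
      then have i: "i < l" by simp
      have "(\<integral>z. - posterior i z * ln (posterior i z) + (1 / c + 1) * \<bar>u i z - posterior i z\<bar> + c \<partial>\<mu>)
        = (\<integral>z. - posterior i z * ln (posterior i z) + (1 / c + 1) * \<bar>u i z - posterior i z\<bar> \<partial>\<mu>) + (\<integral>z. c \<partial>\<mu>)"
        by (intro Bochner_Integration.integral_add Bochner_Integration.integrable_add i2[OF i] i3[OF i]) simp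
      also have "(\<integral>z. - posterior i z * ln (posterior i z) + (1 / c + 1) * \<bar>u i z - posterior i z\<bar> \<partial>\<mu>)
        = (\<integral>z. - posterior i z * ln (posterior i z) \<partial>\<mu>) + (\<integral>z. (1 / c + 1) * \<bar>u i z - posterior i z\<bar> \<partial>\<mu>)"
        by (intro Bochner_Integration.integral_add i2[OF i] i3[OF i])
      finally show "(\<integral>z. - posterior i z * ln (posterior i z) + (1 / c + 1) * \<bar>u i z - posterior i z\<bar> + c \<partial>\<mu>)
        = (\<integral>z. - posterior i z * ln (posterior i z) \<partial>\<mu>) + (1 / c + 1) * (\<integral>z. \<bar>u i z - posterior i z\<bar> \<partial>\<mu>) + c"
        using mu.prob_space by simp
    qed simp
    also have "\<dots> \<le> (\<Sum>i<l. (\<integral>z. - posterior i z * ln (posterior i z) \<partial>\<mu>) + (1 / c + 1) * d + c)"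
      using c by (intro sum_mono add_right_mono add_left_mono mult_left_mono u_dist) (auto simp: add_nonneg_nonneg)
    also have "\<dots> = cond_entropy + real l * ((1 / c + 1) * d) + real l * c"
      by (simp only: sum.distrib cond_entropy_def sum_constant card_lessThan)
    also have "real l * c = e / 2" using l by (simp add: c_def)
    also have "real l * ((1 / c + 1) * d) = e / 2"
    proof -
      have "1 / c + 1 \<noteq> 0" using c by (simp add: add_pos_pos[THEN less_imp_neq, symmetric])
      then show ?thesis using l by (simp add: d_def)
    qed
    finally show ?thesis by simp
  qed
  ultimately show ?thesis by blast
qed

section \<open>Almost sure limits of the local ratios\<close>

definition dimension :: real where
  "dimension = (letter_entropy - cond_entropy) / lyapunov"

lemma AE_ratio_gt:
  assumes "c < dimension"
  shows "AE z in \<mu>. \<forall>\<^sub>F r in at_right 0. c < ln (measure \<mu> (cball z r)) / ln r"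
proof -
  \<comment> \<open>Two of the three \<open>e\<close> come from \<open>AE_cball_le\<close>, the
    third from replacing \<open>cond_entropy\<close> by a cross entropy. Continuity of the quotient
    at zero makes the total loss as small as desired.\<close>
  have "((\<lambda>e. (letter_entropy - cond_entropy - 3 * e) / (lyapunov + e)) \<longlongrightarrow> (letter_entropy - cond_entropy - 3 * 0) / (lyapunov + 0)) (at_right 0)"
    using lyapunov_pos by (intro tendsto_intros) auto
  then have "\<forall>\<^sub>F e in at_right 0. c < (letter_entropy - cond_entropy - 3 * e) / (lyapunov + e)"
    using assms by (intro order_tendstoD(1)) (auto simp: dimension_def)
  then have "\<forall>\<^sub>F e in at_right 0. 0 < e \<and> c < (letter_entropy - cond_entropy - 3 * e) / (lyapunov + e)"
    using eventually_at_right_less by (rule eventually_conj[rotated])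
  then obtain e where e: "0 < e" "c < (letter_entropy - cond_entropy - 3 * e) / (lyapunov + e)"
    using eventually_happens'[OF trivial_limit_at_right_real] by blast
  obtain g L where g: "lipschitz_weights g L" "\<And>i. i < l \<Longrightarrow> integrable \<mu> (\<lambda>z. posterior i z * ln (g i z))"
    "cross_entropy g \<le> cond_entropy + e"
    using ex_lipschitz_weights[OF e(1)] by blast
  have "AE z in \<mu>. \<forall>\<^sub>F n in sequentially.
    measure \<mu> (cball z (exp (- (lyapunov + e) * real n))) \<le> exp (- (letter_entropy - cross_entropy g - 2 * e) * real n)"
    by (rule AE_cball_le) (use g e in auto)
  from this AE_measure_cball_pos show ?thesis
  proof eventually_elim
    case (elim z)
    show ?case
    proof (rule ratio_gt_from_geometric_radii[where C = 1 and k = "lyapunov + e" and a = "letter_entropy - cross_entropy g - 2 * e"])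
      show "measure \<mu> (cball z r) \<le> measure \<mu> (cball z s)" if "r \<le> s" for r s
        using that by (intro mu.finite_measure_mono) (auto simp: sets_mu)
      show "0 < measure \<mu> (cball z r)" if "0 < r" for r
        using that elim by blast
      show "0 < lyapunov + e" using e lyapunov_pos by simp
      show "\<forall>\<^sub>F n in sequentially. ln (measure \<mu> (cball z (1 * exp (- (lyapunov + e) * real n))))
          \<le> - (letter_entropy - cross_entropy g - 2 * e) * real n"
        using elim(1)
      proof eventually_elim
        case (elim n)
        have "0 < measure \<mu> (cball z (exp (- (lyapunov + e) * real n)))"
          using \<open>\<forall>r>0. 0 < measure \<mu> (cball z r)\<close> by simp
        then have "ln (measure \<mu> (cball z (exp (- (lyapunov + e) * real n)))) \<le> ln (exp (- (letter_entropy - cross_entropy g - 2 * e) * real n))"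
          using elim by (intro ln_mono) auto
        then show ?case by simp
      qed
      have "(letter_entropy - cond_entropy - 3 * e) / (lyapunov + e) \<le> (letter_entropy - cross_entropy g - 2 * e) / (lyapunov + e)"
        using g(3) e lyapunov_pos by (intro divide_right_mono) auto
      with e show "c < (letter_entropy - cross_entropy g - 2 * e) / (lyapunov + e)" by linarith
    qed simp
  qed
qed

lemma AE_ratio_less:
  assumes "dimension < c"
  shows "AE z in \<mu>. \<forall>\<^sub>F r in at_right 0. ln (measure \<mu> (cball z r)) / ln r < c"
proof -
  have "((\<lambda>e. (letter_entropy - cond_entropy + 2 * e) / (lyapunov - e)) \<longlongrightarrow> (letter_entropy - cond_entropy + 2 * 0) / (lyapunov - 0)) (at_right 0)"
    using lyapunov_pos by (intro tendsto_intros) auto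
  then have "\<forall>\<^sub>F e in at_right 0. (letter_entropy - cond_entropy + 2 * e) / (lyapunov - e) < c"
    using assms by (intro order_tendstoD(2)) (auto simp: dimension_def)
  \<comment> \<open>This keeps \<open>lyapunov - e\<close> positive, so that the radii in
    \<open>AE_cball_ge\<close> tend to zero.\<close>
  moreover have "\<forall>\<^sub>F e in at_right 0. e < lyapunov"
    using lyapunov_pos by (intro order_tendstoD(2)[OF tendsto_ident_at])
  ultimately have "\<forall>\<^sub>F e in at_right 0. 0 < e \<and> e < lyapunov \<and> (letter_entropy - cond_entropy + 2 * e) / (lyapunov - e) < c"
    using eventually_at_right_less[of "0::real"] by eventually_elim auto
  then obtain e where e: "0 < e" "e < lyapunov" "(letter_entropy - cond_entropy + 2 * e) / (lyapunov - e) < c"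
    using eventually_happens'[OF trivial_limit_at_right_real] by blast
  from AE_cball_ge[OF e(1)] AE_measure_cball_pos show ?thesis
  proof eventually_elim
    case (elim z)
    show ?case
    proof (rule ratio_less_from_geometric_radii[where C = diam_bound and k = "lyapunov - e" and a = "letter_entropy - cond_entropy + 2 * e"])
      show "measure \<mu> (cball z r) \<le> measure \<mu> (cball z s)" if "r \<le> s" for r s
        using that by (intro mu.finite_measure_mono) (auto simp: sets_mu)
      show "0 < measure \<mu> (cball z r)" if "0 < r" for r
        using that elim by blast
      show "\<forall>\<^sub>F n in sequentially. - (letter_entropy - cond_entropy + 2 * e) * real n
          \<le> ln (measure \<mu> (cball z (diam_bound * exp (- (lyapunov - e) * real n))))"
        using elim(1)
      proof eventually_elim
        case (elim n)
        then have "ln (exp (- (letter_entropy - cond_entropy + 2 * e) * real n)) \<le> ln (measure \<mu> (cball z (diam_bound * exp (- (lyapunov - e) * real n))))"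
          by (intro ln_mono) (auto intro: less_le_trans[OF exp_gt_zero])
        then show ?case by simp
      qed
    qed (use e diam_bound_pos in auto)
  qed
qed

lemma exact_dim_dimension: "exact_dim \<mu> dimension"
  unfolding exact_dim_def
proof -
  \<comment> \<open>Restricting to countably many tolerances lets one null set serve them
    all.\<close>
  have "AE z in \<mu>. \<forall>k::nat. (\<forall>\<^sub>F r in at_right 0. dimension - 1 / real (Suc k) < ln (measure \<mu> (cball z r)) / ln r) \<and>
      (\<forall>\<^sub>F r in at_right 0. ln (measure \<mu> (cball z r)) / ln r < dimension + 1 / real (Suc k))"
    unfolding AE_all_countable by (intro allI AE_conjI AE_ratio_gt AE_ratio_less) simp_all
  then show "AE z in \<mu>. ((\<lambda>r. ln (measure \<mu> (cball z r)) / ln r) \<longlongrightarrow> dimension) (at_right 0)"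
  proof eventually_elim
    case (elim z)
    show ?case
    proof (rule order_tendstoI)
      fix a assume "a < dimension"
      then obtain k :: nat where "1 / real (Suc k) < dimension - a"
        using reals_Archimedean[of "dimension - a"] by (auto simp: inverse_eq_divide)
      moreover have "\<forall>\<^sub>F r in at_right 0. dimension - 1 / real (Suc k) < ln (measure \<mu> (cball z r)) / ln r"
        using elim by blast
      ultimately show "\<forall>\<^sub>F r in at_right 0. a < ln (measure \<mu> (cball z r)) / ln r"
        by (auto elim!: eventually_mono)
    next
      fix a assume "dimension < a"
      then obtain k :: nat where "1 / real (Suc k) < a - dimension"
        using reals_Archimedean[of "a - dimension"] by (auto simp: inverse_eq_divide)
      moreover have "\<forall>\<^sub>F r in at_right 0. ln (measure \<mu> (cball z r)) / ln r < dimension + 1 / real (Suc k)"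
        using elim by blast
      ultimately show "\<forall>\<^sub>F r in at_right 0. ln (measure \<mu> (cball z r)) / ln r < a"
        by (auto elim!: eventually_mono)
    qed
  qed
qed

lemma dim_meas_eq: "dim_meas \<mu> = dimension"
  unfolding dim_meas_def
proof (rule the_equality)
  show "exact_dim \<mu> dimension" by (rule exact_dim_dimension)
  fix s assume "exact_dim \<mu> s"
  then have "AE x in \<mu>. ((\<lambda>r. ln (measure \<mu> (cball x r)) / ln r) \<longlongrightarrow> s) (at_right 0)"
    by (simp add: exact_dim_def)
  with exact_dim_dimension[unfolded exact_dim_def] have "AE x in \<mu>. s = dimension"
    by eventually_elim (auto intro: tendsto_unique[OF trivial_limit_at_right_real])
  then show "s = dimension" by simp
qed

subsection \<open>Entropy of partitions\<close>

definition partition_entropy :: "'a set set \<Rightarrow> real" where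
  "partition_entropy \<D> = (\<Sum>D\<in>\<D>. fent l (\<lambda>i. p i * measure \<mu> (S i -` D)))"

text \<open>Members may overlap in null sets and may together miss one. Outside these finitely many
  null sets exactly one member contains the point.\<close>

lemma AE_partition:
  assumes "borel_partition_wrt \<mu> \<D>"
  shows "AE z in \<mu>. (\<Sum>D\<in>\<D>. indicator D z) = (1 :: real)"
proof -
  have fin: "finite \<D>" and borel: "\<And>D. D \<in> \<D> \<Longrightarrow> D \<in> sets borel" and one: "measure \<mu> (\<Union>\<D>) = 1"
    and disj: "\<And>D D'. D \<in> \<D> \<Longrightarrow> D' \<in> \<D> \<Longrightarrow> D \<noteq> D' \<Longrightarrow> measure \<mu> (D \<inter> D') = 0"
    using assms by (auto simp: borel_partition_wrt_def)
  have un: "\<Union>\<D> \<in> sets \<mu>" using fin borel by (auto simp: sets_mu)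
  have "AE z in \<mu>. z \<in> \<Union>\<D>"
    using mu.AE_in_set_eq_1[OF un] one by simp
  moreover have "AE z in \<mu>. \<forall>D\<in>\<D>. \<forall>D'\<in>\<D>. D \<noteq> D' \<longrightarrow> z \<notin> D \<inter> D'"
  proof (intro AE_finite_allI fin)
    fix D D' assume D: "D \<in> \<D>" "D' \<in> \<D>"
    show "AE z in \<mu>. D \<noteq> D' \<longrightarrow> z \<notin> D \<inter> D'"
    proof (cases "D = D'")
      case False
      have "D \<inter> D' \<in> null_sets \<mu>"
        using borel[OF D(1)] borel[OF D(2)] disj[OF D False]
        by (auto simp: null_sets_def sets_mu mu.emeasure_eq_measure)
      from AE_not_in[OF this] show ?thesis by eventually_elim simp
    qed simp
  qed
  ultimately show ?thesis
  proof eventually_elim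
    case (elim z)
    then obtain D where D: "D \<in> \<D>" "z \<in> D" by blast
    have "(\<Sum>D'\<in>\<D>. indicator D' z) = (\<Sum>D'\<in>\<D>. if D' = D then 1 else (0::real))"
      using elim(2) D by (intro sum.cong) (auto simp: indicator_def)
    then show ?case using D fin by simp
  qed
qed

lemma integral_partition:
  fixes f :: "'a \<Rightarrow> real"
  assumes part: "borel_partition_wrt \<mu> \<D>" and f: "integrable \<mu> f"
  shows "(\<integral>z. f z \<partial>\<mu>) = (\<Sum>D\<in>\<D>. \<integral>z. indicator D z * f z \<partial>\<mu>)"
proof -
  have D: "D \<in> sets \<mu>" if "D \<in> \<D>" for D
    using part that by (auto simp: borel_partition_wrt_def sets_mu)
  have int: "integrable \<mu> (\<lambda>z. indicator D z * f z)" if "D \<in> \<D>" for D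
    using integrable_mult_indicator[OF D[OF that] f] by simp
  have "(\<integral>z. f z \<partial>\<mu>) = (\<integral>z. (\<Sum>D\<in>\<D>. indicator D z * f z) \<partial>\<mu>)"
  proof (rule integral_cong_AE)
    show "f \<in> borel_measurable \<mu>" using f by simp
    show "(\<lambda>z. \<Sum>D\<in>\<D>. indicator D z * f z) \<in> borel_measurable \<mu>"
      using int by (intro borel_measurable_sum) auto
    show "AE z in \<mu>. f z = (\<Sum>D\<in>\<D>. indicator D z * f z)"
      using AE_partition[OF part] by eventually_elim (simp flip: sum_distrib_right)
  qed
  also have "\<dots> = (\<Sum>D\<in>\<D>. \<integral>z. indicator D z * f z \<partial>\<mu>)"
    using int by (intro Bochner_Integration.integral_sum)
  finally show ?thesis .
qed

text \<open>Concavity of entropy by way of Gibbs' inequality: on \<open>D\<close> the entropy of the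
  posteriors is at most their cross entropy against the fixed vector of averages
  \<open>x i / s\<close>, and integrating that cross entropy over \<open>D\<close> gives exactly
  \<open>fent l x\<close>.\<close>

lemma cond_entropy_le_partition:
  assumes part: "borel_partition_wrt \<mu> \<D>"
  shows "cond_entropy \<le> partition_entropy \<D>"
proof -
  let ?f = "\<lambda>z. \<Sum>i<l. - posterior i z * ln (posterior i z)"
  have int: "integrable \<mu> (\<lambda>z. - posterior i z * ln (posterior i z))" if "i < l" for i
    using phi_posterior_integrable[OF that] by simp
  then have f_int: "integrable \<mu> ?f" by (intro Bochner_Integration.integrable_sum) auto
  have "cond_entropy = (\<integral>z. ?f z \<partial>\<mu>)"
    unfolding cond_entropy_def by (rule Bochner_Integration.integral_sum[symmetric]) (rule int, simp)
  also have "\<dots> = (\<Sum>D\<in>\<D>. \<integral>z. indicator D z * ?f z \<partial>\<mu>)"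
    by (rule integral_partition[OF part f_int])
  also have "\<dots> \<le> partition_entropy \<D>"
    unfolding partition_entropy_def
  proof (rule sum_mono)
    fix D assume "D \<in> \<D>"
    then have D: "D \<in> sets borel" using part by (auto simp: borel_partition_wrt_def)
    define x where "x i = p i * measure \<mu> (S i -` D)" for i
    define s where "s = (\<Sum>i<l. x i)"
    have x: "0 \<le> x i" if "i < l" for i using ppos[OF that] by (simp add: x_def)
    have Dq_int: "integrable \<mu> (\<lambda>z. indicator D z * posterior i z)" if "i < l" for i
      using integrable_mult_indicator[of D \<mu> "posterior i"] posterior_integrable[OF that] D sets_mu by simp
    have x_eq: "x i = (\<integral>z. indicator D z * posterior i z \<partial>\<mu>)" if "i < l" for i
      using integral_posterior_set[OF that D] by (simp add: x_def)
    have s: "0 \<le> s" unfolding s_def using x by (auto intro!: sum_nonneg)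
    \<comment> \<open>An average may vanish; the posterior then vanishes almost everywhere on
      \<open>D\<close>, which is the support condition of Gibbs' inequality.\<close>
    have "AE z in \<mu>. \<forall>i\<in>{..<l}. x i = 0 \<longrightarrow> indicator D z * posterior i z = 0"
    proof (intro AE_finite_allI finite_lessThan)
      fix i assume "i \<in> {..<l}"
      then have i: "i < l" by simp
      show "AE z in \<mu>. x i = 0 \<longrightarrow> indicator D z * posterior i z = 0"
        using integral_nonneg_eq_0_iff_AE[OF Dq_int[OF i]] posterior_nonneg x_eq[OF i]
        by (cases "x i = 0") auto
    qed
    then have le: "AE z in \<mu>. indicator D z * ?f z \<le> (\<Sum>i<l. (indicator D z * posterior i z) * (- ln (x i / s)))"
    proof eventually_elim
      case (elim z)
      show ?case
      proof (cases "z \<in> D")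
        case True
        have "?f z = fent l (\<lambda>i. posterior i z)"
          by (subst fent_eq) (simp_all add: posterior_nonneg posterior_sum)
        also have "\<dots> \<le> (\<Sum>i<l. - posterior i z * ln (x i / s))"
        proof (rule fent_le_cross_entropy)
          show "(\<Sum>i<l. x i / s) \<le> 1" by (simp flip: sum_divide_distrib s_def)
          show "posterior i z = 0" if i: "i < l" "x i / s = 0" for i
          proof -
            have "x i = 0"
            proof (rule ccontr)
              assume "x i \<noteq> 0"
              then have "0 < s" unfolding s_def using x i by (intro sum_pos2[of _ i]) (auto simp: order_less_le)
              with i \<open>x i \<noteq> 0\<close> show False by simp
            qed
            then show ?thesis using elim i True by auto
          qed
        qed (use x s posterior_nonneg in auto)
        finally show ?thesis using True by simp
      qed simp
    qed
    have "(\<integral>z. indicator D z * ?f z \<partial>\<mu>) \<le> (\<integral>z. (\<Sum>i<l. (indicator D z * posterior i z) * (- ln (x i / s))) \<partial>\<mu>)"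
    proof (rule integral_mono_AE[OF _ _ le])
      show "integrable \<mu> (\<lambda>z. indicator D z * ?f z)"
        using integrable_mult_indicator[of D \<mu> ?f] f_int D sets_mu by simp
      show "integrable \<mu> (\<lambda>z. \<Sum>i<l. (indicator D z * posterior i z) * (- ln (x i / s)))"
        using Dq_int by (intro Bochner_Integration.integrable_sum integrable_mult_left) auto
    qed
    also have "\<dots> = (\<Sum>i<l. \<integral>z. (indicator D z * posterior i z) * (- ln (x i / s)) \<partial>\<mu>)"
      using Dq_int by (intro Bochner_Integration.integral_sum integrable_mult_left) auto
    also have "\<dots> = (\<Sum>i<l. - x i * ln (x i / s))"
      using x_eq by (intro sum.cong refl) simp
    also have "\<dots> = fent l x"
      using x by (subst fent_eq) (simp_all add: s_def)
    finally show "(\<integral>z. indicator D z * ?f z \<partial>\<mu>) \<le> fent l (\<lambda>i. p i * measure \<mu> (S i -` D))"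
      by (simp add: x_def[abs_def])
  qed
  finally show ?thesis .
qed

text \<open>Gibbs' inequality is applied to the integrals of the posteriors over \<open>D\<close>,
  with the weights frozen at one point \<open>y\<close> of \<open>D\<close>. Moving them to the
  running point costs \<open>L * d\<close> times the posteriors, which sum to one.\<close>

lemma partition_entropy_le_cross_entropy:
  assumes part: "borel_partition_wrt \<mu> \<D>" and g: "lipschitz_weights g L"
    and int: "\<And>i. i < l \<Longrightarrow> integrable \<mu> (\<lambda>z. posterior i z * ln (g i z))"
    and small: "\<And>D y z. D \<in> \<D> \<Longrightarrow> y \<in> D \<Longrightarrow> z \<in> D \<Longrightarrow> dist y z \<le> d"
  shows "partition_entropy \<D> \<le> cross_entropy g + L * d"
proof -
  have gpos: "\<And>i z. i < l \<Longrightarrow> 0 < g i z" and L: "0 \<le> L" and gsum: "\<And>z. (\<Sum>i<l. g i z) = 1"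
    and lip: "\<And>i y z. i < l \<Longrightarrow> \<bar>ln (g i y) - ln (g i z)\<bar> \<le> L * dist y z"
    using g by (auto simp: lipschitz_weights_def)
  let ?f = "\<lambda>z. (\<Sum>i<l. - posterior i z * ln (g i z)) + L * d"
  have int': "integrable \<mu> (\<lambda>z. - posterior i z * ln (g i z))" if "i < l" for i
    using int[OF that] by simp
  have f_int: "integrable \<mu> ?f"
    using int' by (intro Bochner_Integration.integrable_add Bochner_Integration.integrable_sum) auto
  have "partition_entropy \<D> \<le> (\<Sum>D\<in>\<D>. \<integral>z. indicator D z * ?f z \<partial>\<mu>)"
    unfolding partition_entropy_def
  proof (rule sum_mono)
    fix D assume "D \<in> \<D>"
    then have D: "D \<in> sets borel" using part by (auto simp: borel_partition_wrt_def)
    show "fent l (\<lambda>i. p i * measure \<mu> (S i -` D)) \<le> (\<integral>z. indicator D z * ?f z \<partial>\<mu>)"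
    \<comment> \<open>An empty member offers no reference point, but contributes zero.\<close>
    proof (cases "D = {}")
      case True
      then show ?thesis by (simp add: fent_def)
    next
      case False
      then obtain y where y: "y \<in> D" by blast
      have Dq_int: "integrable \<mu> (\<lambda>z. indicator D z * posterior i z)" if "i < l" for i
        using integrable_mult_indicator[of D \<mu> "posterior i"] posterior_integrable[OF that] D sets_mu by simp
      have "fent l (\<lambda>i. p i * measure \<mu> (S i -` D)) \<le> (\<Sum>i<l. - (p i * measure \<mu> (S i -` D)) * ln (g i y))"
      proof (rule fent_le_cross_entropy)
        show "p i * measure \<mu> (S i -` D) = 0" if "i < l" "g i y = 0" for i
          using gpos[OF that(1), of y] that(2) by simp
      qed (use gpos gsum ppos in \<open>auto simp: order_less_imp_le\<close>)
      also have "\<dots> = (\<Sum>i<l. \<integral>z. (indicator D z * posterior i z) * (- ln (g i y)) \<partial>\<mu>)"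
        using integral_posterior_set[OF _ D] by (intro sum.cong refl) simp
      also have "\<dots> = (\<integral>z. (\<Sum>i<l. (indicator D z * posterior i z) * (- ln (g i y))) \<partial>\<mu>)"
        using Dq_int by (intro Bochner_Integration.integral_sum[symmetric] integrable_mult_left) auto
      also have "\<dots> \<le> (\<integral>z. indicator D z * ?f z \<partial>\<mu>)"
      proof (rule integral_mono)
        show "integrable \<mu> (\<lambda>z. \<Sum>i<l. (indicator D z * posterior i z) * (- ln (g i y)))"
          using Dq_int by (intro Bochner_Integration.integrable_sum integrable_mult_left) auto
        show "integrable \<mu> (\<lambda>z. indicator D z * ?f z)"
          using integrable_mult_indicator[of D \<mu> ?f] f_int D sets_mu by simp
        fix z
        show "(\<Sum>i<l. (indicator D z * posterior i z) * (- ln (g i y))) \<le> indicator D z * ?f z"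
        proof (cases "z \<in> D")
          case True
          have "posterior i z * (- ln (g i y)) \<le> - posterior i z * ln (g i z) + posterior i z * (L * d)"
            if i: "i < l" for i
          proof -
            have "L * dist z y \<le> L * d"
              using small[OF \<open>D \<in> \<D>\<close> True y] L by (rule mult_left_mono)
            then have "- ln (g i y) \<le> - ln (g i z) + L * d"
              using lip[OF i, of z y] by linarith
            from mult_left_mono[OF this posterior_nonneg[of i z]] show ?thesis by (simp add: algebra_simps)
          qed
          then have "(\<Sum>i<l. posterior i z * (- ln (g i y))) \<le> (\<Sum>i<l. - posterior i z * ln (g i z) + posterior i z * (L * d))"
            by (intro sum_mono) auto
          also have "\<dots> = ?f z"
            unfolding sum.distrib sum_distrib_right[symmetric] posterior_sum by simp
          finally show ?thesis using True by simp
        qed simp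
      qed
      finally show ?thesis .
    qed
  qed
  also have "\<dots> = (\<integral>z. ?f z \<partial>\<mu>)"
    by (rule integral_partition[OF part f_int, symmetric])
  also have "\<dots> = (\<integral>z. (\<Sum>i<l. - posterior i z * ln (g i z)) \<partial>\<mu>) + (\<integral>z. L * d \<partial>\<mu>)"
    using int' by (intro Bochner_Integration.integral_add Bochner_Integration.integrable_sum) auto
  also have "(\<integral>z. (\<Sum>i<l. - posterior i z * ln (g i z)) \<partial>\<mu>) = cross_entropy g"
    unfolding cross_entropy_def using int' by (intro Bochner_Integration.integral_sum) auto
  finally show ?thesis using mu.prob_space by simp
qed

lemma partition_entropy_tendsto:
  assumes part: "\<And>n. borel_partition_wrt \<mu> (\<D>s n)"
    and diam: "(\<lambda>n. Max (ediam ` \<D>s n)) \<longlonglongrightarrow> 0"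
  shows "(\<lambda>n. partition_entropy (\<D>s n)) \<longlonglongrightarrow> cond_entropy"
proof (rule order_tendstoI)
  fix a assume "a < cond_entropy"
  then show "\<forall>\<^sub>F n in sequentially. a < partition_entropy (\<D>s n)"
    using cond_entropy_le_partition[OF part] by (auto intro: always_eventually less_le_trans)
next
  fix a assume a: "cond_entropy < a"
  define e where "e = (a - cond_entropy) / 2"
  have "0 < e" using a by (simp add: e_def)
  then obtain g L where g: "lipschitz_weights g L" "\<And>i. i < l \<Longrightarrow> integrable \<mu> (\<lambda>z. posterior i z * ln (g i z))"
    "cross_entropy g \<le> cond_entropy + e"
    using ex_lipschitz_weights by blast
  have L: "0 \<le> L" using g(1) by (simp add: lipschitz_weights_def)
  \<comment> \<open>Dividing by \<open>L + 1\<close> makes \<open>L * d < e\<close> also when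
    \<open>L = 0\<close>.\<close>
  define d where "d = e / (L + 1)"
  have "0 < d" using \<open>0 < e\<close> L by (simp add: d_def)
  have Ld: "L * d < e" using \<open>0 < e\<close> L by (simp add: d_def field_simps)
  have "\<forall>\<^sub>F n in sequentially. Max (ediam ` \<D>s n) < ereal d"
    using \<open>0 < d\<close> by (intro order_tendstoD(2)[OF diam]) simp
  then show "\<forall>\<^sub>F n in sequentially. partition_entropy (\<D>s n) < a"
  proof eventually_elim
    case (elim n)
    have "dist y z \<le> d" if D: "D \<in> \<D>s n" "y \<in> D" "z \<in> D" for D y z
    proof -
      have "finite (\<D>s n)" using part[of n] by (simp add: borel_partition_wrt_def)
      then have "ediam D \<le> Max (ediam ` \<D>s n)" using D by (intro Max_ge) auto
      with elim have "ediam D < ereal d" by (rule le_less_trans[rotated])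
      \<comment> \<open>The infinite value of \<open>ediam\<close> on unbounded sets forces
        boundedness here, without which \<open>diameter\<close> would not control distances.\<close>
      then have "bounded D" "diameter D < d" by (auto simp: ediam_def split: if_splits)
      then show ?thesis using diameter_bounded_bound[of D y z] D by simp
    qed
    then have "partition_entropy (\<D>s n) \<le> cross_entropy g + L * d"
      by (intro partition_entropy_le_cross_entropy[OF part g(1,2)])
    then show ?case using g(3) Ld by (simp add: e_def field_simps)
  qed
qed

end

theorem theorem1p1:
  fixes l :: nat
    and S :: "nat \<Rightarrow> 'a::euclidean_space \<Rightarrow> 'a"
    and \<rho> p :: "nat \<Rightarrow> real"
    and \<mu> :: "'a measure"
  assumes sim: "\<And>i. i < l \<Longrightarrow> similarity_with (S i) (\<rho> i)"
    and rho: "\<And>i. i < l \<Longrightarrow> 0 < \<rho> i \<and> \<rho> i < 1"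
    and ppos: "\<And>i. i < l \<Longrightarrow> 0 < p i"
    and psum: "(\<Sum>i<l. p i) = 1"
    and mu: "self_similar_measure l S p \<mu>"
  shows
   "(\<forall>\<D>. borel_partition_wrt \<mu> \<D> \<longrightarrow>
       dim_meas \<mu> \<ge> ((\<Sum>i<l. - p i * ln (p i))
           - (\<Sum>D\<in>\<D>. fent l (\<lambda>i. p i * measure \<mu> (S i -` D))))
         / (\<Sum>i<l. - p i * ln (\<rho> i))
     \<and> (\<forall>y :: 'a set \<Rightarrow> nat \<Rightarrow> real.
          (\<forall>D\<in>\<D>. \<forall>i<l. 0 \<le> y D i \<and> p i * measure \<mu> (S i -` D) \<le> y D i) \<longrightarrow>
          dim_meas \<mu> \<ge> ((\<Sum>i<l. - p i * ln (p i)) - (\<Sum>D\<in>\<D>. fent l (y D)))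
            / (\<Sum>i<l. - p i * ln (\<rho> i))))
    \<and> (\<forall>\<D>s :: nat \<Rightarrow> 'a set set.
         (\<forall>n. borel_partition_wrt \<mu> (\<D>s n)) \<and>
         ((\<lambda>n. Max (ediam ` \<D>s n)) \<longlonglongrightarrow> 0) \<longrightarrow>
         (\<exists>L. ((\<lambda>n. \<Sum>D\<in>\<D>s n. fent l (\<lambda>i. p i * measure \<mu> (S i -` D))) \<longlonglongrightarrow> L) \<and>
              dim_meas \<mu> = ((\<Sum>i<l. - p i * ln (p i)) - L) / (\<Sum>i<l. - p i * ln (\<rho> i))))"
proof -
  interpret self_similar_ifs l S \<rho> p \<mu>
    by standard (use assms in auto)
  \<comment> \<open>The quotient decreases in the subtracted entropy, so for both inequalities of
    the first part it is enough to bound \<open>cond_entropy\<close> from above.\<close>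
  have dim_ge: "dim_meas \<mu> \<ge> (letter_entropy - X) / lyapunov" if "cond_entropy \<le> X" for X
    using that lyapunov_pos by (auto simp: dim_meas_eq dimension_def intro!: divide_right_mono)
  show ?thesis
    unfolding letter_entropy_def[symmetric] lyapunov_def[symmetric] partition_entropy_def[symmetric]
  proof (intro conjI allI impI)
    fix \<D> assume part: "borel_partition_wrt \<mu> \<D>"
    show "dim_meas \<mu> \<ge> (letter_entropy - partition_entropy \<D>) / lyapunov"
      by (intro dim_ge cond_entropy_le_partition part)
    fix y :: "'a set \<Rightarrow> nat \<Rightarrow> real"
    assume y: "\<forall>D\<in>\<D>. \<forall>i<l. 0 \<le> y D i \<and> p i * measure \<mu> (S i -` D) \<le> y D i"
    have "cond_entropy \<le> partition_entropy \<D>" by (rule cond_entropy_le_partition[OF part])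
    also have "\<dots> \<le> (\<Sum>D\<in>\<D>. fent l (y D))"
      unfolding partition_entropy_def
      using y ppos by (intro sum_mono fent_mono) (auto simp: order_less_imp_le)
    finally show "dim_meas \<mu> \<ge> (letter_entropy - (\<Sum>D\<in>\<D>. fent l (y D))) / lyapunov"
      by (rule dim_ge)
  next
    fix \<D>s :: "nat \<Rightarrow> 'a set set"
    assume "(\<forall>n. borel_partition_wrt \<mu> (\<D>s n)) \<and> (\<lambda>n. Max (ediam ` \<D>s n)) \<longlonglongrightarrow> 0"
    then have "(\<lambda>n. partition_entropy (\<D>s n)) \<longlonglongrightarrow> cond_entropy"
      by (intro partition_entropy_tendsto) auto
    then show "\<exists>L. (\<lambda>n. partition_entropy (\<D>s n)) \<longlonglongrightarrow> L \<and> dim_meas \<mu> = (letter_entropy - L) / lyapunov"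
      by (intro exI[of _ cond_entropy]) (simp add: dim_meas_eq dimension_def)
  qed
qed

end
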